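(* Let $n\ge 2$, let $M$ be an $(n-1)$-space group with trivial center, and let $\Delta$ be an infinite dihedral $1$-space group. The set $\mathrm{Iso}(\Delta,M)$ is in one-to-one correspondence with the set of conjugacy classes of pairs of elements of $\mathrm{Out}(M)$ of order $1$ or $2$ whose product has finite order. If $[\Gamma,N]\in\mathrm{Iso}(\Delta,M)$, $\alpha:N\to M$ is an isomorphism, and $\gamma_1,\gamma_2$ are elements of $\Gamma$ such that $\{N\gamma_1,N\gamma_2\}$ is a set of Coxeter generators of $\Gamma/N$, then $[\Gamma,N]$ corresponds to the conjugacy class of the pair of elements $\{\alpha(\gamma_1)_\ast\alpha^{-1}\mathrm{Inn}(M),\ \alpha(\gamma_2)_\ast\alpha^{-1}\mathrm{Inn}(M)\}$ of $\mathrm{Out}(M)$.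
   Context: A $k$-space group is a discrete group $\Gamma$ of isometries of Euclidean $k$-space $E^k$ such that the orbit space $E^k/\Gamma$ is compact. For a $1$-space group $\Delta$ and an $(n-1)$-space group $M$, $\mathrm{Iso}(\Delta,M)$ is the set of isomorphism classes $[\Gamma,N]$ of pairs $(\Gamma,N)$, where $\Gamma$ is an $n$-space group and $N$ is a normal subgroup of $\Gamma$ with $N$ isomorphic to $M$ and $\Gamma/N$ isomorphic to $\Delta$; two pairs $(\Gamma_1,N_1)$, $(\Gamma_2,N_2)$ are isomorphic if there is a group isomorphism $\phi:\Gamma_1\to\Gamma_2$ with $\phi(N_1)=N_2$. For $\gamma\in\Gamma$, $\gamma_\ast$ denotes the automorphism $\nu\mapsto\gamma\nu\gamma^{-1}$ of $N$. A set of Coxeter generators of an infinite dihedral group is a pair of elements of order $2$ that generate the group. $\mathrm{Out}(M)=\mathrm{Aut}(M)/\mathrm{Inn}(M)$. A pair $\{x,y\}$ is an unordered pair (possibly $x=y$). The conjugacy class of $\{x,y\}$ consists of all $\{gxg^{-1},gyg^{-1}\}$ with $g\in\mathrm{Out}(M)$. *)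

theory Defs
  imports "HOL-Analysis.Analysis" "HOL-Algebra.Group_Action" "HOL-Algebra.Elementary_Groups"
    "HOL-Algebra.Multiplicative_Group"
begin

definition isometry_group :: "('a::metric_space \<Rightarrow> 'a) monoid" where
  "isometry_group =
     \<lparr>carrier = {f. bij f \<and> (\<forall>x y. dist (f x) (f y) = dist x y)}, mult = (\<circ>), one = id\<rparr>"

abbreviation grp :: "('a::metric_space \<Rightarrow> 'a) set \<Rightarrow> ('a \<Rightarrow> 'a) monoid" where
  "grp \<Gamma> \<equiv> isometry_group\<lparr>carrier := \<Gamma>\<rparr>"

lemma group_isometry_group: "group (isometry_group :: ('a::metric_space \<Rightarrow> 'a) monoid)"
proof (rule groupI)
  fix f :: "'a \<Rightarrow> 'a" assume "f \<in> carrier isometry_group"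
  then have f: "bij f" "\<And>x y. dist (f x) (f y) = dist x y"
    by (auto simp: isometry_group_def)
  let ?h = "inv_into UNIV f"
  have "dist (?h x) (?h y) = dist x y" for x y
    using f(2)[of "?h x" "?h y"] f(1) by (simp add: bij_is_surj surj_f_inv_f)
  then have "?h \<in> carrier isometry_group"
    using f(1) by (auto simp: isometry_group_def bij_imp_bij_inv)
  moreover have "?h \<otimes>\<^bsub>isometry_group\<^esub> f = \<one>\<^bsub>isometry_group\<^esub>"
    using f(1) by (simp add: isometry_group_def bij_is_inj)
  ultimately show "\<exists>g\<in>carrier isometry_group. g \<otimes>\<^bsub>isometry_group\<^esub> f = \<one>\<^bsub>isometry_group\<^esub>"
    by blast
qed (auto simp: isometry_group_def bij_comp comp_assoc)

text \<open>
  The preimage under the orbit map of a set U of orbits is the union of U, so this is the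
  quotient topology.
\<close>

definition orbit_space :: "('a::metric_space \<Rightarrow> 'a) set \<Rightarrow> 'a set topology" where
  "orbit_space \<Gamma> = topology (\<lambda>U. U \<subseteq> orbits (grp \<Gamma>) UNIV (\<lambda>g. g) \<and> open (\<Union>U))"

text \<open>
  \<^const>\<open>discrete\<close> refers to the topology of pointwise convergence on the function type;
  on the isometries of Euclidean space it agrees with the compact-open topology.
\<close>

definition space_group :: "(real^'k \<Rightarrow> real^'k) set \<Rightarrow> bool" where
  "space_group \<Gamma> \<longleftrightarrow>
     subgroup \<Gamma> isometry_group \<and> discrete \<Gamma> \<and> compact_space (orbit_space \<Gamma>)"

lemma
  fixes \<Gamma> :: "('a::metric_space \<Rightarrow> 'a) set"
  assumes "subgroup \<Gamma> isometry_group"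
  shows openin_orbit_space:
      "openin (orbit_space \<Gamma>) U \<longleftrightarrow> U \<subseteq> orbits (grp \<Gamma>) UNIV (\<lambda>g. g) \<and> open (\<Union>U)" (is ?th1)
    and quotient_map_orbit_space:
      "quotient_map euclidean (orbit_space \<Gamma>) (orbit (grp \<Gamma>) (\<lambda>g. g))" (is ?th2)
proof -
  let ?O = "orbit (grp \<Gamma>) (\<lambda>g. g)" and ?S = "orbits (grp \<Gamma>) UNIV (\<lambda>g. g)"
  interpret G: group "isometry_group :: ('a \<Rightarrow> 'a) monoid" by (rule group_isometry_group)
  have orb: "?O x = (\<lambda>g. g x) ` \<Gamma>" for x by (auto simp: orbit_def)
  have S: "?S = range ?O" by (auto simp: orbits_def)
  have id: "id \<in> \<Gamma>"
    using subgroup.one_closed[OF assms] by (simp add: isometry_group_def)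
  have comp: "f \<circ> g \<in> \<Gamma>" if "f \<in> \<Gamma>" "g \<in> \<Gamma>" for f g
    using subgroup.m_closed[OF assms that] by (simp add: isometry_group_def)
  have inverse: "\<exists>h\<in>\<Gamma>. h \<circ> g = id" if "g \<in> \<Gamma>" for g
    using subgroup.m_inv_closed[OF assms that] G.l_inv[of g] subgroup.mem_carrier[OF assms that]
    by (auto simp: isometry_group_def)
  have self: "x \<in> ?O x" for x
    using rev_image_eqI[OF id, of x "\<lambda>g. g x"] by (simp add: orb)
  have eq: "?O y = ?O x" if y: "y \<in> ?O x" for x y
  proof -
    obtain g where g: "g \<in> \<Gamma>" "y = g x" using y by (auto simp: orb)
    obtain h where h: "h \<in> \<Gamma>" "h \<circ> g = id" using inverse[OF g(1)] by auto
    have x: "x = h y" using h(2) g(2) by (metis comp_apply id_apply)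
    show ?thesis
    proof
      show "?O y \<subseteq> ?O x"
      proof
        fix z assume "z \<in> ?O y"
        then obtain k where "k \<in> \<Gamma>" "z = (k \<circ> g) x" using g(2) by (auto simp: orb)
        then show "z \<in> ?O x" unfolding orb using comp[OF _ g(1)] by (intro image_eqI)
      qed
      show "?O x \<subseteq> ?O y"
      proof
        fix z assume "z \<in> ?O x"
        then obtain k where "k \<in> \<Gamma>" "z = (k \<circ> h) y" using x by (auto simp: orb)
        then show "z \<in> ?O y" unfolding orb using comp[OF _ h(1)] by (intro image_eqI)
      qed
    qed
  qed
  have Un: "\<Union>U = {x. ?O x \<in> U}" if U: "U \<subseteq> ?S" for U
  proof
    show "\<Union>U \<subseteq> {x. ?O x \<in> U}"
    proof
      fix x assume "x \<in> \<Union>U"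
      then obtain A where A: "A \<in> U" "x \<in> A" by blast
      then obtain z where "A = ?O z" using U unfolding S by blast
      then show "x \<in> {x. ?O x \<in> U}" using A eq[of x z] by simp
    qed
    show "{x. ?O x \<in> U} \<subseteq> \<Union>U" using self by blast
  qed
  have "istopology (\<lambda>U. U \<subseteq> ?S \<and> open (\<Union>U))"
    unfolding istopology_def
  proof (intro conjI allI impI)
    fix A B assume A: "A \<subseteq> ?S \<and> open (\<Union>A)" and B: "B \<subseteq> ?S \<and> open (\<Union>B)"
    show "A \<inter> B \<subseteq> ?S" using A by blast
    have "\<Union>(A \<inter> B) = \<Union>A \<inter> \<Union>B" using A B by (auto simp: Un le_infI1)
    then show "open (\<Union>(A \<inter> B))" using A B by (simp add: open_Int)
  next
    fix K assume K: "\<forall>U\<in>K. U \<subseteq> ?S \<and> open (\<Union>U)"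
    show "\<Union>K \<subseteq> ?S" using K by blast
    have "\<Union>(\<Union>K) = \<Union>(Union ` K)" by blast
    then show "open (\<Union>(\<Union>K))" using K by (metis (no_types, lifting) imageE open_Union)
  qed
  then show 1: "openin (orbit_space \<Gamma>) U \<longleftrightarrow> U \<subseteq> ?S \<and> open (\<Union>U)" for U
    by (simp add: orbit_space_def topology_inverse')
  have "\<Union>?S = UNIV" using self unfolding S by blast
  then have "openin (orbit_space \<Gamma>) ?S" by (simp add: 1)
  then have top: "topspace (orbit_space \<Gamma>) = ?S"
    unfolding topspace_def 1 by blast
  show ?th2
    unfolding quotient_map_def top 1
  proof (intro conjI allI impI)
    show "?O ` topspace euclidean = ?S" by (simp add: S)
    fix U assume U: "U \<subseteq> ?S"
    show "openin euclidean {x \<in> topspace euclidean. ?O x \<in> U} \<longleftrightarrow> U \<subseteq> ?S \<and> open (\<Union>U)"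
      using U by (simp add: Un[OF U])
  qed
qed

definition conj_map :: "('a, 'b) monoid_scheme \<Rightarrow> 'a set \<Rightarrow> 'a \<Rightarrow> 'a \<Rightarrow> 'a" where
  "conj_map G N g = (\<lambda>x\<in>N. g \<otimes>\<^bsub>G\<^esub> x \<otimes>\<^bsub>G\<^esub> inv\<^bsub>G\<^esub> g)"

definition Inn :: "('a, 'b) monoid_scheme \<Rightarrow> ('a \<Rightarrow> 'a) set" where
  "Inn G = conj_map G (carrier G) ` carrier G"

lemma (in group) Inn_normal: "Inn G \<lhd> AutoGroup G"
proof -
  let ?A = "AutoGroup G" and ?c = "conj_map G (carrier G)"
  interpret A: group ?A by (rule AutoGroup)
  have carr: "carrier ?A = auto G" by (simp add: AutoGroup_def)
  have mult: "f \<otimes>\<^bsub>?A\<^esub> g = compose (carrier G) f g" if "f \<in> auto G" "g \<in> auto G" for f g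
    using that by (auto simp: AutoGroup_def BijGroup_def auto_def)
  have multB: "x \<otimes>\<^bsub>?A\<^esub> y = x \<otimes>\<^bsub>BijGroup (carrier G)\<^esub> y" for x y by (simp add: AutoGroup_def)
  have c: "?c = (\<lambda>g. \<lambda>h\<in>carrier G. g \<otimes> h \<otimes> inv g)"
    by (auto simp: conj_map_def fun_eq_iff)
  have homB: "?c \<in> hom G (BijGroup (carrier G))"
    using conjugation_is_hom by (simp add: c)
  have "inv g \<otimes> (g \<otimes> x) = x" if "g \<in> carrier G" "x \<in> carrier G" for g x
    using that by (simp flip: m_assoc)
  then have c_hom: "?c g \<in> hom G G" if "g \<in> carrier G" for g
    using that by (auto simp: hom_def c m_assoc)
  have c_auto: "?c g \<in> auto G" if "g \<in> carrier G" for g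
    using that c_hom[OF that] homB by (auto simp: auto_def hom_def BijGroup_def)
  have hom: "?c \<in> hom G ?A"
    using homB c_auto by (auto simp: hom_def carr multB)
  then interpret c: group_hom G ?A ?c by unfold_locales
  have sub: "subgroup (Inn G) ?A"
    using c.img_is_subgroup by (simp add: Inn_def)
  have comm: "f \<otimes>\<^bsub>?A\<^esub> ?c g = ?c (f g) \<otimes>\<^bsub>?A\<^esub> f" if f: "f \<in> auto G" and g: "g \<in> carrier G" for f g
  proof -
    interpret f: group_hom G G f using f by unfold_locales (simp add: auto_def)
    show ?thesis
      using g unfolding mult[OF f c_auto[OF g]] mult[OF c_auto[OF f.hom_closed[OF g]] f]
      by (intro ext) (simp add: compose_def c)
  qed
  show ?thesis
  proof (rule A.normal_invI[OF sub])
    fix f h assume f: "f \<in> carrier ?A" and "h \<in> Inn G"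
    then obtain g where g: "g \<in> carrier G" "h = ?c g" by (auto simp: Inn_def)
    have fg: "f g \<in> carrier G" using f g(1) by (auto simp: carr auto_def hom_def)
    have "f \<otimes>\<^bsub>?A\<^esub> h \<otimes>\<^bsub>?A\<^esub> inv\<^bsub>?A\<^esub> f = ?c (f g)"
      using comm[of f g] f g fg c_auto[OF fg]
      by (simp add: carr[symmetric] A.m_assoc)
    then show "f \<otimes>\<^bsub>?A\<^esub> h \<otimes>\<^bsub>?A\<^esub> inv\<^bsub>?A\<^esub> f \<in> Inn G" using fg by (simp add: Inn_def)
  qed
qed

definition Out :: "('a, 'b) monoid_scheme \<Rightarrow> ('a \<Rightarrow> 'a) set monoid" where
  "Out G = AutoGroup G Mod Inn G"

definition group_center :: "('a, 'b) monoid_scheme \<Rightarrow> 'a set" where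
  "group_center G = {z \<in> carrier G. \<forall>g\<in>carrier G. z \<otimes>\<^bsub>G\<^esub> g = g \<otimes>\<^bsub>G\<^esub> z}"

text \<open>
  The class in Out(M) of the automorphism \<open>\<alpha> \<gamma>\<^sub>* \<alpha>\<inverse>\<close> of M, for
  \<open>\<alpha> : N \<rightarrow> M\<close> and \<open>\<gamma>\<^sub>*\<close> conjugation by \<open>\<gamma>\<close> on N.
\<close>

definition outer_class ::
    "('a::metric_space \<Rightarrow> 'a) set \<Rightarrow> ('a \<Rightarrow> 'a) set \<Rightarrow> ('b::metric_space \<Rightarrow> 'b) set
      \<Rightarrow> (('a \<Rightarrow> 'a) \<Rightarrow> ('b \<Rightarrow> 'b)) \<Rightarrow> ('a \<Rightarrow> 'a) \<Rightarrow> (('b \<Rightarrow> 'b) \<Rightarrow> ('b \<Rightarrow> 'b)) set" where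
  "outer_class \<Gamma> N M \<alpha> \<gamma> =
     (\<lambda>m\<in>M. \<alpha> (conj_map (grp \<Gamma>) N \<gamma> (inv_into N \<alpha> m))) <#\<^bsub>AutoGroup (grp M)\<^esub> Inn (grp M)"

definition coxeter_generators :: "('a, 'b) monoid_scheme \<Rightarrow> 'a set \<Rightarrow> bool" where
  "coxeter_generators G S \<longleftrightarrow>
     (\<exists>x\<in>carrier G. \<exists>y\<in>carrier G. S = {x, y} \<and> group.ord G x = 2 \<and> group.ord G y = 2) \<and>
     generate G S = carrier G"

definition infinite_dihedral :: "('a, 'b) monoid_scheme \<Rightarrow> bool" where
  "infinite_dihedral G \<longleftrightarrow> group G \<and> infinite (carrier G) \<and> (\<exists>S. coxeter_generators G S)"

definition Iso_pairs ::
    "(real^1 \<Rightarrow> real^1) set \<Rightarrow> (real^'m \<Rightarrow> real^'m) set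
      \<Rightarrow> ((real^'n \<Rightarrow> real^'n) set \<times> (real^'n \<Rightarrow> real^'n) set) set" where
  "Iso_pairs \<Delta> M =
     {(\<Gamma>, N). space_group \<Gamma> \<and> N \<lhd> grp \<Gamma> \<and> grp N \<cong> grp M \<and> (grp \<Gamma> Mod N) \<cong> grp \<Delta>}"

definition pair_iso_rel ::
    "(real^1 \<Rightarrow> real^1) set \<Rightarrow> (real^'m \<Rightarrow> real^'m) set
      \<Rightarrow> ((real^'n \<Rightarrow> real^'n) set \<times> (real^'n \<Rightarrow> real^'n) set) rel" where
  "pair_iso_rel \<Delta> M =
     {((\<Gamma>1, N1), (\<Gamma>2, N2)). (\<Gamma>1, N1) \<in> Iso_pairs \<Delta> M \<and> (\<Gamma>2, N2) \<in> Iso_pairs \<Delta> M \<and>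
        (\<exists>\<phi>\<in>iso (grp \<Gamma>1) (grp \<Gamma>2). \<phi> ` N1 = N2)}"

lemma equiv_pair_iso_rel: "equiv (Iso_pairs \<Delta> M) (pair_iso_rel \<Delta> M)"
proof (rule equivI)
  show "pair_iso_rel \<Delta> M \<subseteq> Iso_pairs \<Delta> M \<times> Iso_pairs \<Delta> M"
    by (auto simp: pair_iso_rel_def)
  show "refl_on (Iso_pairs \<Delta> M) (pair_iso_rel \<Delta> M)"
    by (auto simp: refl_on_def pair_iso_rel_def intro!: bexI[OF _ iso_set_refl])
  show "sym (pair_iso_rel \<Delta> M)"
  proof (rule symI)
    fix p q assume "(p, q) \<in> pair_iso_rel \<Delta> M"
    then obtain \<Gamma>1 N1 \<Gamma>2 N2 \<phi> where p: "p = (\<Gamma>1, N1)" "q = (\<Gamma>2, N2)" "p \<in> Iso_pairs \<Delta> M"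
      "q \<in> Iso_pairs \<Delta> M" "\<phi> \<in> iso (grp \<Gamma>1) (grp \<Gamma>2)" "\<phi> ` N1 = N2"
      by (auto simp: pair_iso_rel_def)
    then have N: "N1 \<lhd> grp \<Gamma>1" by (simp add: Iso_pairs_def)
    then have "N1 \<subseteq> \<Gamma>1" "group (grp \<Gamma>1)"
      using normal_imp_subgroup[OF N] subgroup.subset[of N1 "grp \<Gamma>1"] normal.axioms(2)[OF N] by auto
    moreover have "bij_betw \<phi> \<Gamma>1 \<Gamma>2" using p(5) by (simp add: iso_def)
    ultimately have "inv_into \<Gamma>1 \<phi> \<in> iso (grp \<Gamma>2) (grp \<Gamma>1)" "inv_into \<Gamma>1 \<phi> ` N2 = N1"
      using group.iso_set_sym[of "grp \<Gamma>1" \<phi> "grp \<Gamma>2"] p(5,6)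
      by (auto simp: bij_betw_def inv_into_image_cancel)
    then show "(q, p) \<in> pair_iso_rel \<Delta> M" using p by (auto simp: pair_iso_rel_def)
  qed
  show "trans (pair_iso_rel \<Delta> M)"
  proof (rule transI)
    fix p q r assume "(p, q) \<in> pair_iso_rel \<Delta> M" and qr: "(q, r) \<in> pair_iso_rel \<Delta> M"
    then obtain \<Gamma>1 N1 \<Gamma>2 N2 \<phi> where pq:
      "p = (\<Gamma>1, N1)" "q = (\<Gamma>2, N2)" "p \<in> Iso_pairs \<Delta> M"
      "\<phi> \<in> iso (grp \<Gamma>1) (grp \<Gamma>2)" "\<phi> ` N1 = N2"
      by (auto simp: pair_iso_rel_def)
    from qr pq(2) obtain \<Gamma>3 N3 \<psi> where
      "r = (\<Gamma>3, N3)" "r \<in> Iso_pairs \<Delta> M" "\<psi> \<in> iso (grp \<Gamma>2) (grp \<Gamma>3)" "\<psi> ` N2 = N3"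
      by (auto simp: pair_iso_rel_def)
    moreover note pq
    moreover from calculation have "\<psi> \<circ> \<phi> \<in> iso (grp \<Gamma>1) (grp \<Gamma>3)" "(\<psi> \<circ> \<phi>) ` N1 = N3"
      using iso_set_trans[of \<phi> "grp \<Gamma>1" "grp \<Gamma>2" \<psi> "grp \<Gamma>3"] by (auto simp: image_comp)
    ultimately show "(p, r) \<in> pair_iso_rel \<Delta> M" unfolding pair_iso_rel_def by blast
  qed
qed

definition Iso ::
    "(real^1 \<Rightarrow> real^1) set \<Rightarrow> (real^'m \<Rightarrow> real^'m) set
      \<Rightarrow> ((real^'n \<Rightarrow> real^'n) set \<times> (real^'n \<Rightarrow> real^'n) set) set set" where
  "Iso \<Delta> M = Iso_pairs \<Delta> M // pair_iso_rel \<Delta> M"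

definition conj_class :: "('a, 'b) monoid_scheme \<Rightarrow> 'a set \<Rightarrow> 'a set set" where
  "conj_class G S = {(\<lambda>x. g \<otimes>\<^bsub>G\<^esub> x \<otimes>\<^bsub>G\<^esub> inv\<^bsub>G\<^esub> g) ` S | g. g \<in> carrier G}"

text \<open>\<^const>\<open>group.ord\<close> is 0 on elements of infinite order.\<close>

definition involution_pairs :: "('a, 'b) monoid_scheme \<Rightarrow> 'a set set" where
  "involution_pairs G =
     {{x, y} | x y. x \<in> carrier G \<and> y \<in> carrier G \<and>
        group.ord G x \<in> {1, 2} \<and> group.ord G y \<in> {1, 2} \<and> group.ord G (x \<otimes>\<^bsub>G\<^esub> y) \<noteq> 0}"

end

theory Submission
  imports Defs
begin

text \<open>
  Since \<open>M\<close> has trivial center, an extension \<open>\<Gamma>\<close> of \<open>M\<close> by \<open>\<Delta>\<close> is the fibre product of \<open>Aut M\<close> and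
  \<open>\<Delta>\<close> over \<open>Out M\<close>, so it is determined by a homomorphism from \<open>\<Delta>\<close> to \<open>Out M\<close>, that is, by the images of
  two Coxeter generators. Any two sets of Coxeter generators of an infinite dihedral group are
  conjugate, which makes the conjugacy class of the pair an invariant.

  By Bieberbach's first theorem some power of \<open>\<gamma>1 \<gamma>2\<close> is a translation, and averaging over the point
  group shows that a further power acts on \<open>N\<close> as an inner automorphism; hence the product of the
  two outer classes has finite order. Conversely, every automorphism of \<open>M\<close> is
  conjugation by a unique affine map. If the two classes generate a finite group, the
  affine maps inducing its elements have finitely many linear parts, so after a linear
  change of coordinates they are isometries, and the fibre product acts
  by isometries on the product of Euclidean space with a line.
\<close>

section \<open>Infinite dihedral groups\<close>

text \<open>Triviality of the center enters twice. Algebraically, \<open>N\<close> acts faithfully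
  on itself, so an element of an extension is determined by its coset and its action on
  \<open>N\<close>. Geometrically, a nonzero vector fixed by all linear parts would yield a central
  translation; its absence makes the affine map inducing an automorphism unique, and hence
  multiplicative in the automorphism. The identification of \<open>N\<close> with \<open>M\<close>
  is given only up to automorphisms of \<open>M\<close>, and Coxeter generators only up to
  conjugation and order: exactly the ambiguity that conjugacy classes of unordered pairs remove.
  Finite order of the product is equivalent to finiteness of the image of the dihedral group in
  \<open>Out M\<close>, and this is what singles out the extensions that act as space groups,
  because an invariant inner product is found by summing over a finite set of linear parts. The
  topological axioms are used only through two metric statements, the assumptions \<open>fin\<close>
  and \<open>cocompact\<close> of \<open>crystal\<close>.\<close>

definition dih :: "('a, 'b) monoid_scheme \<Rightarrow> 'a \<Rightarrow> 'a \<Rightarrow> int \<Rightarrow> bool \<Rightarrow> 'a" where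
  "dih G a b k e = (a \<otimes>\<^bsub>G\<^esub> b) [^]\<^bsub>G\<^esub> k \<otimes>\<^bsub>G\<^esub> (if e then a else \<one>\<^bsub>G\<^esub>)"

lemma (in group) dih_closed [simp]:
  "a \<in> carrier G \<Longrightarrow> b \<in> carrier G \<Longrightarrow> dih G a b k e \<in> carrier G"
  by (simp add: dih_def)

lemma (in group) involution_inv: "a \<in> carrier G \<Longrightarrow> a \<otimes> a = \<one> \<Longrightarrow> inv a = a"
  by (simp add: inv_equality)

text \<open>Conjugation by \<open>a\<close> is an endomorphism that sends
  \<open>a \<otimes> b\<close> to \<open>b \<otimes> a\<close>, its inverse, and endomorphisms
  commute with integer powers.\<close>

lemma (in group) involution_conj_pow:
  assumes a: "a \<in> carrier G" "a \<otimes> a = \<one>" and b: "b \<in> carrier G" "b \<otimes> b = \<one>"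
  shows "a \<otimes> (a \<otimes> b) [^] (k::int) = (a \<otimes> b) [^] (-k) \<otimes> a"
proof -
  have aa: "a \<otimes> (a \<otimes> x) = x" if "x \<in> carrier G" for x
    using that a by (simp flip: m_assoc)
  have "(\<lambda>x. a \<otimes> x \<otimes> a) \<in> hom G G"
    using a aa by (auto simp: hom_def m_assoc)
  then interpret c: group_hom G G "\<lambda>x. a \<otimes> x \<otimes> a" by unfold_locales
  have "a \<otimes> (a \<otimes> b) \<otimes> a = inv (a \<otimes> b)"
    using a b aa by (simp add: inv_mult_group involution_inv m_assoc)
  then have "a \<otimes> (a \<otimes> b) [^] k \<otimes> a = (a \<otimes> b) [^] (-k)"
    using c.hom_int_pow[of "a \<otimes> b" k] a b by (simp add: int_pow_inv int_pow_neg)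
  then show ?thesis using a b by (metis (no_types, lifting) int_pow_closed m_assoc m_closed r_one)
qed

text \<open>\<open>dih G a b k e\<close> is the rotation of exponent \<open>k\<close>, followed by
  the reflection \<open>a\<close> if \<open>e\<close> holds. Moving \<open>a\<close> past a rotation
  negates the exponent, so the coordinates \<open>(k, e)\<close> multiply as in the semidirect
  product of the integers with a group of order two, and words in two involutions become integer
  arithmetic.\<close>

lemma (in group) dih_mult:
  assumes "a \<in> carrier G" "a \<otimes> a = \<one>" "b \<in> carrier G" "b \<otimes> b = \<one>"
  shows "dih G a b k e \<otimes> dih G a b l f = dih G a b (if e then k - l else k + l) (e \<noteq> f)"
proof (cases e)
  case True
  have "dih G a b k e \<otimes> dih G a b l f =
      (a \<otimes> b) [^] k \<otimes> (a \<otimes> (a \<otimes> b) [^] l) \<otimes> (if f then a else \<one>)"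
    using True assms by (simp add: dih_def m_assoc)
  also have "\<dots> = (a \<otimes> b) [^] k \<otimes> (a \<otimes> b) [^] (-l) \<otimes> (a \<otimes> (if f then a else \<one>))"
    unfolding involution_conj_pow[OF assms] using assms by (simp add: m_assoc)
  also have "(a \<otimes> b) [^] k \<otimes> (a \<otimes> b) [^] (-l) = (a \<otimes> b) [^] (k - l)"
    using assms by (metis diff_conv_add_uminus int_pow_mult m_closed)
  finally show ?thesis using True assms by (simp add: dih_def)
next
  case False
  then show ?thesis using assms by (simp add: dih_def int_pow_mult m_assoc)
qed

lemma (in group) dih_simps:
  assumes "a \<in> carrier G" "a \<otimes> a = \<one>" "b \<in> carrier G" "b \<otimes> b = \<one>"
  shows "dih G a b 0 False = \<one>" "dih G a b 0 True = a" "dih G a b (-1) True = b"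
    "dih G a b 1 False = a \<otimes> b"
proof -
  \<comment> \<open>Hence \<open>b = (b \<otimes> a) \<otimes> a\<close> is the reflection with
    exponent -1.\<close>
  have "(a \<otimes> b) [^] (-1 :: int) = b \<otimes> a"
    using assms by (simp add: int_pow_neg inv_mult_group involution_inv)
  then show "dih G a b (-1) True = b" using assms by (simp add: dih_def m_assoc)
qed (use assms in \<open>simp_all add: dih_def\<close>)

lemma (in group) dih_inv:
  assumes ab: "a \<in> carrier G" "a \<otimes> a = \<one>" "b \<in> carrier G" "b \<otimes> b = \<one>"
  shows "inv (dih G a b k e) = dih G a b (if e then k else - k) e"
  by (rule inv_equality) (use assms in \<open>simp_all add: dih_mult[OF ab] dih_simps[OF ab]\<close>)

lemma (in group) generate_involutions:
  assumes ab: "a \<in> carrier G" "a \<otimes> a = \<one>" "b \<in> carrier G" "b \<otimes> b = \<one>"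
  shows "generate G {a, b} = {dih G a b k e | k e. True}"
proof
  show "generate G {a, b} \<subseteq> {dih G a b k e | k e. True}"
  proof
    have D: "dih G a b k e \<in> {dih G a b k e | k e. True}" for k e by blast
    note D' = D[of 0 False, unfolded dih_simps(1)[OF ab]] D[of 0 True, unfolded dih_simps(2)[OF ab]]
      D[of "-1" True, unfolded dih_simps(3)[OF ab]]
    fix x assume "x \<in> generate G {a, b}"
    then show "x \<in> {dih G a b k e | k e. True}"
    proof induction
      case one
      show ?case by (rule D')
    next
      case (incl h)
      then show ?case using D'(2,3) by blast
    next
      case (inv h)
      then have "inv h = h" using ab by (auto simp: involution_inv)
      then show ?case using inv D'(2,3) by (metis insertE singletonD)
    next
      case (eng h1 h2)
      then obtain k e l f where "h1 = dih G a b k e" "h2 = dih G a b l f" by blast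
      then show ?case using D by (simp only: dih_mult[OF ab])
    qed
  qed
  have sub: "subgroup (generate G {a, b}) G" using ab by (intro generate_is_subgroup) auto
  have "a \<in> generate G {a, b}" "b \<in> generate G {a, b}" by (auto intro: generate.incl)
  then show "{dih G a b k e | k e. True} \<subseteq> generate G {a, b}"
    using sub subgroup_int_pow_closed[OF sub]
    by (auto simp: dih_def subgroup.m_closed subgroup.one_closed)
qed

text \<open>Exponents matter only modulo the order of \<open>a \<otimes> b\<close>. This serves in
  two ways: it forces that order to be infinite in an infinite dihedral group, and it makes the
  image of such a group in \<open>Out M\<close> finite.\<close>

lemma (in group) finite_dih:
  assumes ab: "a \<in> carrier G" "b \<in> carrier G" and n: "ord (a \<otimes> b) \<noteq> 0"
  shows "finite {dih G a b k e | k e. True}"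
proof -
  let ?z = "a \<otimes> b" let ?n = "int (ord ?z)"
  have "?z [^] k = ?z [^] (k mod ?n)" for k :: int
    using ab by (simp add: int_pow_eq mod_eq_dvd_iff[symmetric])
  then have "dih G a b k e = dih G a b (k mod ?n) e" for k e by (simp add: dih_def)
  moreover have "k mod ?n \<in> {0..<?n}" for k using n by simp
  ultimately have "{dih G a b k e | k e. True} \<subseteq> (\<lambda>(k, e). dih G a b k e) ` ({0..<?n} \<times> UNIV)"
    by (auto intro!: image_eqI[of _ _ "(k mod ?n, e)" for k e])
  then show ?thesis by (rule finite_subset) simp
qed

locale infinite_dihedral_group = group G for G (structure) +
  fixes a b
  assumes ab: "a \<in> carrier G" "a \<otimes> a = \<one>" "b \<in> carrier G" "b \<otimes> b = \<one>"
    and gen: "generate G {a, b} = carrier G" and inf: "infinite (carrier G)"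
begin

lemma carrier_dih: "carrier G = {dih G a b k e | k e. True}"
  using gen generate_involutions[OF ab] by simp

lemma ord_0: "ord (a \<otimes> b) = 0"
proof (rule ccontr)
  assume "ord (a \<otimes> b) \<noteq> 0"
  then have "finite (carrier G)" unfolding carrier_dih using ab by (intro finite_dih)
  with inf show False by simp
qed

lemma dih_inj: "dih G a b k e = dih G a b l f \<longleftrightarrow> k = l \<and> e = f"
proof -
  let ?z = "a \<otimes> b"
  have pow: "?z [^] k = ?z [^] l \<longleftrightarrow> k = l" for k l :: int
    using ab by (auto simp: int_pow_eq ord_0)
  \<comment> \<open>If a reflection were a rotation, \<open>a\<close> itself would be a rotation and
    commute with \<open>a \<otimes> b\<close>. Conjugation by \<open>a\<close> inverts
    \<open>a \<otimes> b\<close>, whose square would then be trivial, against its infinite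
    order.\<close>
  have ne: "dih G a b k True \<noteq> dih G a b l False" for k l
  proof
    assume eq: "dih G a b k True = dih G a b l False"
    let ?x = "dih G a b (l - k) False"
    have "?x = dih G a b (-k) False \<otimes> dih G a b l False" by (simp add: dih_mult[OF ab])
    also have "\<dots> = a" unfolding eq[symmetric] by (simp add: dih_mult[OF ab] dih_simps[OF ab])
    finally have x: "?x = a" .
    have "?x \<otimes> dih G a b 1 False = dih G a b 1 False \<otimes> ?x"
      by (simp add: dih_mult[OF ab] add.commute)
    then have "dih G a b 0 True \<otimes> dih G a b 1 False = dih G a b 1 False \<otimes> dih G a b 0 True"
      unfolding x by (simp add: dih_simps(2)[OF ab])
    then have "dih G a b (-1) True = dih G a b 1 True" by (simp add: dih_mult[OF ab])
    then have "?z [^] (-1::int) = ?z [^] (1::int)"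
      using ab by (simp add: dih_def)
    then show False unfolding pow by simp
  qed
  show ?thesis
    using ne[of k l] ne[of l k] pow[of k l] ab by (cases e; cases f) (auto simp: dih_def)
qed

text \<open>An infinite dihedral group is the free product of two groups of order two: unique normal
  forms allow any two elements with trivial squares as images of the generators. The image is part
  of the conclusion because its finiteness is needed for realizing extensions.\<close>

lemma hom_exists:
  assumes H: "group H" and u: "u \<in> carrier H" "u \<otimes>\<^bsub>H\<^esub> u = \<one>\<^bsub>H\<^esub>"
    and v: "v \<in> carrier H" "v \<otimes>\<^bsub>H\<^esub> v = \<one>\<^bsub>H\<^esub>"
  obtains \<rho> where "\<rho> \<in> hom G H" "\<rho> a = u" "\<rho> b = v" "\<rho> ` carrier G = {dih H u v k e | k e. True}"
proof -
  interpret H: group H by fact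
  define \<rho> where "\<rho> x = (THE y. \<exists>k e. x = dih G a b k e \<and> y = dih H u v k e)" for x
  have \<rho>: "\<rho> (dih G a b k e) = dih H u v k e" for k e
    unfolding \<rho>_def by (rule the_equality) (auto simp: dih_inj)
  show thesis
  proof
    show "\<rho> \<in> hom G H"
    proof (rule homI)
      fix x y assume "x \<in> carrier G" "y \<in> carrier G"
      then show "\<rho> (x \<otimes> y) = \<rho> x \<otimes>\<^bsub>H\<^esub> \<rho> y"
        unfolding carrier_dih by (auto simp: dih_mult[OF ab] H.dih_mult[OF u v] \<rho>)
    qed (use u v in \<open>auto simp: carrier_dih \<rho>\<close>)
    show "\<rho> a = u" using \<rho>[of 0 True] dih_simps(2)[OF ab] H.dih_simps(2)[OF u v] by simp
    show "\<rho> b = v" using \<rho>[of "-1" True] dih_simps(3)[OF ab] H.dih_simps(3)[OF u v] by simp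
    show "\<rho> ` carrier G = {dih H u v k e | k e. True}"
      unfolding carrier_dih by (force simp: \<rho>)
  qed
qed

lemma hom_eqI:
  assumes H: "group H" and \<rho>: "\<rho> \<in> hom G H" "\<sigma> \<in> hom G H" and eq: "\<rho> a = \<sigma> a" "\<rho> b = \<sigma> b"
    and x: "x \<in> carrier G"
  shows "\<rho> x = \<sigma> x"
proof -
  interpret \<rho>: group_hom G H \<rho> using H \<rho> by (simp add: group_hom_def group_hom_axioms_def is_group)
  interpret \<sigma>: group_hom G H \<sigma> using H \<rho> by (simp add: group_hom_def group_hom_axioms_def is_group)
  have sub: "{a, b} \<subseteq> carrier G" using ab by simp
  have "x \<in> generate G {a, b}" using x gen by simp
  then show ?thesis
  proof induction
    case (inv h)
    then show ?case using eq ab by auto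
  next
    case (eng h1 h2)
    then show ?case using generate_in_carrier[OF sub] by simp
  qed (use eq in auto)
qed

text \<open>Every involution is a reflection. The rotations generated by the reflections of
  exponents \<open>k\<close> and \<open>l\<close> have exponents divisible by \<open>k - l\<close>,
  so two reflections generate the group only if their exponents are adjacent; adjacent pairs are all
  conjugate, up to order.\<close>

lemma generators_conjugate:
  assumes c: "c \<in> carrier G" "c \<otimes> c = \<one>" "c \<noteq> \<one>" and d: "d \<in> carrier G" "d \<otimes> d = \<one>" "d \<noteq> \<one>"
    and cd: "generate G {c, d} = carrier G"
  obtains g where "g \<in> carrier G" "{g \<otimes> a \<otimes> inv g, g \<otimes> b \<otimes> inv g} = {c, d}"
proof -
  note m = dih_mult[OF ab] and s = dih_simps[OF ab]
  \<comment> \<open>Squaring a rotation doubles its exponent, so only the trivial rotation squares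
    to one.\<close>
  have refl: "\<exists>k. x = dih G a b k True" if x: "x \<in> carrier G" "x \<otimes> x = \<one>" "x \<noteq> \<one>" for x
  proof -
    obtain k e where xk: "x = dih G a b k e" using x by (auto simp: carrier_dih)
    have "e"
    proof (rule ccontr)
      assume "\<not> e"
      then have "dih G a b (k + k) False = dih G a b 0 False" using x(2) xk by (simp add: m s)
      then have "k = 0" unfolding dih_inj by simp
      with \<open>\<not> e\<close> xk x(3) show False by (simp add: s)
    qed
    then show ?thesis using xk by auto
  qed
  obtain k where k: "c = dih G a b k True" using refl[OF c] by auto
  obtain l where l: "d = dih G a b l True" using refl[OF d] by auto
  have "dih G a b 1 False \<in> generate G {c, d}" by (simp add: cd ab)
  then obtain i e where i: "dih G a b 1 False = dih G c d i e"
    unfolding generate_involutions[OF c(1,2) d(1,2)] by auto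
  have cdk: "c \<otimes> d = dih G a b (k - l) False" unfolding k l by (simp add: m)
  have pow: "dih G a b j False [^] (i::int) = dih G a b (j * i) False" for i j
    using ab by (simp add: dih_def int_pow_pow)
  have "dih G c d i e = dih G a b ((k - l) * i) False \<otimes> dih G a b (if e then k else 0) e"
    unfolding dih_def[of G c d] cdk pow using k s by simp
  then have "dih G a b 1 False = dih G a b ((k - l) * i + (if e then k else 0)) e"
    unfolding i by (simp add: m)
  \<comment> \<open>The left-hand side is a rotation, so \<open>e\<close> is false and the extra
    summand vanishes.\<close>
  then have "(k - l) * i = 1" unfolding dih_inj by auto
  then have kl: "k - l = 1 \<or> k - l = -1"
    by (simp add: zmult_eq_1_iff) auto
  have conj: "dih G a b j f \<otimes> dih G a b n True \<otimes> inv (dih G a b j f) =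
      dih G a b (if f then 2 * j - n else 2 * j + n) True" for j f n
    by (simp add: m dih_inv[OF ab])
  \<comment> \<open>Conjugation by the rotation of exponent \<open>j\<close> adds
    \<open>2 * j\<close> to the exponents 0 and -1 of \<open>a\<close> and \<open>b\<close>;
    conjugation by the reflection of exponent \<open>j\<close> turns them into \<open>2 * j\<close>
    and \<open>2 * j + 1\<close>. The parity of \<open>i\<close> decides which one applies, and in
    the odd case \<open>a\<close> and \<open>b\<close> change places.\<close>
  have *: "\<exists>g\<in>carrier G. {g \<otimes> a \<otimes> inv g, g \<otimes> b \<otimes> inv g} = {dih G a b i True, dih G a b (i - 1) True}" for i
  proof (cases "even i")
    case True
    then obtain j where "i = 2 * j" by blast
    then show ?thesis
      using conj[of j False 0] conj[of j False "-1"] ab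
      by (intro bexI[of _ "dih G a b j False"]) (simp_all add: s)
  next
    case False
    then obtain j where "i = 2 * j + 1" by (rule oddE)
    then show ?thesis
      using conj[of j True 0] conj[of j True "-1"] ab
      by (intro bexI[of _ "dih G a b j True"]) (simp_all add: s insert_commute)
  qed
  show thesis
    using kl
  proof
    assume "k - l = 1"
    then have "l = k - 1" by simp
    then show thesis using *[of k] that unfolding k l by blast
  next
    assume "k - l = -1"
    then have "k = l - 1" by simp
    then show thesis using *[of l] that unfolding k l by (metis insert_commute)
  qed
qed

end

section \<open>Extensions and outer automorphisms\<close>

lemma carrier_AutoGroup: "carrier (AutoGroup G) = auto G"
  by (simp add: AutoGroup_def)

lemma mult_AutoGroup:
  "f \<in> auto G \<Longrightarrow> g \<in> auto G \<Longrightarrow> f \<otimes>\<^bsub>AutoGroup G\<^esub> g = compose (carrier G) f g"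
  by (auto simp: AutoGroup_def BijGroup_def auto_def)

lemma one_AutoGroup: "\<one>\<^bsub>AutoGroup G\<^esub> = (\<lambda>x\<in>carrier G. x)"
  by (simp add: AutoGroup_def BijGroup_def)

lemma auto_extensional: "f \<in> auto G \<Longrightarrow> f \<in> extensional (carrier G)"
  by (auto simp: auto_def Bij_def)

lemma auto_bij: "f \<in> auto G \<Longrightarrow> bij_betw f (carrier G) (carrier G)"
  by (auto simp: auto_def Bij_def)

lemma (in group) Inn_subset: "Inn G \<subseteq> auto G"
  using normal_imp_subgroup[OF Inn_normal] subgroup.subset by (auto simp: carrier_AutoGroup[symmetric])

lemma (in group) conj_map_auto: "x \<in> carrier G \<Longrightarrow> conj_map G (carrier G) x \<in> auto G"
  using Inn_subset by (auto simp: Inn_def)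

lemma (in group) group_Out: "group (Out G)"
  unfolding Out_def by (rule normal.factorgroup_is_group[OF Inn_normal])

text \<open>A left coset, as in \<open>outer_class\<close>, whereas the elements of a factor group
  are right cosets; normality of \<open>Inn G\<close> identifies the two.\<close>

definition out :: "('a, 'b) monoid_scheme \<Rightarrow> ('a \<Rightarrow> 'a) \<Rightarrow> ('a \<Rightarrow> 'a) set" where
  "out G f = f <#\<^bsub>AutoGroup G\<^esub> Inn G"

lemma (in group) out_eq_rcoset:
  assumes "f \<in> auto G"
  shows "out G f = Inn G #>\<^bsub>AutoGroup G\<^esub> f"
  using normal.coset_eq[OF Inn_normal] assms by (simp add: out_def carrier_AutoGroup)

lemma (in group) out_hom: "out G \<in> hom (AutoGroup G) (Out G)"
proof -
  have "(\<lambda>f. Inn G #>\<^bsub>AutoGroup G\<^esub> f) \<in> hom (AutoGroup G) (AutoGroup G Mod Inn G)"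
    by (rule normal.r_coset_hom_Mod[OF Inn_normal])
  moreover have "x \<otimes>\<^bsub>AutoGroup G\<^esub> y \<in> auto G" if "x \<in> auto G" "y \<in> auto G" for x y
    using that monoid.m_closed[OF group.is_monoid[OF AutoGroup]] by (simp add: carrier_AutoGroup)
  ultimately show ?thesis by (auto simp: hom_def Out_def out_eq_rcoset carrier_AutoGroup)
qed

lemma (in group) carrier_Out: "carrier (Out G) = out G ` auto G"
  by (auto simp: Out_def carrier_FactGroup carrier_AutoGroup out_eq_rcoset)

lemma (in group) one_Out: "\<one>\<^bsub>Out G\<^esub> = Inn G"
  by (simp add: Out_def)

lemma (in group) mem_out_self: "f \<in> auto G \<Longrightarrow> f \<in> out G f"
  using group.rcos_self[OF AutoGroup _ normal_imp_subgroup[OF Inn_normal]]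
  by (simp add: out_eq_rcoset carrier_AutoGroup)

lemma (in group) mem_out_iff:
  assumes f: "f \<in> auto G"
  shows "h \<in> out G f \<longleftrightarrow> (\<exists>m\<in>carrier G. h = conj_map G (carrier G) m \<otimes>\<^bsub>AutoGroup G\<^esub> f)"
  using assms by (auto simp: out_eq_rcoset r_coset_def Inn_def)

lemma (in group) out_conj_map:
  assumes "x \<in> carrier G"
  shows "out G (conj_map G (carrier G) x) = \<one>\<^bsub>Out G\<^esub>"
proof -
  have "conj_map G (carrier G) x \<in> Inn G" using assms by (simp add: Inn_def)
  then show ?thesis
    using group.coset_join2[OF AutoGroup _ normal_imp_subgroup[OF Inn_normal]] assms conj_map_auto
    by (simp add: out_eq_rcoset carrier_AutoGroup one_Out)
qed

text \<open>An extension of \<open>M\<close> by \<open>G Mod N\<close> whose kernel is identified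
  with \<open>M\<close> by a chosen \<open>\<alpha>\<close>. The groups are abstract because the
  classification of centerless extensions involves no geometry.\<close>

locale normal_extension = normal N G + M: group M
  for N and G (structure) and M :: "('m, 'n) monoid_scheme" and \<alpha> +
  assumes iso: "\<alpha> \<in> iso (G\<lparr>carrier := N\<rparr>) M"
begin

text \<open>Conjugation by \<open>g\<close>, carried from \<open>N\<close> to \<open>M\<close>. It
  is restricted to the carrier since elements of \<open>AutoGroup M\<close> are extensional.\<close>

definition act :: "'a \<Rightarrow> 'm \<Rightarrow> 'm" where
  "act g = (\<lambda>m\<in>carrier M. \<alpha> (conj_map G N g (inv_into N \<alpha> m)))"

lemma bij: "bij_betw \<alpha> N (carrier M)"
  using iso by (simp add: iso_def)

lemma iso_closed [simp]: "n \<in> N \<Longrightarrow> \<alpha> n \<in> carrier M"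
  using bij by (rule bij_betw_apply)

lemma inv_iso [simp]:
  "n \<in> N \<Longrightarrow> inv_into N \<alpha> (\<alpha> n) = n"
  "m \<in> carrier M \<Longrightarrow> inv_into N \<alpha> m \<in> N"
  "m \<in> carrier M \<Longrightarrow> \<alpha> (inv_into N \<alpha> m) = m"
  using bij by (auto simp: bij_betw_def inv_into_into f_inv_into_f)

lemma iso_mult: "n \<in> N \<Longrightarrow> n' \<in> N \<Longrightarrow> \<alpha> (n \<otimes> n') = \<alpha> n \<otimes>\<^bsub>M\<^esub> \<alpha> n'"
  using iso by (auto simp: iso_def hom_def)

lemma iso_inv:
  assumes "n \<in> N"
  shows "\<alpha> (inv n) = inv\<^bsub>M\<^esub> \<alpha> n"
proof -
  interpret N: group "G\<lparr>carrier := N\<rparr>" using subgroup_is_group[OF is_group] .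
  interpret h: group_hom "G\<lparr>carrier := N\<rparr>" M \<alpha> using iso by unfold_locales (simp add: iso_def)
  show ?thesis using h.hom_inv[of n] assms m_inv_consistent[OF subgroup_axioms] by simp
qed

lemma iso_cases:
  assumes "m \<in> carrier M"
  obtains n where "n \<in> N" "m = \<alpha> n"
  using assms inv_iso(2,3) by metis

lemma act_apply:
  assumes "g \<in> carrier G" "n \<in> N"
  shows "act g (\<alpha> n) = \<alpha> (g \<otimes> n \<otimes> inv g)"
  using assms by (simp add: act_def conj_map_def)

lemma conj_closed [simp]: "g \<in> carrier G \<Longrightarrow> n \<in> N \<Longrightarrow> g \<otimes> n \<otimes> inv g \<in> N"
  by (rule inv_op_closed2)

lemma act_closed [simp]: "g \<in> carrier G \<Longrightarrow> m \<in> carrier M \<Longrightarrow> act g m \<in> carrier M"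
  by (auto elim!: iso_cases simp: act_apply)

lemma act_act:
  assumes g: "g \<in> carrier G" "h \<in> carrier G" and m: "m \<in> carrier M"
  shows "act (g \<otimes> h) m = act g (act h m)"
proof -
  obtain n where n: "n \<in> N" "m = \<alpha> n" using m by (rule iso_cases)
  have "g \<otimes> h \<otimes> n \<otimes> inv (g \<otimes> h) = g \<otimes> (h \<otimes> n \<otimes> inv h) \<otimes> inv g"
    using g mem_carrier[OF n(1)] by (simp add: inv_mult_group m_assoc)
  then show ?thesis using g n by (simp add: act_apply)
qed

lemma act_one: "m \<in> carrier M \<Longrightarrow> act \<one> m = m"
  by (erule iso_cases) (simp add: act_apply mem_carrier)

lemma act_mult_apply:
  assumes g: "g \<in> carrier G" and m: "m \<in> carrier M" "m' \<in> carrier M"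
  shows "act g (m \<otimes>\<^bsub>M\<^esub> m') = act g m \<otimes>\<^bsub>M\<^esub> act g m'"
proof -
  obtain n where n: "n \<in> N" "m = \<alpha> n" using m(1) by (rule iso_cases)
  obtain n' where n': "n' \<in> N" "m' = \<alpha> n'" using m(2) by (rule iso_cases)
  have "inv g \<otimes> (g \<otimes> x) = x" if "x \<in> carrier G" for x
    using g that by (simp flip: m_assoc)
  then have "g \<otimes> (n \<otimes> n') \<otimes> inv g = (g \<otimes> n \<otimes> inv g) \<otimes> (g \<otimes> n' \<otimes> inv g)"
    using g mem_carrier[OF n(1)] mem_carrier[OF n'(1)] by (simp add: m_assoc)
  then show ?thesis
    using g n(1) n'(1) unfolding n(2) n'(2) by (simp flip: iso_mult add: act_apply)
qed

lemma act_auto: "g \<in> carrier G \<Longrightarrow> act g \<in> auto M"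
proof -
  assume g: "g \<in> carrier G"
  have "bij_betw (act g) (carrier M) (carrier M)"
    using g by (intro bij_betw_byWitness[where f' = "act (inv g)"])
      (auto simp flip: act_act simp: act_one)
  moreover have "act g \<in> extensional (carrier M)" by (simp add: act_def)
  ultimately show ?thesis using g by (auto simp: auto_def Bij_def hom_def act_mult_apply)
qed

lemma act_hom: "act \<in> hom G (AutoGroup M)"
proof (rule homI)
  fix g h assume g: "g \<in> carrier G" "h \<in> carrier G"
  show "act (g \<otimes> h) = act g \<otimes>\<^bsub>AutoGroup M\<^esub> act h"
    unfolding mult_AutoGroup[OF act_auto[OF g(1)] act_auto[OF g(2)]]
  proof (rule extensionalityI[of _ "carrier M"])
    show "act (g \<otimes> h) \<in> extensional (carrier M)" by (simp add: act_def)
  qed (simp_all add: act_act g compose_eq)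
qed (simp add: act_auto carrier_AutoGroup)

lemma act_N:
  assumes n: "n \<in> N"
  shows "act n = conj_map M (carrier M) (\<alpha> n)"
proof (rule extensionalityI[of _ "carrier M"])
  fix m assume "m \<in> carrier M"
  then obtain n' where n': "n' \<in> N" "m = \<alpha> n'" by (rule iso_cases)
  have "\<alpha> (n \<otimes> n' \<otimes> inv n) = \<alpha> n \<otimes>\<^bsub>M\<^esub> \<alpha> n' \<otimes>\<^bsub>M\<^esub> inv\<^bsub>M\<^esub> \<alpha> n"
    using n n' by (simp add: iso_mult iso_inv)
  then show "act n m = conj_map M (carrier M) (\<alpha> n) m"
    using n n' mem_carrier by (simp add: act_apply conj_map_def)
qed (simp_all add: act_def conj_map_def)

definition cls :: "'a \<Rightarrow> ('m \<Rightarrow> 'm) set" where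
  "cls g = out M (act g)"

lemma cls_hom: "cls \<in> hom G (Out M)"
  using act_hom M.out_hom by (auto simp: hom_def cls_def[abs_def] Pi_iff)

lemma cls_N: "n \<in> N \<Longrightarrow> cls n = \<one>\<^bsub>Out M\<^esub>"
  by (simp add: cls_def act_N M.out_conj_map)

lemma cls_closed [simp]: "g \<in> carrier G \<Longrightarrow> cls g \<in> carrier (Out M)"
  using cls_hom by (auto simp: hom_def)

lemma rcoset_cases:
  assumes "N #> x = N #> y" "x \<in> carrier G" "y \<in> carrier G"
  obtains n where "n \<in> N" "x = n \<otimes> y"
proof -
  have "x \<in> N #> y" using assms rcos_self[OF assms(2) subgroup_axioms] by simp
  then show thesis using that by (auto simp: r_coset_def)
qed

lemma rcoset_mult:
  assumes "n \<in> N" "y \<in> carrier G"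
  shows "N #> (n \<otimes> y) = N #> y"
  using assms by (metis coset_join2 coset_mult_assoc mem_carrier subgroup_axioms subset)

text \<open>Elements of \<open>N\<close> act by inner automorphisms of \<open>M\<close>, so
  \<open>cls\<close> is constant on cosets of \<open>N\<close>. The induced \<open>\<rho>\<close> is
  the outer action that determines a centerless extension.\<close>

lemma quotient_hom:
  obtains \<rho> where "\<rho> \<in> hom (G Mod N) (Out M)" "\<And>g. g \<in> carrier G \<Longrightarrow> \<rho> (N #> g) = cls g"
proof (rule FactGroup_universal[OF cls_hom normal_axioms])
  fix x y assume xy: "x \<in> carrier G" "y \<in> carrier G" "N #> x = N #> y"
  interpret O: group "Out M" by (rule M.group_Out)
  obtain n where "n \<in> N" "x = n \<otimes> y" using rcoset_cases[OF xy(3,1,2)] .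
  then show "cls x = cls y"
    using cls_hom xy(2) mem_carrier by (simp add: hom_def cls_N)
qed (use that in blast)

end

text \<open>The automorphism \<open>a\<close> is \<open>\<phi>\<close> read through both
  identifications. It intertwines the actions: the action of \<open>\<phi> g\<close> after
  \<open>a\<close> equals \<open>a\<close> after the action of \<open>g\<close>, which becomes a
  conjugation in \<open>Out M\<close>.\<close>

lemma normal_extension_conj:
  assumes e1: "normal_extension N1 G1 M \<alpha>1" and e2: "normal_extension N2 G2 M \<alpha>2"
    and \<phi>: "\<phi> \<in> iso G1 G2" "\<phi> ` N1 = N2"
  defines "a \<equiv> \<lambda>m\<in>carrier M. \<alpha>2 (\<phi> (inv_into N1 \<alpha>1 m))"
  shows "a \<in> auto M"
    and "g \<in> carrier G1 \<Longrightarrow> normal_extension.cls N2 G2 M \<alpha>2 (\<phi> g) =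
      out M a \<otimes>\<^bsub>Out M\<^esub> normal_extension.cls N1 G1 M \<alpha>1 g \<otimes>\<^bsub>Out M\<^esub> inv\<^bsub>Out M\<^esub> (out M a)"
proof -
  interpret e1: normal_extension N1 G1 M \<alpha>1 by fact
  interpret e2: normal_extension N2 G2 M \<alpha>2 by fact
  interpret h: group_hom G1 G2 \<phi> using \<phi> by unfold_locales (simp add: iso_def)
  interpret A: group "AutoGroup M" by (rule e1.M.AutoGroup)
  interpret O: group "Out M" by (rule e1.M.group_Out)
  interpret out: group_hom "AutoGroup M" "Out M" "out M"
    using e1.M.out_hom by unfold_locales
  have N: "\<phi> n \<in> N2" if "n \<in> N1" for n using \<phi>(2) that by blast
  have inj: "inj_on \<phi> (carrier G1)" using \<phi>(1) by (simp add: iso_def bij_betw_def)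
  have a_ap: "a (\<alpha>1 n) = \<alpha>2 (\<phi> n)" if "n \<in> N1" for n
    using that by (simp add: a_def)
  have a_hom: "a (m \<otimes>\<^bsub>M\<^esub> m') = a m \<otimes>\<^bsub>M\<^esub> a m'" if m: "m \<in> carrier M" "m' \<in> carrier M" for m m'
  proof -
    obtain n where n: "n \<in> N1" "m = \<alpha>1 n" using m(1) by (rule e1.iso_cases)
    obtain n' where n': "n' \<in> N1" "m' = \<alpha>1 n'" using m(2) by (rule e1.iso_cases)
    show ?thesis
      using a_ap[of "n \<otimes>\<^bsub>G1\<^esub> n'"] n n'
      by (simp add: a_ap e1.iso_mult e2.iso_mult N e1.mem_carrier)
  qed
  have "bij_betw a (carrier M) (carrier M)"
  proof (rule bij_betw_imageI)
    show "inj_on a (carrier M)"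
    proof (rule inj_onI)
      fix m m' assume m: "m \<in> carrier M" "m' \<in> carrier M" and eq: "a m = a m'"
      obtain n where n: "n \<in> N1" "m = \<alpha>1 n" using m(1) by (rule e1.iso_cases)
      obtain n' where n': "n' \<in> N1" "m' = \<alpha>1 n'" using m(2) by (rule e1.iso_cases)
      have "\<alpha>2 (\<phi> n) = \<alpha>2 (\<phi> n')" using eq n n' by (simp add: a_ap)
      then have "\<phi> n = \<phi> n'" using e2.bij N n(1) n'(1) by (auto simp: bij_betw_def dest: inj_onD)
      then have "n = n'" using inj_onD[OF inj] n(1) n'(1) e1.mem_carrier by blast
      then show "m = m'" using n n' by simp
    qed
    show "a ` carrier M = carrier M"
    proof
      show "carrier M \<subseteq> a ` carrier M"
      proof
        fix m assume "m \<in> carrier M"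
        then obtain n' where n': "n' \<in> N2" "m = \<alpha>2 n'" by (rule e2.iso_cases)
        then obtain n where "n \<in> N1" "n' = \<phi> n" using \<phi>(2) by blast
        then show "m \<in> a ` carrier M" using n' by (intro image_eqI[of _ _ "\<alpha>1 n"]) (simp_all add: a_ap)
      qed
    qed (auto elim!: e1.iso_cases simp: a_ap N)
  qed
  then show a: "a \<in> auto M"
    using a_hom by (auto simp: auto_def Bij_def hom_def a_def bij_betw_def)
  assume g: "g \<in> carrier G1"
  have "e2.act (\<phi> g) \<otimes>\<^bsub>AutoGroup M\<^esub> a = a \<otimes>\<^bsub>AutoGroup M\<^esub> e1.act g"
    unfolding mult_AutoGroup[OF a e1.act_auto[OF g]] mult_AutoGroup[OF e2.act_auto[OF h.hom_closed[OF g]] a]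
  proof (rule extensionalityI[of _ "carrier M"])
    fix m assume "m \<in> carrier M"
    then obtain n where n: "n \<in> N1" "m = \<alpha>1 n" by (rule e1.iso_cases)
    then show "compose (carrier M) (e2.act (\<phi> g)) a m = compose (carrier M) a (e1.act g) m"
      using g N by (simp add: compose_eq a_ap e1.act_apply e2.act_apply e1.mem_carrier)
  qed simp_all
  then have "e2.cls (\<phi> g) \<otimes>\<^bsub>Out M\<^esub> out M a = out M a \<otimes>\<^bsub>Out M\<^esub> e1.cls g"
    unfolding e1.cls_def e2.cls_def
    using out.hom_mult a e1.act_auto[OF g] e2.act_auto[OF h.hom_closed[OF g]]
    by (metis carrier_AutoGroup)
  moreover have "out M a \<in> carrier (Out M)" using a by (simp add: e1.M.carrier_Out)
  ultimately show "e2.cls (\<phi> g) = out M a \<otimes>\<^bsub>Out M\<^esub> e1.cls g \<otimes>\<^bsub>Out M\<^esub> inv\<^bsub>Out M\<^esub> (out M a)"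
    using g by (metis O.inv_solve_right O.m_closed e1.cls_closed e2.cls_closed h.hom_closed)
qed

text \<open>For existence, any representative of the target coset acts like \<open>x\<close> up to
  an inner automorphism of \<open>M\<close>, and multiplication by an element of \<open>N2\<close>
  corrects it. For uniqueness, two lifts differ by an element of \<open>N2\<close> that acts
  trivially on \<open>M\<close> and hence corresponds to a central element. Only a map
  \<open>\<theta>\<close> is asked for, so that the lemma applies to an isomorphism and to its
  inverse alike.\<close>

lemma centerless_lift:
  assumes e1: "normal_extension N1 G1 M \<alpha>1" and e2: "normal_extension N2 G2 M \<alpha>2"
    and center: "group_center M = {\<one>\<^bsub>M\<^esub>}"
    and \<theta>: "\<theta> \<in> carrier (G1 Mod N1) \<rightarrow> carrier (G2 Mod N2)"
    and cls: "\<And>x y. x \<in> carrier G1 \<Longrightarrow> y \<in> carrier G2 \<Longrightarrow> \<theta> (N1 #>\<^bsub>G1\<^esub> x) = N2 #>\<^bsub>G2\<^esub> y \<Longrightarrow>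
      normal_extension.cls N2 G2 M \<alpha>2 y = normal_extension.cls N1 G1 M \<alpha>1 x"
    and x: "x \<in> carrier G1"
  shows "\<exists>!y. y \<in> carrier G2 \<and> \<theta> (N1 #>\<^bsub>G1\<^esub> x) = N2 #>\<^bsub>G2\<^esub> y \<and>
    normal_extension.act N2 G2 M \<alpha>2 y = normal_extension.act N1 G1 M \<alpha>1 x"
proof -
  interpret e1: normal_extension N1 G1 M \<alpha>1 by fact
  interpret e2: normal_extension N2 G2 M \<alpha>2 by fact
  interpret A: group "AutoGroup M" by (rule e1.M.AutoGroup)
  interpret act2: group_hom G2 "AutoGroup M" e2.act using e2.act_hom by unfold_locales
  have "\<theta> (N1 #>\<^bsub>G1\<^esub> x) \<in> carrier (G2 Mod N2)" using \<theta> x by (auto simp: carrier_FactGroup)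
  then obtain y0 where y0: "y0 \<in> carrier G2" "\<theta> (N1 #>\<^bsub>G1\<^esub> x) = N2 #>\<^bsub>G2\<^esub> y0"
    by (auto simp: carrier_FactGroup)
  have "out M (e2.act y0) = out M (e1.act x)" using cls[OF x y0] by (simp add: e1.cls_def e2.cls_def)
  then have "e1.act x \<in> out M (e2.act y0)" using e1.M.mem_out_self[OF e1.act_auto[OF x]] by simp
  then obtain m where m: "m \<in> carrier M"
    "e1.act x = conj_map M (carrier M) m \<otimes>\<^bsub>AutoGroup M\<^esub> e2.act y0"
    using e1.M.mem_out_iff[OF e2.act_auto[OF y0(1)]] by blast
  obtain n where n: "n \<in> N2" "m = \<alpha>2 n" using m(1) by (rule e2.iso_cases)
  let ?y = "n \<otimes>\<^bsub>G2\<^esub> y0"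
  have "e2.act ?y = e1.act x"
    using n y0 m(2) e2.mem_carrier by (simp add: e2.act_N)
  moreover have "N2 #>\<^bsub>G2\<^esub> ?y = N2 #>\<^bsub>G2\<^esub> y0" using n(1) y0(1) by (rule e2.rcoset_mult)
  ultimately have y: "?y \<in> carrier G2 \<and> \<theta> (N1 #>\<^bsub>G1\<^esub> x) = N2 #>\<^bsub>G2\<^esub> ?y \<and> e2.act ?y = e1.act x"
    using y0 n(1) e2.mem_carrier by simp
  show ?thesis
  proof (rule ex1I[of _ ?y], rule y)
    fix z assume z: "z \<in> carrier G2 \<and> \<theta> (N1 #>\<^bsub>G1\<^esub> x) = N2 #>\<^bsub>G2\<^esub> z \<and> e2.act z = e1.act x"
    then have "N2 #>\<^bsub>G2\<^esub> z = N2 #>\<^bsub>G2\<^esub> ?y" using y by simp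
    then obtain k where k: "k \<in> N2" "z = k \<otimes>\<^bsub>G2\<^esub> ?y" using y z by (metis e2.rcoset_cases)
    have "e2.act k \<otimes>\<^bsub>AutoGroup M\<^esub> e2.act ?y = \<one>\<^bsub>AutoGroup M\<^esub> \<otimes>\<^bsub>AutoGroup M\<^esub> e2.act ?y"
      using z y k e2.mem_carrier[OF k(1)] act2.hom_mult[of k ?y] act2.hom_closed[of ?y] by simp
    then have "e2.act k = \<one>\<^bsub>AutoGroup M\<^esub>"
      using y e2.mem_carrier[OF k(1)] by (metis A.one_closed A.right_cancel act2.hom_closed)
    then have conj: "\<alpha>2 k \<otimes>\<^bsub>M\<^esub> m \<otimes>\<^bsub>M\<^esub> inv\<^bsub>M\<^esub> \<alpha>2 k = m" if "m \<in> carrier M" for m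
      using that k(1) e2.act_N[OF k(1)] unfolding one_AutoGroup conj_map_def by (metis restrict_apply')
    have "\<alpha>2 k \<otimes>\<^bsub>M\<^esub> m = m \<otimes>\<^bsub>M\<^esub> \<alpha>2 k" if "m \<in> carrier M" for m
      using conj[OF that] that k(1) by (metis e2.iso_closed e1.M.inv_solve_right e1.M.m_closed)
    then have "\<alpha>2 k \<in> group_center M" using k(1) by (simp add: group_center_def)
    then have "\<alpha>2 k = \<one>\<^bsub>M\<^esub>" using center by simp
    moreover have "\<alpha>2 \<one>\<^bsub>G2\<^esub> = \<one>\<^bsub>M\<^esub>"
      using e2.iso_inv[OF k(1)] e2.iso_mult[of k "inv\<^bsub>G2\<^esub> k"] k(1) e2.mem_carrier[OF k(1)] by simp
    ultimately have "k = \<one>\<^bsub>G2\<^esub>" using k(1) e2.inv_iso(1) by (metis e2.one_closed e2.subgroup_axioms subgroup.one_closed)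
    then show "z = ?y" using k y by simp
  qed
qed

text \<open>The relation \<open>R\<close> pairs elements that lie over corresponding cosets and act
  alike on \<open>M\<close>. Unique lifts in both directions make it the graph of a bijection, and
  it is compatible with products since \<open>\<theta>\<close> and both actions are
  homomorphisms.\<close>

lemma centerless_extension_iso:
  assumes e1: "normal_extension N1 G1 M \<alpha>1" and e2: "normal_extension N2 G2 M \<alpha>2"
    and center: "group_center M = {\<one>\<^bsub>M\<^esub>}"
    and \<theta>: "\<theta> \<in> iso (G1 Mod N1) (G2 Mod N2)"
    and cls: "\<And>x y. x \<in> carrier G1 \<Longrightarrow> y \<in> carrier G2 \<Longrightarrow> \<theta> (N1 #>\<^bsub>G1\<^esub> x) = N2 #>\<^bsub>G2\<^esub> y \<Longrightarrow>
      normal_extension.cls N2 G2 M \<alpha>2 y = normal_extension.cls N1 G1 M \<alpha>1 x"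
  shows "\<exists>\<phi>\<in>iso G1 G2. \<phi> ` N1 = N2"
proof -
  interpret e1: normal_extension N1 G1 M \<alpha>1 by fact
  interpret e2: normal_extension N2 G2 M \<alpha>2 by fact
  interpret A: group "AutoGroup M" by (rule e1.M.AutoGroup)
  interpret act1: group_hom G1 "AutoGroup M" e1.act using e1.act_hom by unfold_locales
  interpret act2: group_hom G2 "AutoGroup M" e2.act using e2.act_hom by unfold_locales
  interpret Q1: group "G1 Mod N1" by (rule e1.factorgroup_is_group)
  interpret Q2: group "G2 Mod N2" by (rule e2.factorgroup_is_group)
  interpret \<theta>: group_hom "G1 Mod N1" "G2 Mod N2" \<theta> using \<theta> by unfold_locales (simp add: iso_def)
  have bij: "bij_betw \<theta> (carrier (G1 Mod N1)) (carrier (G2 Mod N2))" using \<theta> by (simp add: iso_def)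
  let ?\<theta>' = "inv_into (carrier (G1 Mod N1)) \<theta>"
  have Q1: "N1 #>\<^bsub>G1\<^esub> x \<in> carrier (G1 Mod N1)" if "x \<in> carrier G1" for x
    using that by (auto simp: carrier_FactGroup)
  have Q2: "N2 #>\<^bsub>G2\<^esub> y \<in> carrier (G2 Mod N2)" if "y \<in> carrier G2" for y
    using that by (auto simp: carrier_FactGroup)
  have inv_iff: "?\<theta>' (N2 #>\<^bsub>G2\<^esub> y) = N1 #>\<^bsub>G1\<^esub> x \<longleftrightarrow> \<theta> (N1 #>\<^bsub>G1\<^esub> x) = N2 #>\<^bsub>G2\<^esub> y"
    if "x \<in> carrier G1" "y \<in> carrier G2" for x y
    using bij Q1[OF that(1)] Q2[OF that(2)] by (metis bij_betw_def f_inv_into_f inv_into_f_f)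
  define R where "R x y \<longleftrightarrow> x \<in> carrier G1 \<and> y \<in> carrier G2 \<and> \<theta> (N1 #>\<^bsub>G1\<^esub> x) = N2 #>\<^bsub>G2\<^esub> y \<and>
    e2.act y = e1.act x" for x y
  have ex1: "\<exists>!y. R x y" if "x \<in> carrier G1" for x
    using centerless_lift[OF e1 e2 center _ cls that] bij_betw_imp_funcset[OF bij] that
    by (simp add: R_def)
  have ex2: "\<exists>!x. R x y" if y: "y \<in> carrier G2" for y
  proof -
    have "\<exists>!x. x \<in> carrier G1 \<and> ?\<theta>' (N2 #>\<^bsub>G2\<^esub> y) = N1 #>\<^bsub>G1\<^esub> x \<and> e1.act x = e2.act y"
    proof (rule centerless_lift[OF e2 e1 center _ _ y])
      show "?\<theta>' \<in> carrier (G2 Mod N2) \<rightarrow> carrier (G1 Mod N1)"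
        using bij_betw_inv_into[OF bij] by (rule bij_betw_imp_funcset)
      show "e1.cls x = e2.cls z" if "z \<in> carrier G2" "x \<in> carrier G1"
        "?\<theta>' (N2 #>\<^bsub>G2\<^esub> z) = N1 #>\<^bsub>G1\<^esub> x" for z x
        using cls[OF that(2,1)] inv_iff[OF that(2,1)] that(3) by simp
    qed
    moreover have "R x y \<longleftrightarrow> x \<in> carrier G1 \<and> ?\<theta>' (N2 #>\<^bsub>G2\<^esub> y) = N1 #>\<^bsub>G1\<^esub> x \<and> e1.act x = e2.act y" for x
      using inv_iff[OF _ y] y by (auto simp: R_def)
    ultimately show ?thesis by simp
  qed
  have mult: "R (x \<otimes>\<^bsub>G1\<^esub> x') (y \<otimes>\<^bsub>G2\<^esub> y')" if "R x y" "R x' y'" for x y x' y'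
  proof -
    have c: "x \<in> carrier G1" "x' \<in> carrier G1" "y \<in> carrier G2" "y' \<in> carrier G2"
      and t: "\<theta> (N1 #>\<^bsub>G1\<^esub> x) = N2 #>\<^bsub>G2\<^esub> y" "\<theta> (N1 #>\<^bsub>G1\<^esub> x') = N2 #>\<^bsub>G2\<^esub> y'"
      and a: "e2.act y = e1.act x" "e2.act y' = e1.act x'"
      using that by (auto simp: R_def)
    have "\<theta> (N1 #>\<^bsub>G1\<^esub> (x \<otimes>\<^bsub>G1\<^esub> x')) = N2 #>\<^bsub>G2\<^esub> (y \<otimes>\<^bsub>G2\<^esub> y')"
      using \<theta>.hom_mult[OF Q1[OF c(1)] Q1[OF c(2)]] c by (simp add: e1.rcos_sum e2.rcos_sum t)
    then show ?thesis using c by (simp add: R_def a)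
  qed
  define \<phi> where "\<phi> x = (THE y. R x y)" for x
  have R\<phi>: "R x (\<phi> x)" if "x \<in> carrier G1" for x
    unfolding \<phi>_def using ex1[OF that] by (rule theI')
  have \<phi>_eq: "\<phi> x = y" if "R x y" for x y
    using ex1[of x] R\<phi>[of x] that by (auto simp: R_def)
  have "\<phi> \<in> iso G1 G2"
  proof (rule isoI)
    show "\<phi> \<in> hom G1 G2"
    proof (rule homI)
      show "\<phi> x \<in> carrier G2" if "x \<in> carrier G1" for x using R\<phi>[OF that] by (simp add: R_def)
      show "\<phi> (x \<otimes>\<^bsub>G1\<^esub> y) = \<phi> x \<otimes>\<^bsub>G2\<^esub> \<phi> y" if "x \<in> carrier G1" "y \<in> carrier G1" for x y
        using that by (intro \<phi>_eq mult R\<phi>)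
    qed
    show "bij_betw \<phi> (carrier G1) (carrier G2)"
    proof (rule bij_betw_imageI)
      show "inj_on \<phi> (carrier G1)"
      proof (rule inj_onI)
        fix x y assume "x \<in> carrier G1" "y \<in> carrier G1" "\<phi> x = \<phi> y"
        then have "R x (\<phi> x)" "R y (\<phi> x)" using R\<phi>[of x] R\<phi>[of y] by auto
        then show "x = y" using ex2[of "\<phi> x"] by (auto simp: R_def)
      qed
      show "\<phi> ` carrier G1 = carrier G2"
      proof
        show "\<phi> ` carrier G1 \<subseteq> carrier G2" using R\<phi> by (auto simp: R_def)
        show "carrier G2 \<subseteq> \<phi> ` carrier G1"
        proof
          fix y assume "y \<in> carrier G2"
          then obtain x where x: "R x y" using ex2 by blast
          then show "y \<in> \<phi> ` carrier G1" using \<phi>_eq[OF x] by (auto simp: R_def)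
        qed
      qed
    qed
  qed
  moreover have "\<phi> ` N1 = N2"
  proof -
    \<comment> \<open>\<open>\<theta>\<close> is injective and takes the neutral coset
      \<open>N1\<close> to the neutral coset \<open>N2\<close>.\<close>
    have iff: "x \<in> N1 \<longleftrightarrow> y \<in> N2" if "R x y" for x y
    proof -
      have c: "x \<in> carrier G1" "y \<in> carrier G2" and t: "\<theta> (N1 #>\<^bsub>G1\<^esub> x) = N2 #>\<^bsub>G2\<^esub> y"
        using that by (auto simp: R_def)
      have "x \<in> N1 \<longleftrightarrow> N1 #>\<^bsub>G1\<^esub> x = N1"
        using c(1) e1.coset_join1 e1.coset_join2 e1.subgroup_axioms e1.subset by metis
      also have "\<dots> \<longleftrightarrow> \<theta> (N1 #>\<^bsub>G1\<^esub> x) = N2"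
        using \<theta>.hom_one bij Q1[OF c(1)] Q1.one_closed by (metis bij_betw_def inj_onD one_FactGroup)
      also have "\<dots> \<longleftrightarrow> y \<in> N2"
        unfolding t using c(2) e2.coset_join1 e2.coset_join2 e2.subgroup_axioms e2.subset by metis
      finally show ?thesis .
    qed
    show ?thesis
    proof
      show "\<phi> ` N1 \<subseteq> N2" using iff R\<phi> e1.mem_carrier by blast
      show "N2 \<subseteq> \<phi> ` N1"
      proof
        fix y assume y: "y \<in> N2"
        then obtain x where x: "R x y" using ex2 e2.mem_carrier by blast
        then show "y \<in> \<phi> ` N1" using iff[OF x] y \<phi>_eq[OF x] by blast
      qed
    qed
  qed
  ultimately show ?thesis by blast
qed

section \<open>Crystallographic groups\<close>

text \<open>The linear part of an affine map, written so that it makes sense for every map.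
  Linearity is therefore always a separate statement.\<close>

definition lin :: "('a::real_vector \<Rightarrow> 'b::real_vector) \<Rightarrow> 'a \<Rightarrow> 'b" where
  "lin f x = f x - f 0"

lemma mem_isometry_group:
  "f \<in> carrier isometry_group \<longleftrightarrow> bij f \<and> (\<forall>x y. dist (f x) (f y) = dist x y)"
  by (simp add: isometry_group_def)

lemma mult_isometry_group [simp]: "f \<otimes>\<^bsub>isometry_group\<^esub> g = f \<circ> g"
  by (simp add: isometry_group_def)

lemma one_isometry_group [simp]: "\<one>\<^bsub>isometry_group\<^esub> = id"
  by (simp add: isometry_group_def)

lemma inv_isometry_group:
  assumes "f \<in> carrier isometry_group"
  shows "inv\<^bsub>isometry_group\<^esub> f = inv_into UNIV f"
proof -
  interpret group "isometry_group :: ('a \<Rightarrow> 'a) monoid" by (rule group_isometry_group)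
  have "(inv\<^bsub>isometry_group\<^esub> f) \<circ> f = id" using l_inv[OF assms] by simp
  then show ?thesis
    by (metis assms bij_is_surj comp_apply ext id_apply mem_isometry_group surj_f_inv_f)
qed

lemma lin_orthogonal:
  fixes f :: "'a::euclidean_space \<Rightarrow> 'a"
  assumes "f \<in> carrier isometry_group"
  shows "orthogonal_transformation (lin f)"
  using assms by (simp add: orthogonal_transformation_isometry lin_def mem_isometry_group dist_norm)

lemma lin_comp:
  fixes f :: "'a::euclidean_space \<Rightarrow> 'a"
  assumes "f \<in> carrier isometry_group"
  shows "lin (f \<circ> g) = lin f \<circ> lin g"
proof
  fix x
  have "linear (lin f)" using lin_orthogonal[OF assms] by (rule orthogonal_transformation_linear)
  then have "lin f (g x) - lin f (g 0) = lin f (g x - g 0)" by (simp add: linear_diff)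
  then show "lin (f \<circ> g) x = (lin f \<circ> lin g) x" by (simp add: lin_def)
qed

section \<open>Finiteness of the point group (Bieberbach's first theorem)\<close>

text \<open>Total boundedness of a ball: the color of a bounded \<open>f\<close> records, for each
  point of the finite set \<open>X\<close>, the center of a ball of radius \<open>e / 2\<close>
  containing the value there. This turns compactness into a pigeonhole principle.\<close>

lemma finite_coloring:
  fixes X :: "'a set" and R e :: real
  assumes X: "finite X" and e: "e > 0"
  obtains c :: "('a \<Rightarrow> 'b::euclidean_space) \<Rightarrow> 'a \<Rightarrow> 'b"
  where "finite (c ` {f. \<forall>x\<in>X. norm (f x) \<le> R})"
    and "\<And>f g x. \<forall>x\<in>X. norm (f x) \<le> R \<Longrightarrow> \<forall>x\<in>X. norm (g x) \<le> R \<Longrightarrow> c f = c g \<Longrightarrow> x \<in> X \<Longrightarrow>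
      dist (f x) (g x) < e"
proof -
  have "compact (cball (0::'b) R)" by simp
  moreover have "e / 2 > 0" using e by simp
  ultimately obtain K where K: "finite K" "cball (0::'b) R \<subseteq> (\<Union>k\<in>K. ball k (e / 2))"
    unfolding compact_eq_totally_bounded by blast
  define c where "c f = (\<lambda>x\<in>X. SOME k. k \<in> K \<and> dist k (f x) < e / 2)" for f :: "'a \<Rightarrow> 'b"
  have c: "c f x \<in> K \<and> dist (c f x) (f x) < e / 2" if "x \<in> X" "norm (f x) \<le> R" for f x
  proof -
    have "\<exists>k. k \<in> K \<and> dist k (f x) < e / 2" using K(2) that(2) by (force simp: subset_iff)
    then have "(SOME k. k \<in> K \<and> dist k (f x) < e / 2) \<in> K \<and>
        dist (SOME k. k \<in> K \<and> dist k (f x) < e / 2) (f x) < e / 2" by (rule someI_ex)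
    then show ?thesis using that by (simp add: c_def)
  qed
  show thesis
  proof
    have "c ` {f. \<forall>x\<in>X. norm (f x) \<le> R} \<subseteq> PiE X (\<lambda>_. K)"
    proof (intro image_subsetI PiE_I)
      fix f :: "'a \<Rightarrow> 'b" and x assume "f \<in> {f. \<forall>x\<in>X. norm (f x) \<le> R}" "x \<in> X"
      then show "c f x \<in> K" using c by blast
    next
      fix f :: "'a \<Rightarrow> 'b" and x assume "x \<notin> X"
      then show "c f x = undefined" by (simp add: c_def)
    qed
    then show "finite (c ` {f. \<forall>x\<in>X. norm (f x) \<le> R})"
      by (rule finite_subset) (simp add: finite_PiE X K(1))
    fix f g :: "'a \<Rightarrow> 'b" and x
    assume "\<forall>x\<in>X. norm (f x) \<le> R" "\<forall>x\<in>X. norm (g x) \<le> R" "c f = c g" "x \<in> X"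
    then have "dist (c f x) (f x) < e / 2" "dist (c f x) (g x) < e / 2" using c by metis+
    then show "dist (f x) (g x) < e" by (rule dist_triangle_half_r)
  qed
qed

lemma orthogonal_coloring:
  fixes e :: real
  assumes e: "e > 0"
  obtains c :: "('a::euclidean_space \<Rightarrow> 'a) \<Rightarrow> 'a \<Rightarrow> 'a"
  where "finite (c ` {f. orthogonal_transformation f})"
    and "\<And>f g x. orthogonal_transformation f \<Longrightarrow> orthogonal_transformation g \<Longrightarrow> c f = c g \<Longrightarrow>
      norm (f x - g x) \<le> e * norm x"
proof -
  \<comment> \<open>A difference of linear maps is controlled by its values on the basis, and the
    errors at the \<open>DIM('a)\<close> basis vectors add up.\<close>
  let ?e = "e / DIM('a)"
  have "?e > 0" using e by simp
  then obtain c :: "('a \<Rightarrow> 'a) \<Rightarrow> 'a \<Rightarrow> 'a" where c: "finite (c ` {f. \<forall>x\<in>Basis. norm (f x) \<le> 1})"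
    "\<And>f g x. \<forall>x\<in>Basis. norm (f x) \<le> 1 \<Longrightarrow> \<forall>x\<in>Basis. norm (g x) \<le> 1 \<Longrightarrow> c f = c g \<Longrightarrow>
      x \<in> Basis \<Longrightarrow> dist (f x) (g x) < ?e"
    by (rule finite_coloring[OF finite_Basis, of _ 1]) (erule that, blast)
  have 1: "\<forall>x\<in>Basis. norm (f x) \<le> 1" if "orthogonal_transformation f" for f :: "'a \<Rightarrow> 'a"
    using that by (simp add: orthogonal_transformation_norm)
  show thesis
  proof
    show "finite (c ` {f. orthogonal_transformation f})"
      by (rule finite_subset[OF _ c(1)]) (use 1 in auto)
    fix f g :: "'a \<Rightarrow> 'a" and x :: 'a
    assume f: "orthogonal_transformation f" and g: "orthogonal_transformation g" and fg: "c f = c g"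
    let ?h = "\<lambda>x. f x - g x"
    have h: "linear ?h"
      using f g by (intro linear_compose_sub) (auto intro: orthogonal_transformation_linear)
    have "?h x = ?h (\<Sum>b\<in>Basis. (x \<bullet> b) *\<^sub>R b)" by (simp add: euclidean_representation)
    also have "\<dots> = (\<Sum>b\<in>Basis. (x \<bullet> b) *\<^sub>R ?h b)"
      by (simp only: linear_sum[OF h] linear_cmul[OF h])
    finally have "norm (?h x) \<le> (\<Sum>b\<in>Basis. norm ((x \<bullet> b) *\<^sub>R ?h b))"
      by (simp only: norm_sum)
    also have "\<dots> \<le> (\<Sum>b\<in>(Basis::'a set). norm x * ?e)"
    proof (rule sum_mono)
      fix b :: 'a assume b: "b \<in> Basis"
      then have "norm (?h b) < ?e" using c(2)[OF 1[OF f] 1[OF g] fg b] by (simp add: dist_norm)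
      moreover have "\<bar>x \<bullet> b\<bar> \<le> norm x" using b by (rule Basis_le_norm)
      ultimately show "norm ((x \<bullet> b) *\<^sub>R ?h b) \<le> norm x * ?e"
        unfolding norm_scaleR by (intro mult_mono) auto
    qed
    also have "\<dots> = e * norm x" by simp
    finally show "norm (f x - g x) \<le> e * norm x" .
  qed
qed

text \<open>An affine function bounded below is constant: with a nonzero slope the argument
  \<open>- (s + 1) / (2 * c)\<close> would give the value -1. It stands in for the Cauchy-Schwarz
  inequality of a semidefinite form.\<close>

lemma affine_nonneg_imp_slope_0:
  fixes s c :: real
  assumes "\<And>t. s + 2 * t * c \<ge> 0"
  shows "c = 0"
proof (rule ccontr)
  assume "c \<noteq> 0"
  then have "s + 2 * (- (s + 1) / (2 * c)) * c = -1" by (simp add: field_simps)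
  with assms[of "- (s + 1) / (2 * c)"] show False by simp
qed

text \<open>\<open>m\<close> is the operator norm of \<open>A - id\<close>, and \<open>E\<close> is
  the set of vectors on which it is attained. \<open>E\<close> is a subspace because it is the null
  space of the positive semidefinite form \<open>q\<close>. On the invariant orthogonal complement
  the maximum, attained by compactness, is strictly smaller; the gap between \<open>m'\<close> and
  \<open>m\<close> is what the commutator argument exploits.\<close>

lemma max_displacement_subspace:
  fixes A :: "'a::euclidean_space \<Rightarrow> 'a"
  assumes A: "orthogonal_transformation A" and ne: "A \<noteq> id"
  obtains m' m E where "0 \<le> m'" "m' < m" "\<And>x. norm (A x - x) \<le> m * norm x"
    "subspace E" "E \<noteq> {0}" "\<And>x. x \<in> E \<Longrightarrow> norm (A x - x) = m * norm x"
    "\<And>x. x \<in> E \<Longrightarrow> A x \<in> E"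
    "\<forall>x. (\<forall>y\<in>E. orthogonal x y) \<longrightarrow> norm (A x - x) \<le> m' * norm x"
    "\<forall>x. (\<forall>y\<in>E. orthogonal x y) \<longrightarrow> (\<forall>y\<in>E. orthogonal (A x) y)"
proof -
  have lA: "linear A" using A by (rule orthogonal_transformation_linear)
  let ?D = "\<lambda>x. A x - x"
  have lD: "linear ?D" using linear_compose_sub[OF lA linear_ident] .
  have cont: "continuous_on S (\<lambda>x. norm (?D x))" for S
    using linear_continuous_on[of ?D S] lD by (intro continuous_on_norm) (simp add: linear_conv_bounded_linear)
  obtain x0 where x0: "?D x0 \<noteq> 0" using ne by (auto simp: fun_eq_iff)
  have max: "\<exists>x\<in>sphere 0 1 \<inter> F. \<forall>y\<in>F. norm (?D y) \<le> norm (?D x) * norm y"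
    if F: "subspace F" "F \<noteq> {0}" for F
  proof -
    obtain z where z: "z \<in> F" "z \<noteq> 0" using F subspace_0[OF F(1)] by auto
    have cp: "compact (sphere 0 1 \<inter> F)"
      using F(1) by (intro compact_Int_closed closed_subspace) auto
    have "z /\<^sub>R norm z \<in> sphere 0 1 \<inter> F" using z F(1) by (simp add: subspace_mul)
    then obtain x where x: "x \<in> sphere 0 1 \<inter> F" "\<And>y. y \<in> sphere 0 1 \<inter> F \<Longrightarrow> norm (?D y) \<le> norm (?D x)"
      using continuous_attains_sup[OF cp _ cont] by blast
    have "norm (?D y) \<le> norm (?D x) * norm y" if y: "y \<in> F" for y
    proof (cases "y = 0")
      case False
      have "norm (?D (y /\<^sub>R norm y)) \<le> norm (?D x)"
        using False y F(1) by (intro x(2)) (simp add: subspace_mul)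
      then have "norm (?D y) / norm y \<le> norm (?D x)"
        by (simp only: linear_cmul[OF lD]) (simp add: divide_inverse mult.commute)
      then show ?thesis using False by (simp add: field_simps)
    qed (simp add: linear_0[OF lA])
    then show ?thesis using x(1) by blast
  qed
  have U: "subspace (UNIV :: 'a set)" "(UNIV :: 'a set) \<noteq> {0}"
    using x0 linear_0[OF lD] by auto
  obtain x1 where x1: "norm x1 = 1" "\<And>y. norm (?D y) \<le> norm (?D x1) * norm y"
    using max[OF U] by auto
  define m where "m = norm (?D x1)"
  have m: "norm (?D y) \<le> m * norm y" for y using x1 by (simp add: m_def)
  have m_pos: "m > 0"
  proof -
    have "0 < m * norm x0" using x0 m[of x0] by (metis less_le_trans zero_less_norm_iff)
    then show ?thesis by (simp add: m_def zero_less_mult_iff)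
  qed
  define E where "E = {x. norm (?D x) = m * norm x}"
  define q where "q x y = m\<^sup>2 * (x \<bullet> y) - ?D x \<bullet> ?D y" for x y
  have q_nonneg: "q x x \<ge> 0" for x
    using power_mono[OF m[of x], of 2] by (simp add: q_def power_mult_distrib power2_norm_eq_inner)
  have E_q: "x \<in> E \<longleftrightarrow> q x x = 0" for x
  proof -
    have "x \<in> E \<longleftrightarrow> (norm (?D x))\<^sup>2 = (m * norm x)\<^sup>2"
      using m_pos by (simp add: E_def)
    then show ?thesis by (auto simp add: q_def power_mult_distrib power2_norm_eq_inner)
  qed
  have q_add: "q (x + y) z = q x z + q y z" "q z (x + y) = q z x + q z y" for x y z
    by (simp_all add: q_def linear_add[OF lA] algebra_simps inner_simps)
  have q_scale: "q (c *\<^sub>R x) z = c * q x z" "q z (c *\<^sub>R x) = c * q z x" for c x z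
    by (simp_all add: q_def linear_cmul[OF lA] algebra_simps inner_simps)
  have q_sym: "q x y = q y x" for x y by (simp add: q_def inner_commute)
  \<comment> \<open>A null vector of a semidefinite form is orthogonal to everything: otherwise
    \<open>q\<close> would become negative along the line \<open>y + t *\<^sub>R x\<close>.\<close>
  have E_orth: "q x y = 0" if "x \<in> E" for x y
  proof (rule affine_nonneg_imp_slope_0)
    fix t
    show "0 \<le> q y y + 2 * t * q x y"
      using q_nonneg[of "y + t *\<^sub>R x"] that
      by (simp add: q_add q_scale E_q q_sym[of y x])
  qed
  have subE: "subspace E"
    unfolding subspace_def
    by (auto simp: E_q q_add q_scale E_orth) (simp add: q_def linear_0[OF lA])
  have AE: "A x \<in> E" if "x \<in> E" for x
    using that by (simp add: E_def orthogonal_transformation_norm[OF A] flip: linear_diff[OF lA])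
  have x1E: "x1 \<in> E" using x1 by (simp add: E_def m_def)
  have Aorth: "orthogonal (A x) y" if x: "\<And>y. y \<in> E \<Longrightarrow> orthogonal x y" and y: "y \<in> E" for x y
  proof -
    obtain z where z: "y = A z" using orthogonal_transformation_surj[OF A] by (metis surjD)
    have "z \<in> E" using y unfolding z
      by (simp add: E_def orthogonal_transformation_norm[OF A] flip: linear_diff[OF lA])
    then show ?thesis using x A z by (simp add: orthogonal_def orthogonal_transformation_def)
  qed
  let ?F = "{x. \<forall>y\<in>E. orthogonal x y}"
  have subF: "subspace ?F"
    by (auto simp: subspace_def orthogonal_def inner_simps)
  have "\<exists>m'. 0 \<le> m' \<and> m' < m \<and> (\<forall>x\<in>?F. norm (?D x) \<le> m' * norm x)"
  proof (cases "?F = {0}")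
    case True
    then have "\<forall>x\<in>?F. norm (?D x) \<le> 0 * norm x" by (auto simp: linear_0[OF lA])
    then show ?thesis using m_pos by blast
  next
    case False
    obtain x where x: "norm x = 1" "x \<in> ?F" "\<forall>y\<in>?F. norm (?D y) \<le> norm (?D x) * norm y"
      using max[OF subF False] by auto
    have "norm (?D x) \<noteq> m"
    proof
      assume "norm (?D x) = m"
      then have "x \<in> E" using x(1) by (simp add: E_def)
      then have "orthogonal x x" using x(2) by blast
      then show False using x(1) by (auto simp: orthogonal_self)
    qed
    then have "norm (?D x) < m" using m[of x] x(1) by simp
    then show ?thesis using x(3) by (intro exI[of _ "norm (?D x)"]) auto
  qed
  then obtain m' where m': "0 \<le> m'" "m' < m" "\<And>x. x \<in> ?F \<Longrightarrow> norm (?D x) \<le> m' * norm x" by blast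
  show thesis
  proof (rule that[OF m'(1,2) m subE _ _ AE])
    show "E \<noteq> {0}" using x1E x1(1) by auto
    show "norm (?D x) = m * norm x" if "x \<in> E" for x using that by (simp add: E_def)
    show "\<forall>x. (\<forall>y\<in>E. orthogonal x y) \<longrightarrow> norm (?D x) \<le> m' * norm x"
      using m'(3) by blast
    show "\<forall>x. (\<forall>y\<in>E. orthogonal x y) \<longrightarrow> (\<forall>y\<in>E. orthogonal (A x) y)"
      using Aorth by blast
  qed
qed


locale isometry_subgroup =
  fixes G :: "('a::euclidean_space \<Rightarrow> 'a) set"
  assumes sub: "subgroup G isometry_group"
begin

lemma group_grp: "group (grp G)"
  using subgroup.subgroup_is_group[OF sub group_isometry_group] .

lemma mem_carrier: "g \<in> G \<Longrightarrow> g \<in> carrier isometry_group"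
  using subgroup.mem_carrier[OF sub] .

lemma dist_eq: "g \<in> G \<Longrightarrow> dist (g x) (g y) = dist x y"
  using mem_carrier by (simp add: mem_isometry_group)

lemma bij: "g \<in> G \<Longrightarrow> bij g"
  using mem_carrier by (simp add: mem_isometry_group)

lemma id_mem: "id \<in> G"
  using subgroup.one_closed[OF sub] by simp

lemma comp_mem: "f \<in> G \<Longrightarrow> g \<in> G \<Longrightarrow> f \<circ> g \<in> G"
  using subgroup.m_closed[OF sub, of f g] by simp

lemma inv_mem: "g \<in> G \<Longrightarrow> inv_into UNIV g \<in> G"
  using subgroup.m_inv_closed[OF sub, of g] by (simp add: inv_isometry_group mem_carrier)

lemma inv_apply [simp]:
  assumes "g \<in> G"
  shows "g (inv_into UNIV g x) = x" "inv_into UNIV g (g x) = x"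
  using bij[OF assms] by (simp_all add: bij_is_surj surj_f_inv_f bij_is_inj)

lemma norm_inv_0: "g \<in> G \<Longrightarrow> norm (inv_into UNIV g 0) = norm (g 0)"
  using dist_eq[of g "inv_into UNIV g 0" 0] by simp

lemma orth: "g \<in> G \<Longrightarrow> orthogonal_transformation (lin g)"
  by (simp add: lin_orthogonal mem_carrier)

lemma lin_linear: "g \<in> G \<Longrightarrow> linear (lin g)"
  by (simp add: orth orthogonal_transformation_linear)

lemma lin_norm: "g \<in> G \<Longrightarrow> norm (lin g x) = norm x"
  by (simp add: orth orthogonal_transformation_norm)

lemma lin_comp_apply: "f \<in> G \<Longrightarrow> lin (f \<circ> g) x = lin f (lin g x)"
  by (simp add: lin_comp mem_carrier)

lemma decomp: "g x = lin g x + g 0"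
  by (simp add: lin_def)

lemma lin_inv [simp]:
  assumes g: "g \<in> G"
  shows "lin g (lin (inv_into UNIV g) x) = x" "lin (inv_into UNIV g) (lin g x) = x"
proof -
  have "g \<circ> inv_into UNIV g = id" "inv_into UNIV g \<circ> g = id" using g by (auto simp: fun_eq_iff)
  then show "lin g (lin (inv_into UNIV g) x) = x" "lin (inv_into UNIV g) (lin g x) = x"
    using lin_comp_apply[of g "inv_into UNIV g" x] lin_comp_apply[OF inv_mem[OF g], of g x] g
    by (simp_all add: lin_def[of id])
qed

lemma inv_grp: "g \<in> G \<Longrightarrow> inv\<^bsub>grp G\<^esub> g = inv_into UNIV g"
  using group.m_inv_consistent[OF group_isometry_group sub] by (simp add: inv_isometry_group mem_carrier)

end

text \<open>Proper discontinuity and cocompactness in metric form, with the origin as base point.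
  The equivalence with the topological definition is \<open>space_group_iff_crystal\<close>.\<close>

locale crystal = isometry_subgroup +
  assumes fin: "finite {g \<in> G. norm (g 0) \<le> R}"
    and cocompact: "\<exists>R. \<forall>x. \<exists>g\<in>G. norm (g x) \<le> R"
begin

text \<open>Only finitely many elements have a translation part no longer than that of
  \<open>g\<close>, so the minimum is attained. This replaces an induction on the size of group
  elements.\<close>

lemma ex_minimal:
  assumes "g \<in> G" "P g"
  obtains h where "h \<in> G" "P h" "\<And>k. k \<in> G \<Longrightarrow> P k \<Longrightarrow> norm (h 0) \<le> norm (k 0)"
proof -
  let ?S = "{k \<in> G. norm (k 0) \<le> norm (g 0)} \<inter> {k. P k}"
  have S: "finite ?S" "g \<in> ?S" using fin assms by auto
  define h where "h = arg_min_on (\<lambda>k. norm (k 0)) ?S"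
  have h: "h \<in> ?S" unfolding h_def using S by (intro arg_min_if_finite) auto
  have min: "norm (h 0) \<le> norm (k 0)" if "k \<in> ?S" for k
    unfolding h_def using S that by (intro arg_min_least[where f = "\<lambda>k. norm (k 0)"]) auto
  show thesis
  proof (rule that[of h])
    fix k assume "k \<in> G" "P k"
    then show "norm (h 0) \<le> norm (k 0)"
      using min[of k] min[OF S(2)] by (cases "k \<in> ?S") auto
  qed (use h in auto)
qed

text \<open>Cocompactness gives, for each \<open>k\<close>, an element \<open>f k\<close> taking the
  origin close to \<open>real k *\<^sub>R u\<close>. Infinitely many of the linear parts share the
  color of some \<open>f i\<close>, so \<open>f j\<close> composed with the inverse of
  \<open>f i\<close> barely rotates, and for large \<open>j\<close> it moves the origin far, nearly
  in the direction of \<open>u\<close>.\<close>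

lemma almost_translation:
  assumes u: "norm u = 1" and e: "e > 0" and d: "d > 0"
  obtains g where "g \<in> G" "g 0 \<noteq> 0" "\<And>x. norm (lin g x - x) \<le> e * norm x"
    "norm (g 0 - norm (g 0) *\<^sub>R u) \<le> d * norm (g 0)"
proof -
  obtain R where R: "\<And>x. \<exists>g\<in>G. norm (g x) \<le> R" using cocompact by blast
  have "\<exists>f\<in>G. norm (f 0 - real k *\<^sub>R u) \<le> R" for k :: nat
  proof -
    obtain g where g: "g \<in> G" "norm (g (real k *\<^sub>R u)) \<le> R" using R by blast
    have "dist (inv_into UNIV g 0) (real k *\<^sub>R u) = dist 0 (g (real k *\<^sub>R u))"
      using dist_eq[OF g(1), of "inv_into UNIV g 0" "real k *\<^sub>R u"] g(1) by simp
    then show ?thesis using g inv_mem by (intro bexI[of _ "inv_into UNIV g"]) (auto simp: dist_norm)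
  qed
  then obtain f where f: "\<And>k. f k \<in> G" "\<And>k. norm (f k 0 - real k *\<^sub>R u) \<le> R" by metis
  obtain c :: "('a \<Rightarrow> 'a) \<Rightarrow> 'a \<Rightarrow> 'a" where c: "finite (c ` {f. orthogonal_transformation f})"
    "\<And>f g x. orthogonal_transformation f \<Longrightarrow> orthogonal_transformation g \<Longrightarrow> c f = c g \<Longrightarrow>
      norm (f x - g x) \<le> e * norm x"
    using e by (rule orthogonal_coloring) (erule that, blast)
  have "finite ((\<lambda>k. c (lin (f k))) ` UNIV)"
    by (rule finite_subset[OF _ c(1)]) (use f(1) orth in auto)
  then obtain i where "infinite {j \<in> UNIV. c (lin (f j)) = c (lin (f i))}"
    using pigeonhole_infinite[OF infinite_UNIV_nat] by blast
  then have inf: "infinite {j. c (lin (f j)) = c (lin (f i))}" by simp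
  \<comment> \<open>\<open>D\<close> bounds the distance from \<open>g 0\<close> to
    \<open>real j *\<^sub>R u\<close>: one \<open>R\<close> comes from \<open>f j\<close>, and the
    norm of \<open>f i 0\<close>, at most \<open>real i + R\<close>, comes from the inverse of
    \<open>f i\<close>.\<close>
  define D where "D = real i + 2 * R"
  have R0: "0 \<le> R" using f(2)[of 0] norm_ge_zero order_trans by blast
  \<comment> \<open>The threshold ensures that \<open>2 * D\<close>, which bounds the deviation from
    the direction \<open>u\<close>, is at most \<open>d * (real j - D)\<close>, where
    \<open>real j - D\<close> is a lower bound for the norm of \<open>g 0\<close>.\<close>
  obtain j where j: "j \<in> {j. c (lin (f j)) = c (lin (f i))}" "nat \<lceil>D + 2 * D / d\<rceil> < j"
    using inf unfolding infinite_nat_iff_unbounded by blast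
  have jD: "real j > D + 2 * D / d" using j(2) by linarith
  define g where "g = f j \<circ> inv_into UNIV (f i)"
  have g: "g \<in> G" unfolding g_def using f(1) by (intro comp_mem inv_mem)
  have "norm (g 0 - f j 0) = norm (f i 0)"
    using dist_eq[OF f(1)[of j], of "inv_into UNIV (f i) 0" 0] norm_inv_0[OF f(1)[of i]]
    by (simp add: g_def dist_norm)
  moreover have "norm (f i 0) \<le> real i + R"
    using f(2)[of i] norm_triangle_sub[of "f i 0" "real i *\<^sub>R u"] u by simp
  ultimately have gj: "norm (g 0 - real j *\<^sub>R u) \<le> D"
    using f(2)[of j] norm_triangle_ineq[of "g 0 - f j 0" "f j 0 - real j *\<^sub>R u"]
    by (simp add: D_def)
  have diff: "\<bar>norm (g 0) - real j\<bar> \<le> D"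
    using gj norm_triangle_ineq3[of "g 0" "real j *\<^sub>R u"] u by simp
  have eq: "g 0 - norm (g 0) *\<^sub>R u = (g 0 - real j *\<^sub>R u) + (real j - norm (g 0)) *\<^sub>R u"
    by (simp add: algebra_simps)
  have "norm (g 0 - norm (g 0) *\<^sub>R u) \<le>
      norm (g 0 - real j *\<^sub>R u) + norm ((real j - norm (g 0)) *\<^sub>R u)"
    unfolding eq by (rule norm_triangle_ineq)
  then have "norm (g 0 - norm (g 0) *\<^sub>R u) \<le> D + \<bar>real j - norm (g 0)\<bar>"
    using gj by (simp add: u)
  then have "norm (g 0 - norm (g 0) *\<^sub>R u) \<le> 2 * D" using diff by linarith
  also have "2 * D \<le> d * (real j - D)" using jD d by (simp add: field_simps)
  also have "\<dots> \<le> d * norm (g 0)" using diff d by (intro mult_left_mono) auto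
  finally have 1: "norm (g 0 - norm (g 0) *\<^sub>R u) \<le> d * norm (g 0)" .
  have "2 * D / d \<ge> 0" using d R0 by (simp add: D_def)
  then have 2: "g 0 \<noteq> 0" using diff jD by auto
  have "norm (lin g x - x) \<le> e * norm x" for x
  proof -
    let ?y = "lin (inv_into UNIV (f i)) x"
    have "norm (lin (f j) ?y - lin (f i) ?y) \<le> e * norm ?y"
      using j(1) by (intro c(2) orth f(1)) simp
    moreover have "lin (f j) ?y = lin g x" by (simp add: g_def lin_comp_apply f(1))
    moreover have "lin (f i) ?y = x" by (simp add: f(1))
    ultimately show ?thesis by (simp add: lin_norm inv_mem f(1))
  qed
  with g 1 2 show thesis by (intro that)
qed

end

context crystal begin

text \<open>
  Buser's argument: the commutator of \<open>\<alpha>\<close> with an almost translation \<open>\<beta>\<close> in the direction of maximal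
  displacement of \<open>lin \<alpha>\<close> is again such an almost translation, but shorter.
\<close>

lemma small_rotation_trivial:
  assumes "\<alpha> \<in> G" "\<And>x. norm (lin \<alpha> x - x) \<le> 1/2 * norm x"
  shows "lin \<alpha> = id"
proof (rule ccontr)
  assume "lin \<alpha> \<noteq> id"
  define P where "P g \<longleftrightarrow> lin g \<noteq> id \<and> (\<forall>x. norm (lin g x - x) \<le> 1/2 * norm x)" for g :: "'a \<Rightarrow> 'a"
  have "P \<alpha>" using assms(2) \<open>lin \<alpha> \<noteq> id\<close> by (simp add: P_def)
  then obtain f where f: "f \<in> G" "P f" "\<And>k. k \<in> G \<Longrightarrow> P k \<Longrightarrow> norm (f 0) \<le> norm (k 0)"
    using ex_minimal[of \<alpha> P] assms(1) by blast
  define A where "A = lin f"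
  have oA: "orthogonal_transformation A" and Ane: "A \<noteq> id" using f orth by (auto simp: A_def P_def)
  have lA: "linear A" using oA by (rule orthogonal_transformation_linear)
  obtain m' m E where m: "0 \<le> m'" "m' < m" and mA: "\<And>x. norm (A x - x) \<le> m * norm x"
    and E: "subspace E" "E \<noteq> {0}" "\<And>x. x \<in> E \<Longrightarrow> norm (A x - x) = m * norm x"
      "\<And>x. x \<in> E \<Longrightarrow> A x \<in> E"
    and F: "\<forall>x. (\<forall>y\<in>E. orthogonal x y) \<longrightarrow> norm (A x - x) \<le> m' * norm x"
      "\<forall>x. (\<forall>y\<in>E. orthogonal x y) \<longrightarrow> (\<forall>y\<in>E. orthogonal (A x) y)"
    by (rule max_displacement_subspace[OF oA Ane]) (rule that, assumption+)
  obtain e0 where e0: "e0 \<in> E" "e0 \<noteq> 0" using E(1,2) subspace_0 by blast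
  have "m * norm e0 \<le> 1/2 * norm e0"
    using E(3)[OF e0(1)] f(2) unfolding P_def A_def by metis
  then have m_half: "m \<le> 1/2" using e0(2) by simp
  \<comment> \<open>The factor 8 keeps the error \<open>r\<close> of the commutator, of norm at most
    \<open>2 * e * norm (g 0)\<close> with \<open>norm (g 0) < 2 * norm y\<close>, below half the
    gap \<open>(m - m') * norm y\<close>.\<close>
  define e where "e = (m - m') / 8"
  have e: "0 < e" "e \<le> 1/2" using m m_half by (auto simp: e_def)
  \<comment> \<open>These are almost translations whose component in \<open>E\<close> dominates the
    component orthogonal to \<open>E\<close>.\<close>
  define Q where "Q g \<longleftrightarrow> g 0 \<noteq> 0 \<and> (\<forall>x. norm (lin g x - x) \<le> e * norm x) \<and>
    (\<exists>y\<in>E. \<exists>z. (\<forall>w\<in>E. orthogonal z w) \<and> g 0 = y + z \<and> norm z < norm y)" for g :: "'a \<Rightarrow> 'a"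
  have dec: "\<exists>y\<in>E. \<exists>z. (\<forall>w\<in>E. orthogonal z w) \<and> x = y + z" for x
    using orthogonal_subspace_decomp_exists[of E x] E(1) by (metis span_eq_iff)
  have pyth: "(norm (y + z))\<^sup>2 = (norm y)\<^sup>2 + (norm z)\<^sup>2"
    if "y \<in> E" "\<forall>w\<in>E. orthogonal z w" for y z
    using that by (intro norm_add_Pythagorean) (auto simp: orthogonal_commute)
  have small: "norm y \<le> norm (y + z)" "norm z \<le> norm (y + z)"
    if "y \<in> E" "\<forall>w\<in>E. orthogonal z w" for y z
    by (rule power2_le_imp_le, simp add: pyth[OF that], simp)+
  have "\<exists>g\<in>G. Q g"
  proof -
    define u where "u = e0 /\<^sub>R norm e0"
    have u: "u \<in> E" "norm u = 1" using e0 E(1) by (auto simp: u_def subspace_mul)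
    obtain g where g: "g \<in> G" "g 0 \<noteq> 0" "\<And>x. norm (lin g x - x) \<le> e * norm x"
      "norm (g 0 - norm (g 0) *\<^sub>R u) \<le> 1/2 * norm (g 0)"
      using almost_translation[OF u(2) e(1), of "1/2"] by auto
    obtain y z where yz: "y \<in> E" "\<forall>w\<in>E. orthogonal z w" "g 0 = y + z" using dec by blast
    have "y - norm (g 0) *\<^sub>R u \<in> E" using yz(1) u(1) E(1) by (simp add: subspace_diff subspace_mul)
    moreover have "g 0 - norm (g 0) *\<^sub>R u = (y - norm (g 0) *\<^sub>R u) + z" by (subst yz(3)) simp
    \<comment> \<open>Since \<open>u\<close> lies in \<open>E\<close>, \<open>z\<close> is also the
      orthogonal component of \<open>g 0 - norm (g 0) *\<^sub>R u\<close>, so it is at most half as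
      long as \<open>g 0\<close>.\<close>
    ultimately have "norm z \<le> 1/2 * norm (g 0)" using small(2) yz(2) g(4) by (metis order_trans)
    moreover have "(norm (g 0))\<^sup>2 = (norm y)\<^sup>2 + (norm z)\<^sup>2" using pyth yz by simp
    moreover have "norm (g 0) > 0" using g(2) by simp
    ultimately have "norm z < norm y"
    proof -
      assume z: "norm z \<le> 1/2 * norm (g 0)" and p: "(norm (g 0))\<^sup>2 = (norm y)\<^sup>2 + (norm z)\<^sup>2"
        and pos: "norm (g 0) > 0"
      have "(norm z)\<^sup>2 \<le> (1/2 * norm (g 0))\<^sup>2" using z by (intro power_mono) auto
      also have "\<dots> = (norm (g 0))\<^sup>2 / 4" by (simp add: power_mult_distrib power2_eq_square)
      finally have "2 * (norm z)\<^sup>2 < (norm (g 0))\<^sup>2"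
        using pos zero_less_power[OF pos, of 2] by linarith
      then have "(norm z)\<^sup>2 < (norm y)\<^sup>2" using p by linarith
      then show "norm z < norm y" by (rule power_less_imp_less_base) simp
    qed
    then show ?thesis using g yz by (intro bexI[of _ g]) (auto simp: Q_def)
  qed
  then obtain g where g: "g \<in> G" "Q g" "\<And>k. k \<in> G \<Longrightarrow> Q k \<Longrightarrow> norm (g 0) \<le> norm (k 0)"
    using ex_minimal[of _ Q] by blast
  define B where "B = lin g"
  have lB: "linear B" using g(1) lin_linear by (simp add: B_def)
  have mB: "norm (B x - x) \<le> e * norm x" for x using g(2) by (simp add: Q_def B_def)
  obtain y z where yz: "y \<in> E" "\<forall>w\<in>E. orthogonal z w" "g 0 = y + z" "norm z < norm y"
    using g(2) by (auto simp: Q_def)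
  define h where "h = f \<circ> g \<circ> inv_into UNIV f \<circ> inv_into UNIV g"
  define C where "C = lin h"
  have h: "h \<in> G" unfolding h_def using f(1) g(1) by (intro comp_mem inv_mem)
  have C: "C (B (A x)) = A (B x)" for x
    by (simp add: C_def h_def A_def B_def lin_comp_apply comp_mem inv_mem f(1) g(1))
  have surj: "\<exists>y. x = B (A y) \<and> norm x = norm y" for x
    using f(1) g(1) by (intro exI[of _ "lin (inv_into UNIV f) (lin (inv_into UNIV g) x)"])
      (simp add: A_def B_def lin_norm inv_mem)
  have mC: "norm (C x - x) \<le> e * norm x" for x
  proof -
    obtain v where v: "x = B (A v)" "norm x = norm v" using surj by blast
    \<comment> \<open>This is \<open>(A - id) (B - id) v - (B - id) (A - id) v\<close>; each product
      has one factor of size at most \<open>m\<close> and one of size at most \<open>e\<close>, and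
      \<open>2 * m \<le> 1\<close>.\<close>
    have "C x - x = (A (B v - v) - (B v - v)) - (B (A v - v) - (A v - v))"
      by (simp add: v(1) C linear_diff[OF lA] linear_diff[OF lB])
    also have "norm \<dots> \<le> m * norm (B v - v) + e * norm (A v - v)"
      using mA[of "B v - v"] mB[of "A v - v"] norm_triangle_ineq4 by (smt (verit))
    also have "\<dots> \<le> m * (e * norm v) + e * (m * norm v)"
      using mA[of v] mB[of v] m e by (intro add_mono mult_left_mono) auto
    also have "\<dots> = (2 * m) * (e * norm v)" by simp
    also have "\<dots> \<le> 1 * (e * norm v)" using m_half e by (intro mult_right_mono) auto
    finally show ?thesis by (simp add: v(2))
  qed
  have gf: "h (g (f 0)) = f (g 0)" using f(1) g(1) by (simp add: h_def)
  define r where "r = (g 0 - C (g 0)) + (f 0 - C (B (f 0)))"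
  have "f (g 0) = A (g 0) + f 0" "g (f 0) = B (f 0) + g 0" "h (g (f 0)) = C (g (f 0)) + h 0"
    by (simp_all add: A_def B_def C_def lin_def)
  moreover have "C (B (f 0) + g 0) = C (B (f 0)) + C (g 0)"
    using lin_linear[OF h] by (simp add: C_def linear_add)
  \<comment> \<open>The main term is \<open>A - id\<close> applied to the translation part of
    \<open>g\<close>: it scales the component in \<open>E\<close> by exactly \<open>m\<close> and
    the other component by at most \<open>m'\<close>, so the component in \<open>E\<close> stays
    dominant.\<close>
  ultimately have h0: "h 0 = (A (g 0) - g 0) + r" using gf by (simp add: r_def algebra_simps)
  \<comment> \<open>If \<open>g\<close> rotates at all, it satisfies \<open>P\<close>, and
    minimality of \<open>f\<close> bounds \<open>f 0\<close> by \<open>g 0\<close>; if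
    \<open>g\<close> is a translation, \<open>C\<close> is the identity and \<open>r\<close>
    vanishes.\<close>
  have r: "norm r \<le> 2 * e * norm (g 0)"
  proof (cases "B = id")
    case True
    have "C x = x" for x
    proof -
      obtain v where "x = B (A v)" using surj by blast
      then show ?thesis using C[of v] True by simp
    qed
    then have "r = 0" using True by (simp add: r_def)
    then show ?thesis using e by simp
  next
    case False
    have "norm (B x - x) \<le> 1/2 * norm x" for x
      using mB[of x] mult_right_mono[OF e(2), of "norm x"] by simp
    then have "P g" using False by (simp add: P_def B_def)
    then have fg: "norm (f 0) \<le> norm (g 0)" using f(3) g(1) by simp
    obtain v where v: "f 0 = A v" "norm (f 0) = norm v"
      using f(1) by (metis A_def lin_inv(1) lin_norm)
    have "f 0 - C (B (f 0)) = A (v - B v)" unfolding v C by (simp add: linear_diff[OF lA])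
    then have "norm (f 0 - C (B (f 0))) = norm (B v - v)"
      by (simp add: orthogonal_transformation_norm[OF oA] norm_minus_commute)
    also have "\<dots> \<le> e * norm (g 0)" using mB[of v] mult_left_mono[OF fg less_imp_le[OF e(1)]] unfolding v(2) by (rule order_trans)
    finally have "norm (f 0 - C (B (f 0))) \<le> e * norm (g 0)" .
    moreover have "norm (g 0 - C (g 0)) \<le> e * norm (g 0)" using mC by (simp add: norm_minus_commute)
    ultimately show ?thesis
      unfolding r_def using norm_triangle_ineq[of "g 0 - C (g 0)" "f 0 - C (B (f 0))"] by linarith
  qed
  obtain r1 r2 where r12: "r1 \<in> E" "\<forall>w\<in>E. orthogonal r2 w" "r = r1 + r2" using dec by blast
  have rs: "norm r1 \<le> norm r" "norm r2 \<le> norm r" using small[OF r12(1,2)] r12(3) by auto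
  define y' where "y' = (A y - y) + r1"
  define z' where "z' = (A z - z) + r2"
  have y': "y' \<in> E" using E yz(1) r12(1) by (simp add: y'_def subspace_add subspace_diff)
  have z': "\<forall>w\<in>E. orthogonal z' w"
    using F(2) yz(2) r12(2)
    by (auto simp: z'_def orthogonal_def inner_simps)
  have hyz: "h 0 = y' + z'"
    unfolding h0 yz(3) y'_def z'_def r12(3) by (simp add: linear_add[OF lA])
  have gn: "norm (g 0) < 2 * norm y" using yz(4) norm_triangle_ineq[of y z] unfolding yz(3) by linarith
  have "m * norm y \<le> norm y' + norm r"
    using E(3)[OF yz(1)] rs(1) norm_triangle_ineq4[of y' r1] unfolding y'_def by simp
  moreover have "norm z' \<le> m' * norm z + norm r"
    using F(1) yz(2) rs(2) norm_triangle_ineq[of "A z - z" r2] unfolding z'_def by fastforce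
  moreover have "m' * norm z \<le> m' * norm y" using yz(4) m by (intro mult_left_mono) auto
  moreover have "2 * norm r < (m - m') * norm y"
  proof -
    have "2 * norm r \<le> 4 * e * norm (g 0)" using r by simp
    also have "\<dots> < 4 * e * (2 * norm y)" using gn e by (intro mult_strict_left_mono) auto
    also have "4 * e * (2 * norm y) = (m - m') * norm y" by (simp add: e_def)
    finally show ?thesis .
  qed
  ultimately have yz': "norm z' < norm y'" by (simp add: algebra_simps)
  have "h 0 \<noteq> 0"
  proof
    assume "h 0 = 0"
    then have "norm y' \<le> 0" using small(1)[OF y' z'] hyz by simp
    then show False using yz' by simp
  qed
  then have "Q h" using mC y' z' hyz yz' by (auto simp: Q_def C_def)
  then have "norm (g 0) \<le> norm (h 0)" using g(3) h by simp
  moreover have "norm (h 0) \<le> m * norm (g 0) + 2 * e * norm (g 0)"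
    unfolding h0 using mA[of "g 0"] r norm_triangle_ineq[of "A (g 0) - g 0" r] by linarith
  \<comment> \<open>From \<open>8 * e \<le> m\<close> and \<open>m \<le> 1/2\<close> the factor
    \<open>m + 2 * e\<close> is at most 5/8, so \<open>h\<close> satisfies \<open>Q\<close> with a
    shorter translation part than \<open>g\<close>.\<close>
  moreover have "m * norm (g 0) + 2 * e * norm (g 0) < norm (g 0)"
  proof -
    have "8 * e = m - m'" by (simp add: e_def)
    then have "m + 2 * e < 1" using m m_half by linarith
    moreover have "norm (g 0) > 0" using g(2) by (simp add: Q_def)
    ultimately have "(m + 2 * e) * norm (g 0) < 1 * norm (g 0)" by (intro mult_strict_right_mono)
    then show ?thesis by (simp add: algebra_simps)
  qed
  ultimately show False by linarith
qed

text \<open>If \<open>lin f\<close> and \<open>lin g\<close> have equal colors at tolerance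
  \<open>1/2\<close>, then \<open>f\<close> composed with the inverse of \<open>g\<close> rotates so
  little that it is a translation. Hence the finitely many colors separate the linear parts.\<close>

theorem finite_point_group: "finite (lin ` G)"
proof -
  obtain c :: "('a \<Rightarrow> 'a) \<Rightarrow> 'a \<Rightarrow> 'a" where c: "finite (c ` {f. orthogonal_transformation f})"
    "\<And>f g x. orthogonal_transformation f \<Longrightarrow> orthogonal_transformation g \<Longrightarrow> c f = c g \<Longrightarrow>
      norm (f x - g x) \<le> 1/2 * norm x"
    by (rule orthogonal_coloring[of "1/2"], simp) (erule that, blast)
  have "inj_on c (lin ` G)"
  proof (rule inj_onI, clarify)
    fix f g assume f: "f \<in> G" and g: "g \<in> G" and eq: "c (lin f) = c (lin g)"
    define k where "k = f \<circ> inv_into UNIV g"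
    have k: "k \<in> G" unfolding k_def using f g by (intro comp_mem inv_mem)
    have "lin k = id"
    proof (rule small_rotation_trivial[OF k])
      fix x
      let ?y = "lin (inv_into UNIV g) x"
      have "norm (lin f ?y - lin g ?y) \<le> 1/2 * norm ?y"
        using eq f g orth by (intro c(2)) auto
      then show "norm (lin k x - x) \<le> 1/2 * norm x"
        using f g by (simp add: k_def lin_comp_apply lin_norm inv_mem)
    qed
    then have "lin k (lin g x) = lin g x" for x by simp
    then show "lin f = lin g" using f g by (simp add: k_def lin_comp_apply fun_eq_iff)
  qed
  moreover have "finite (c ` lin ` G)"
    by (rule finite_subset[OF _ c(1)]) (use orth in auto)
  ultimately show ?thesis by (rule finite_imageD[rotated])
qed

end

section \<open>The lattice of translations\<close>

context crystal begin

definition lattice :: "'a set" where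
  "lattice = {t. (\<lambda>x. x + t) \<in> G}"

lemma translation_lattice: "t \<in> lattice \<Longrightarrow> (\<lambda>x. x + t) \<in> G"
  by (simp add: lattice_def)

lemma lin_translation [simp]: "lin (\<lambda>x. x + t) = id" for t :: 'a
  by (simp add: lin_def fun_eq_iff)

lemma lin_eq_id:
  assumes "g \<in> G" "lin g = id"
  shows "g = (\<lambda>x. x + g 0)" "g 0 \<in> lattice"
proof -
  show g: "g = (\<lambda>x. x + g 0)" using assms(2) decomp[of g] by (metis id_apply)
  then show "g 0 \<in> lattice" using assms(1) unfolding lattice_def by simp
qed

lemma lattice_add: "s \<in> lattice \<Longrightarrow> t \<in> lattice \<Longrightarrow> s + t \<in> lattice"
  using comp_mem[of "\<lambda>x. x + t" "\<lambda>x. x + s"] by (simp add: lattice_def comp_def add.assoc)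

lemma lattice_minus:
  assumes "t \<in> lattice"
  shows "- t \<in> lattice"
proof -
  have "inv_into UNIV (\<lambda>x. x + t) = (\<lambda>x. x + - t)"
    by (rule inv_equality) auto
  then show ?thesis using inv_mem[of "\<lambda>x. x + t"] assms by (simp add: lattice_def)
qed

lemma lattice_0: "0 \<in> lattice"
  using id_mem by (simp add: lattice_def id_def)

lemma lattice_scale_nat: "t \<in> lattice \<Longrightarrow> real k *\<^sub>R t \<in> lattice"
  by (induction k) (auto simp: lattice_0 algebra_simps intro: lattice_add)

text \<open>Conjugating the translation by \<open>t\<close> with \<open>g\<close> gives the
  translation by \<open>lin g t\<close>.\<close>

lemma lattice_lin:
  assumes g: "g \<in> G" and t: "t \<in> lattice"
  shows "lin g t \<in> lattice"
proof -
  have "g \<circ> (\<lambda>x. x + t) \<circ> inv_into UNIV g = (\<lambda>x. x + lin g t)"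
  proof
    fix x
    have "g (inv_into UNIV g x + t) = lin g (inv_into UNIV g x) + lin g t + g 0"
      using lin_linear[OF g] decomp[of g "inv_into UNIV g x + t"] by (simp add: linear_add)
    also have "\<dots> = x + lin g t" using decomp[of g "inv_into UNIV g x"] g by simp
    finally show "(g \<circ> (\<lambda>x. x + t) \<circ> inv_into UNIV g) x = x + lin g t" by simp
  qed
  then show ?thesis
    using comp_mem[OF comp_mem[OF g translation_lattice[OF t]] inv_mem[OF g]] by (simp add: lattice_def)
qed

lemma lattice_finite: "finite {t \<in> lattice. norm t \<le> R}"
proof -
  have "{t \<in> lattice. norm t \<le> R} \<subseteq> (\<lambda>g. g 0) ` {g \<in> G. norm (g 0) \<le> R}"
  proof
    fix t assume "t \<in> {t \<in> lattice. norm t \<le> R}"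
    then show "t \<in> (\<lambda>g. g 0) ` {g \<in> G. norm (g 0) \<le> R}"
      by (intro image_eqI[of _ _ "\<lambda>x. x + t"]) (auto simp: lattice_def)
  qed
  then show ?thesis by (rule finite_subset) (simp add: fin)
qed

text \<open>The translations have finite index: with one representative fixed for each of the
  finitely many linear parts, every element is a translation after a representative, and
  \<open>R'\<close> bounds how far the representatives move the origin.\<close>

lemma lattice_cocompact: "\<exists>R. \<forall>x. \<exists>t\<in>lattice. norm (x - t) \<le> R"
proof -
  obtain R where R: "\<And>x. \<exists>g\<in>G. norm (g x) \<le> R" using cocompact by blast
  define rep where "rep P = (SOME g. g \<in> G \<and> lin g = P)" for P :: "'a \<Rightarrow> 'a"
  have rep: "rep (lin g) \<in> G" "lin (rep (lin g)) = lin g" if "g \<in> G" for g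
    using someI[of "\<lambda>h. h \<in> G \<and> lin h = lin g" g] that by (simp_all add: rep_def)
  define R' where "R' = Max ((\<lambda>P. norm (rep P 0)) ` lin ` G)"
  have R': "norm (rep (lin g) 0) \<le> R'" if "g \<in> G" for g
    unfolding R'_def using that finite_point_group by (intro Max_ge) auto
  have "\<exists>t\<in>lattice. norm (x - t) \<le> R + R'" for x
  proof -
    obtain g where g: "g \<in> G" "norm (g x) \<le> R" using R by blast
    let ?h = "inv_into UNIV g"
    have h: "?h \<in> G" using g(1) by (rule inv_mem)
    have hx: "norm (?h 0 - x) \<le> R" using dist_eq[OF g(1), of "?h 0" x] g by (simp add: dist_norm)
    let ?r = "rep (lin ?h)"
    let ?k = "?h \<circ> inv_into UNIV ?r"
    have k: "?k \<in> G" by (rule comp_mem[OF h inv_mem[OF rep(1)[OF h]]])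
    have "lin ?k y = y" for y
    proof -
      have "lin ?k y = lin ?h (lin (inv_into UNIV ?r) y)" using h by (rule lin_comp_apply)
      also have "\<dots> = lin ?r (lin (inv_into UNIV ?r) y)" by (simp only: rep(2)[OF h])
      also have "\<dots> = y" using rep(1)[OF h] by (rule lin_inv(1))
      finally show ?thesis .
    qed
    then have "lin ?k = id" by (simp add: fun_eq_iff)
    then have "?k 0 \<in> lattice" using k lin_eq_id by blast
    moreover have "norm (?h 0 - ?k 0) \<le> R'"
      using dist_eq[OF h, of 0 "inv_into UNIV ?r 0"] norm_inv_0[OF rep(1)[OF h]] R'[OF h]
      by (simp add: dist_norm)
    ultimately show ?thesis
      using norm_triangle_ineq[of "x - ?h 0" "?h 0 - ?k 0"] hx
      by (intro bexI[of _ "?k 0"]) (auto simp: norm_minus_commute)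
  qed
  then show ?thesis by blast
qed

lemma span_lattice: "span lattice = UNIV"
proof (rule ccontr)
  assume "span lattice \<noteq> UNIV"
  then obtain a where a: "a \<noteq> 0" "span lattice \<subseteq> {x. a \<bullet> x = 0}"
    using span_not_univ_subset_hyperplane by blast
  obtain R where R: "\<And>x. \<exists>t\<in>lattice. norm (x - t) \<le> R" using lattice_cocompact by blast
  \<comment> \<open>This point lies at distance \<open>R + 1\<close> from the hyperplane orthogonal
    to \<open>a\<close>, which contains the lattice.\<close>
  let ?x = "((R + 1) / norm a) *\<^sub>R a"
  obtain t where t: "t \<in> lattice" "norm (?x - t) \<le> R" using R by blast
  have "a \<bullet> t = 0" using a(2) t(1) span_base by blast
  then have "a \<bullet> (?x - t) = (R + 1) * norm a"
    using a(1) by (simp add: inner_diff_right power2_norm_eq_inner[symmetric] power2_eq_square)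
  moreover have "a \<bullet> (?x - t) \<le> norm a * R"
    using norm_cauchy_schwarz[of a "?x - t"] t(2) mult_left_mono[OF t(2) norm_ge_zero[of a]] by linarith
  ultimately show False using a(1) by (simp add: algebra_simps)
qed

lemma funpow_mem: "g \<in> G \<Longrightarrow> g ^^ k \<in> G"
  by (induction k) (auto intro: comp_mem simp: id_mem)

text \<open>Two powers share a linear part because the point group is finite; cancelling the smaller
  power leaves a translation.\<close>

lemma power_translation:
  assumes g: "g \<in> G"
  obtains k where "k > 0" "lin (g ^^ k) = id"
proof -
  have "finite (range (\<lambda>k. lin (g ^^ k)))"
    by (rule finite_subset[OF _ finite_point_group]) (use funpow_mem[OF g] in auto)
  then have "\<not> inj (\<lambda>k. lin (g ^^ k))"
    using finite_imageD infinite_UNIV_nat by blast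
  then obtain i j where ij: "i < j" "lin (g ^^ i) = lin (g ^^ j)"
    unfolding inj_def by (metis nat_neq_iff)
  have "g ^^ j = g ^^ i \<circ> g ^^ (j - i)" using ij(1) by (simp flip: funpow_add)
  then have eq: "lin (g ^^ i) x = lin (g ^^ i) (lin (g ^^ (j - i)) x)" for x
    using ij(2) lin_comp_apply[OF funpow_mem[OF g], of i "g ^^ (j - i)" x] by simp
  have inj: "inj (lin (g ^^ i))"
    using orth[OF funpow_mem[OF g]] by (rule orthogonal_transformation_inj)
  have "lin (g ^^ (j - i)) x = x" for x
    by (rule sym, rule injD[OF inj], rule eq)
  then have "lin (g ^^ (j - i)) = id" by (simp add: fun_eq_iff)
  then show thesis using ij(1) that[of "j - i"] by simp
qed

end

section \<open>Space groups in metric terms\<close>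

lemma orbit_isometries:
  fixes G :: "('a::metric_space \<Rightarrow> 'a) set"
  shows "orbit (grp G) (\<lambda>g. g) x = (\<lambda>g. g x) ` G"
  by (auto simp: orbit_def)

lemma continuous_isometry:
  assumes "f \<in> carrier isometry_group"
  shows "continuous_on S f"
  using assms by (auto simp: mem_isometry_group continuous_on_iff)

text \<open>A basic neighbourhood of \<open>id\<close> for pointwise convergence constrains finitely
  many points, so an element moving each of them by less than some \<open>e\<close> is the identity;
  the coloring then yields finiteness. Compactness of the orbit space is applied to the cover by the
  sets of orbits meeting a ball of radius \<open>n\<close>. Conversely, finiteness isolates each
  element by finitely many open conditions, and the orbit space is the image of a closed
  ball.\<close>

theorem space_group_iff_crystal:
  fixes G :: "(real^'k \<Rightarrow> real^'k) set"
  shows "space_group G \<longleftrightarrow> crystal G"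
proof
  assume "space_group G"
  then have sub: "subgroup G isometry_group" and disc: "discrete G" and cpt: "compact_space (orbit_space G)"
    by (auto simp: space_group_def)
  interpret I: isometry_subgroup G using sub by (rule isometry_subgroup.intro)
  show "crystal G"
  proof (intro crystal.intro isometry_subgroup.intro crystal_axioms.intro)
    show "subgroup G isometry_group" by fact
    obtain T where T: "open T" "T \<inter> G = {id}"
      using discreteD[OF disc I.id_mem] by (auto simp: isolated_in_def)
    have "id \<in> T" using T(2) by blast
    then have "\<exists>X. id \<in> (\<Pi>\<^sub>E i\<in>UNIV. X i) \<and> (\<forall>i. open (X i)) \<and> finite {i. X i \<noteq> UNIV} \<and>
        (\<Pi>\<^sub>E i\<in>UNIV. X i) \<subseteq> T"
      using product_topology_open_contains_basis[OF T(1)[unfolded open_fun_def]] by simp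
    then obtain X where X: "id \<in> (\<Pi>\<^sub>E i\<in>UNIV. X i)" "\<And>i. open (X i)" "finite {i. X i \<noteq> UNIV}"
      "(\<Pi>\<^sub>E i\<in>UNIV. X i) \<subseteq> T"
      by (elim exE conjE) (rule that, assumption, blast, assumption+)
    let ?I = "{i. X i \<noteq> UNIV}"
    have "\<exists>e>0. ball i e \<subseteq> X i" for i
    proof -
      have "id i \<in> X i" using X(1) by (rule PiE_mem) simp
      then show ?thesis using X(2)[of i] by (simp add: open_contains_ball)
    qed
    then obtain d where d: "\<And>i. d i > 0" "\<And>i. ball i (d i) \<subseteq> X i" by metis
    \<comment> \<open>The inserted 1 covers the case that no coordinate is constrained.\<close>
    define e where "e = Min (insert 1 (d ` ?I))"
    have fin_d: "finite (insert 1 (d ` ?I))" using X(3) by simp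
    have "e \<in> insert 1 (d ` ?I)" unfolding e_def by (rule Min_in[OF fin_d]) simp
    then have e: "e > 0" using d(1) by auto
    have e_le: "e \<le> d i" if "i \<in> ?I" for i
      unfolding e_def by (rule Min_le[OF fin_d]) (rule insertI2, rule imageI, rule that)
    have near: "g = id" if g: "g \<in> G" and "\<And>i. i \<in> ?I \<Longrightarrow> dist (g i) i < e" for g
    proof -
      have "g i \<in> X i" for i
      proof (cases "i \<in> ?I")
        case True
        then have "dist i (g i) < d i" using that(2)[of i] e_le[OF True] by (simp add: dist_commute)
        then show ?thesis using d(2)[of i] by auto
      qed auto
      then have "g \<in> T" using X(4) by auto
      then show ?thesis using T(2) g by blast
    qed
    fix R
    define R' where "R' = R + Max (insert 0 (norm ` ?I))"
    have R': "norm (g i) \<le> R'" if "g \<in> G" "norm (g 0) \<le> R" "i \<in> ?I" for g i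
    proof -
      have "norm i \<le> Max (insert 0 (norm ` ?I))" using X(3) that(3) by (intro Max_ge) auto
      moreover have "norm (g i - g 0) = norm i" using I.dist_eq[OF that(1), of i 0] by (simp add: dist_norm)
      ultimately show ?thesis
        using that(2) norm_triangle_ineq[of "g i - g 0" "g 0"] by (simp add: R'_def)
    qed
    obtain c :: "(real^'k \<Rightarrow> real^'k) \<Rightarrow> real^'k \<Rightarrow> real^'k"
      where c: "finite (c ` {f. \<forall>x\<in>?I. norm (f x) \<le> R'})"
        "\<And>f g x. \<forall>x\<in>?I. norm (f x) \<le> R' \<Longrightarrow> \<forall>x\<in>?I. norm (g x) \<le> R' \<Longrightarrow> c f = c g \<Longrightarrow> x \<in> ?I \<Longrightarrow>
          dist (f x) (g x) < e"
      using e by (rule finite_coloring[OF X(3)]) (erule that, blast)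
    show "finite {g \<in> G. norm (g 0) \<le> R}"
    proof (rule finite_imageD)
      show "finite (c ` {g \<in> G. norm (g 0) \<le> R})"
        by (rule finite_subset[OF _ c(1)]) (use R' in auto)
      show "inj_on c {g \<in> G. norm (g 0) \<le> R}"
      proof (rule inj_onI)
        fix f g assume f: "f \<in> {g \<in> G. norm (g 0) \<le> R}" and g: "g \<in> {g \<in> G. norm (g 0) \<le> R}"
          and eq: "c f = c g"
        have fG: "f \<in> G" and gG: "g \<in> G" using f g by auto
        have lt: "dist (f x) (g x) < e" if "x \<in> ?I" for x
          using R' f g that eq by (intro c(2)) auto
        have "inv_into UNIV f \<circ> g = id"
        proof (rule near)
          show "inv_into UNIV f \<circ> g \<in> G" using fG gG by (intro I.comp_mem I.inv_mem)
          fix x assume "x \<in> ?I"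
          then have "dist (inv_into UNIV f (f x)) (inv_into UNIV f (g x)) < e"
            using lt[of x] I.dist_eq[OF I.inv_mem[OF fG]] by simp
          then show "dist ((inv_into UNIV f \<circ> g) x) x < e"
            using I.inv_apply(2)[OF fG] by (simp add: dist_commute)
        qed
        then show "f = g" using I.inv_apply(1)[OF fG] by (metis comp_apply ext id_apply)
      qed
    qed
  next
    let ?O = "orbit (grp G) (\<lambda>g. g)"
    have S: "orbits (grp G) UNIV (\<lambda>g. g) = range ?O" by (auto simp: orbits_def)
    have q: "quotient_map euclidean (orbit_space G) ?O" by (rule quotient_map_orbit_space[OF sub])
    then have top: "topspace (orbit_space G) = range ?O" by (simp add: quotient_map_def)
    define U where "U n = {A \<in> range ?O. \<exists>y\<in>A. norm y < real n}" for n :: nat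
    have "openin (orbit_space G) (U n)" for n
    proof -
      have "{x. ?O x \<in> U n} = (\<Union>g\<in>G. g -` ball 0 (real n))"
        by (auto simp: U_def orbit_isometries)
      moreover have "open (g -` ball 0 (real n))" if "g \<in> G" for g
        using continuous_isometry[OF I.mem_carrier[OF that]] by (intro open_vimage) auto
      ultimately have "open {x. ?O x \<in> U n}" by auto
      moreover have "U n \<subseteq> topspace (orbit_space G)" by (auto simp: U_def top)
      ultimately show ?thesis using q unfolding quotient_map_def by simp
    qed
    moreover have "topspace (orbit_space G) \<subseteq> \<Union>(range U)"
    proof
      fix A assume A: "A \<in> topspace (orbit_space G)"
      then obtain x where x: "A = ?O x" by (auto simp: top)
      have "x \<in> A" unfolding x orbit_isometries using I.id_mem by (intro image_eqI[of _ _ id]) auto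
      moreover obtain n :: nat where "norm x < real n" using reals_Archimedean2 by blast
      ultimately have "A \<in> U n" using A by (auto simp: U_def top)
      then show "A \<in> \<Union>(range U)" by blast
    qed
    ultimately obtain \<F> where F: "finite \<F>" "\<F> \<subseteq> range U" "topspace (orbit_space G) \<subseteq> \<Union>\<F>"
      using cpt[unfolded compact_space_alt, rule_format, of "range U"] by blast
    obtain N where N: "finite N" "\<F> = U ` N" using F(1,2) by (meson finite_subset_image)
    define R where "R = real (Max (insert 0 N))"
    have "\<exists>g\<in>G. norm (g x) \<le> R" for x
    proof -
      have "?O x \<in> \<Union>\<F>" using F(3) by (auto simp: top)
      then obtain n where n: "n \<in> N" "?O x \<in> U n" unfolding N(2) by blast
      then obtain g where g: "g \<in> G" "norm (g x) < real n" by (auto simp: U_def orbit_isometries)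
      have "real n \<le> R" using n(1) N(1) by (simp add: R_def)
      then show ?thesis using g by force
    qed
    then show "\<exists>R. \<forall>x. \<exists>g\<in>G. norm (g x) \<le> R" by blast
  qed
next
  assume "crystal G"
  then interpret crystal G .
  have "discrete G"
  proof (rule discreteI)
    fix f assume f: "f \<in> G"
    let ?F = "{g \<in> G. norm (g 0) \<le> norm (f 0) + 1} - {f}"
    have ev: "continuous_on UNIV (\<lambda>g :: real^'k \<Rightarrow> real^'k. g x)" for x
      by (rule continuous_on_product_coordinates)
    define p where "p h = (SOME x. h x \<noteq> f x)" for h
    have p: "h (p h) \<noteq> f (p h)" if "h \<in> ?F" for h
    proof -
      have "\<exists>x. h x \<noteq> f x" using that by (auto simp: fun_eq_iff)
      then show ?thesis unfolding p_def by (rule someI_ex)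
    qed
    \<comment> \<open>The first condition confines the elements of \<open>G\<close> in
      \<open>?T\<close> to \<open>f\<close> and the finite set \<open>?F\<close>; each
      \<open>h\<close> in \<open>?F\<close> is then excluded at the point \<open>p h\<close>, where
      it differs from \<open>f\<close>.\<close>
    let ?T = "(\<lambda>g. g 0) -` ball (f 0) 1 \<inter> (\<Inter>h\<in>?F. (\<lambda>g. g (p h)) -` (- {h (p h)}))"
    have "open ((\<lambda>g :: real^'k \<Rightarrow> real^'k. g 0) -` ball (f 0) 1)" using ev by (intro open_vimage) auto
    moreover have "open (\<Inter>h\<in>?F. (\<lambda>g :: real^'k \<Rightarrow> real^'k. g (p h)) -` (- {h (p h)}))"
    proof (rule open_INT)
      show "finite ?F" using fin by simp
      show "\<forall>h\<in>?F. open ((\<lambda>g :: real^'k \<Rightarrow> real^'k. g (p h)) -` (- {h (p h)}))"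
        using ev by (intro ballI open_vimage) auto
    qed
    ultimately have "open ?T" by (rule open_Int)
    moreover have "?T \<inter> G = {f}"
    proof
      show "?T \<inter> G \<subseteq> {f}"
      proof
        fix g assume g: "g \<in> ?T \<inter> G"
        then have "norm (g 0) \<le> norm (f 0) + 1"
          using norm_triangle_ineq2[of "g 0" "f 0"] by (simp add: dist_norm norm_minus_commute)
        moreover have "g \<notin> ?F"
        proof
          assume F: "g \<in> ?F"
          have "g \<in> (\<Inter>h\<in>?F. (\<lambda>g. g (p h)) -` (- {h (p h)}))" using g by blast
          from INT_D[OF this F] show False by simp
        qed
        ultimately show "g \<in> {f}" using g by blast
      qed
      have "f \<in> (\<lambda>g. g (p h)) -` (- {h (p h)})" if "h \<in> ?F" for h
        using p[OF that] by (simp add: eq_commute)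
      then have "f \<in> ?T" by simp
      then show "{f} \<subseteq> ?T \<inter> G" using f by blast
    qed
    ultimately show "f isolated_in G" using f by (auto simp: isolated_in_def)
  qed
  moreover have "compact_space (orbit_space G)"
  proof -
    let ?O = "orbit (grp G) (\<lambda>g. g)"
    have q: "quotient_map euclidean (orbit_space G) ?O" by (rule quotient_map_orbit_space[OF sub])
    then have top: "topspace (orbit_space G) = range ?O" by (simp add: quotient_map_def)
    obtain R where R: "\<And>x. \<exists>g\<in>G. norm (g x) \<le> R" using cocompact by blast
    have "compactin (orbit_space G) (?O ` cball 0 R)"
      using quotient_imp_continuous_map[OF q] by (intro image_compactin[of euclidean]) (auto simp: compactin_euclidean_iff)
    moreover have "?O ` cball 0 R = range ?O"
    proof
      show "range ?O \<subseteq> ?O ` cball 0 R"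
      proof
        fix A assume "A \<in> range ?O"
        then obtain x where x: "A = ?O x" by blast
        obtain g where g: "g \<in> G" "norm (g x) \<le> R" using R by blast
        have "?O x = ?O (g x)"
        proof
          show "?O x \<subseteq> ?O (g x)"
          proof
            fix y assume "y \<in> ?O x"
            then obtain h where h: "h \<in> G" "y = h x" by (auto simp: orbit_isometries)
            then show "y \<in> ?O (g x)" unfolding orbit_isometries
              using g(1) comp_mem inv_mem by (intro image_eqI[of _ _ "h \<circ> inv_into UNIV g"]) auto
          qed
          show "?O (g x) \<subseteq> ?O x"
          proof
            fix y assume "y \<in> ?O (g x)"
            then obtain h where h: "h \<in> G" "y = h (g x)" by (auto simp: orbit_isometries)
            then show "y \<in> ?O x" unfolding orbit_isometries
              using g(1) comp_mem by (intro image_eqI[of _ _ "h \<circ> g"]) auto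
          qed
        qed
        then show "A \<in> ?O ` cball 0 R" using x g(2) by auto
      qed
    qed auto
    ultimately show ?thesis by (simp add: compact_space_def top)
  qed
  ultimately show "space_group G" using sub by (simp add: space_group_def)
qed

section \<open>Automorphisms as affine maps\<close>

text \<open>Values on a maximal independent subset \<open>B\<close> of \<open>L\<close> determine a
  linear \<open>A\<close>. For \<open>t\<close> in \<open>L\<close>, the multiples
  \<open>real j *\<^sub>R t\<close> reduced by integer combinations of \<open>B\<close> stay in a
  bounded, hence finite, part of \<open>L\<close>; two reductions coincide, so a nonzero multiple of
  \<open>t\<close> is an integer combination of \<open>B\<close>, where \<open>A\<close> and
  \<open>\<phi>\<close> agree.\<close>

lemma additive_extends_linear:
  fixes L :: "'a::euclidean_space set" and \<phi> :: "'a \<Rightarrow> 'b::real_vector"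
  assumes L0: "0 \<in> L" and Ladd: "\<And>s t. s \<in> L \<Longrightarrow> t \<in> L \<Longrightarrow> s + t \<in> L"
    and Lneg: "\<And>t. t \<in> L \<Longrightarrow> - t \<in> L"
    and fin: "\<And>R. finite {t \<in> L. norm t \<le> R}"
    and add: "\<And>s t. s \<in> L \<Longrightarrow> t \<in> L \<Longrightarrow> \<phi> (s + t) = \<phi> s + \<phi> t"
  shows "\<exists>A. linear A \<and> (\<forall>t\<in>L. A t = \<phi> t)"
proof -
  have \<phi>0: "\<phi> 0 = 0" using add[OF L0 L0] by simp
  have \<phi>neg: "\<phi> (- t) = - \<phi> t" if "t \<in> L" for t
    using add[OF that Lneg[OF that]] \<phi>0 by (simp add: eq_neg_iff_add_eq_0 add.commute)
  have nat: "real k *\<^sub>R t \<in> L \<and> \<phi> (real k *\<^sub>R t) = real k *\<^sub>R \<phi> t" if "t \<in> L" for k t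
    using that by (induction k) (auto simp: L0 \<phi>0 scaleR_left_distrib Ladd add)
  have int: "of_int k *\<^sub>R t \<in> L \<and> \<phi> (of_int k *\<^sub>R t) = of_int k *\<^sub>R \<phi> t" if "t \<in> L" for k t
    using nat[OF that] Lneg \<phi>neg by (cases k rule: int_cases2) auto
  have comb: "(\<Sum>b\<in>B. of_int (c b) *\<^sub>R b) \<in> L \<and>
      \<phi> (\<Sum>b\<in>B. of_int (c b) *\<^sub>R b) = (\<Sum>b\<in>B. of_int (c b) *\<^sub>R \<phi> b)"
    if "finite B" "B \<subseteq> L" for B c
    using that by (induction B rule: finite_induct) (auto simp: L0 \<phi>0 Ladd add int)
  obtain B where B: "B \<subseteq> L" "independent B" "L \<subseteq> span B"
    using maximal_independent_subset by blast
  have finB: "finite B" using B(2) independent_imp_finite by blast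
  obtain A where A: "linear A" "\<And>b. b \<in> B \<Longrightarrow> A b = \<phi> b"
    using linear_independent_extend[OF B(2), of \<phi>] by blast
  have Acomb: "A (\<Sum>b\<in>B. of_int (c b) *\<^sub>R b) = \<phi> (\<Sum>b\<in>B. of_int (c b) *\<^sub>R b)" for c
    using comb[OF finB B(1), of c] A(2) by (simp add: linear_sum[OF A(1)] linear_cmul[OF A(1)])
  have "A t = \<phi> t" if t: "t \<in> L" for t
  proof -
    obtain u where u: "t = (\<Sum>b\<in>B. u b *\<^sub>R b)"
      using t B(3) span_finite[OF finB] by auto
    define n where "n j b = \<lfloor>real j * u b\<rfloor>" for j :: nat and b
    define r where "r j = real j *\<^sub>R t - (\<Sum>b\<in>B. of_int (n j b) *\<^sub>R b)" for j
    have rL: "r j \<in> L" for j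
      using Ladd[of "real j *\<^sub>R t" "- (\<Sum>b\<in>B. of_int (n j b) *\<^sub>R b)"] Lneg nat[OF t]
        comb[OF finB B(1), of "n j"] by (simp add: r_def)
    have "norm (r j) \<le> (\<Sum>b\<in>B. norm b)" for j
    proof -
      have "r j = (\<Sum>b\<in>B. (real j * u b - of_int (n j b)) *\<^sub>R b)"
        by (simp add: r_def u scaleR_sum_right scaleR_left_diff_distrib sum_subtractf)
      also have "norm \<dots> \<le> (\<Sum>b\<in>B. norm ((real j * u b - of_int (n j b)) *\<^sub>R b))" by (rule norm_sum)
      also have "\<dots> \<le> (\<Sum>b\<in>B. norm b)"
      proof (rule sum_mono)
        fix b
        have "real j * u b - of_int (n j b) = frac (real j * u b)" by (simp add: n_def frac_def)
        then show "norm ((real j * u b - of_int (n j b)) *\<^sub>R b) \<le> norm b"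
          using frac_lt_1[of "real j * u b"] by (simp add: mult_left_le_one_le)
      qed
      finally show ?thesis .
    qed
    then have "range r \<subseteq> {s \<in> L. norm s \<le> (\<Sum>b\<in>B. norm b)}" using rL by auto
    then have "finite (range r)" using fin finite_subset by blast
    then have "\<not> inj r" using finite_imageD infinite_UNIV_nat by blast
    then obtain i j where ij: "i < j" "r i = r j" unfolding inj_def by (metis nat_neq_iff)
    define c where "c b = n j b - n i b" for b
    have "real j *\<^sub>R t - real i *\<^sub>R t = (\<Sum>b\<in>B. of_int (c b) *\<^sub>R b)"
      using ij(2) by (simp add: r_def c_def scaleR_left_diff_distrib sum_subtractf algebra_simps)
    then have eq: "real (j - i) *\<^sub>R t = (\<Sum>b\<in>B. of_int (c b) *\<^sub>R b)"
      using ij(1) by (simp add: of_nat_diff scaleR_left_diff_distrib)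
    have "real (j - i) *\<^sub>R A t = A (real (j - i) *\<^sub>R t)" by (simp add: linear_cmul[OF A(1)])
    also have "\<dots> = \<phi> (real (j - i) *\<^sub>R t)" unfolding eq by (rule Acomb)
    also have "\<dots> = real (j - i) *\<^sub>R \<phi> t" using nat[OF t] by blast
    finally show ?thesis using ij(1) by simp
  qed
  then show ?thesis using A(1) by blast
qed

lemma comp_left_cancel: "inj f \<Longrightarrow> f \<circ> g = f \<circ> h \<Longrightarrow> g = h"
  by (simp add: fun_eq_iff inj_eq)

lemma lin_id [simp]: "lin id = id"
  by (simp add: fun_eq_iff lin_def)

lemma funpow_translation: "(\<lambda>x. x + t) ^^ k = (\<lambda>x. x + real k *\<^sub>R t)" for t :: "'a::real_vector"
  by (induction k) (auto simp: fun_eq_iff algebra_simps)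

context crystal begin

lemma comp_translation:
  assumes "g \<in> G"
  shows "g \<circ> (\<lambda>x. x + t) = (\<lambda>x. x + lin g t) \<circ> g"
proof
  fix x
  have "lin g (x + t) = lin g x + lin g t" using lin_linear[OF assms] by (simp add: linear_add)
  then show "(g \<circ> (\<lambda>x. x + t)) x = ((\<lambda>x. x + lin g t) \<circ> g) x" by (simp add: lin_def)
qed

lemma inv_comp:
  assumes "f \<in> G" "g \<in> G"
  shows "inv_into UNIV (f \<circ> g) = inv_into UNIV g \<circ> inv_into UNIV f"
  using bij[OF assms(1)] bij[OF assms(2)] by (simp add: o_inv_distrib)

context
  fixes \<alpha>
  assumes \<alpha>_mem: "\<And>g. g \<in> G \<Longrightarrow> \<alpha> g \<in> G"
    and \<alpha>_comp: "\<And>f g. f \<in> G \<Longrightarrow> g \<in> G \<Longrightarrow> \<alpha> (f \<circ> g) = \<alpha> f \<circ> \<alpha> g"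
begin

text \<open>This avoids proving that an automorphism preserves the translation subgroup: on the
  translations that \<open>\<alpha>\<close> sends to translations it induces an additive map, and
  their vectors still span the space.\<close>

definition common_lattice :: "'a set" where
  "common_lattice = {t \<in> lattice. lin (\<alpha> (\<lambda>x. x + t)) = id}"

lemma common_lattice_translation:
  assumes "t \<in> common_lattice"
  shows "\<alpha> (\<lambda>x. x + t) = (\<lambda>x. x + \<alpha> (\<lambda>x. x + t) 0)"
  using assms lin_eq_id(1)[OF \<alpha>_mem] by (simp add: common_lattice_def translation_lattice)

lemma \<alpha>_id: "\<alpha> id = id"
proof
  fix x
  have "\<alpha> id (\<alpha> id x) = \<alpha> id x" using \<alpha>_comp[OF id_mem id_mem] by (metis comp_apply comp_id)
  then show "\<alpha> id x = id x" using bij[OF \<alpha>_mem[OF id_mem]] by (metis bij_is_inj id_apply injD)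
qed

lemma \<alpha>_funpow: "g \<in> G \<Longrightarrow> \<alpha> (g ^^ k) = \<alpha> g ^^ k"
  by (induction k) (simp_all add: \<alpha>_id \<alpha>_comp funpow_mem)

lemma common_lattice_0: "0 \<in> common_lattice"
  using \<alpha>_id by (simp add: common_lattice_def lattice_0 id_def[symmetric])

lemma common_lattice_add:
  assumes s: "s \<in> common_lattice" and t: "t \<in> common_lattice"
  shows "s + t \<in> common_lattice" "\<alpha> (\<lambda>x. x + (s + t)) 0 = \<alpha> (\<lambda>x. x + s) 0 + \<alpha> (\<lambda>x. x + t) 0"
proof -
  have L: "s \<in> lattice" "t \<in> lattice" using s t by (auto simp: common_lattice_def)
  have "(\<lambda>x. x + (s + t)) = (\<lambda>x. x + t) \<circ> (\<lambda>x. x + s)" by (simp add: fun_eq_iff add.assoc)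
  then have eq: "\<alpha> (\<lambda>x. x + (s + t)) = \<alpha> (\<lambda>x. x + t) \<circ> \<alpha> (\<lambda>x. x + s)"
    using \<alpha>_comp[OF translation_lattice translation_lattice] L by simp
  have "lin (\<alpha> (\<lambda>x. x + t) \<circ> \<alpha> (\<lambda>x. x + s)) = lin (\<alpha> (\<lambda>x. x + t)) \<circ> lin (\<alpha> (\<lambda>x. x + s))"
    by (rule lin_comp[OF mem_carrier[OF \<alpha>_mem[OF translation_lattice[OF L(2)]]]])
  also have "\<dots> = id" using s t by (simp add: common_lattice_def)
  finally show "s + t \<in> common_lattice"
    using lattice_add[OF L] eq by (simp add: common_lattice_def)
  have "\<alpha> (\<lambda>x. x + t) y = y + \<alpha> (\<lambda>x. x + t) 0" for y
    using common_lattice_translation[OF t] by (rule fun_cong)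
  from this[of "\<alpha> (\<lambda>x. x + s) 0"]
  show "\<alpha> (\<lambda>x. x + (s + t)) 0 = \<alpha> (\<lambda>x. x + s) 0 + \<alpha> (\<lambda>x. x + t) 0"
    unfolding eq comp_def .
qed

lemma common_lattice_minus:
  assumes t: "t \<in> common_lattice"
  shows "- t \<in> common_lattice"
proof -
  have L: "t \<in> lattice" "- t \<in> lattice" using t by (auto simp: common_lattice_def lattice_minus)
  let ?f = "\<alpha> (\<lambda>x. x + - t)" and ?g = "\<alpha> (\<lambda>x. x + t)"
  have "(\<lambda>x. x + - t) \<circ> (\<lambda>x. x + t) = id" by (simp add: fun_eq_iff)
  then have "?f \<circ> ?g = id"
    using \<alpha>_comp[OF translation_lattice[OF L(2)] translation_lattice[OF L(1)]] \<alpha>_id by simp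
  moreover have "lin (?f \<circ> ?g) = lin ?f \<circ> lin ?g"
    by (rule lin_comp[OF mem_carrier[OF \<alpha>_mem[OF translation_lattice[OF L(2)]]]])
  moreover have "lin ?g = id" using t by (simp add: common_lattice_def)
  ultimately have "lin ?f = id" by simp
  then show ?thesis using L(2) unfolding common_lattice_def by blast
qed

text \<open>The image under \<open>\<alpha>\<close> of a translation has a power that is a
  translation, so a positive multiple of every lattice vector belongs to
  \<open>common_lattice\<close>.\<close>

lemma span_common_lattice: "span common_lattice = UNIV"
proof -
  have "t \<in> span common_lattice" if t: "t \<in> lattice" for t
  proof -
    let ?g = "\<lambda>x. x + t"
    have g: "?g \<in> G" using t by (rule translation_lattice)
    obtain k where k: "k > 0" "lin (\<alpha> ?g ^^ k) = id" using power_translation[OF \<alpha>_mem[OF g]] .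
    have "\<alpha> (\<lambda>x. x + real k *\<^sub>R t) = \<alpha> ?g ^^ k"
      using \<alpha>_funpow[OF g, of k] by (simp add: funpow_translation)
    then have "real k *\<^sub>R t \<in> common_lattice"
      using k(2) t by (simp add: common_lattice_def lattice_scale_nat)
    then have "(1 / real k) *\<^sub>R (real k *\<^sub>R t) \<in> span common_lattice"
      by (intro span_scale span_base)
    then show ?thesis using k(1) by simp
  qed
  then have "span lattice \<subseteq> span common_lattice" by (intro span_minimal) auto
  then show ?thesis using span_lattice by blast
qed

text \<open>
  If A extends the additive map that \<open>\<alpha>\<close> induces on \<open>common_lattice\<close>, then \<open>\<alpha> m \<circ> A \<circ> inv m\<close> does not
  change when m is multiplied by an element of \<open>common_lattice\<close>, so it depends only on the pair
  \<open>(lin m, lin (\<alpha> m))\<close>; the average over these finitely many pairs is equivariant.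
\<close>

lemma ex_equivariant: "\<exists>h. linear (lin h) \<and> (\<forall>g\<in>G. h \<circ> g = \<alpha> g \<circ> h)"
proof -
  have "\<exists>A. linear A \<and> (\<forall>t\<in>common_lattice. A t = \<alpha> (\<lambda>x. x + t) 0)"
  proof (rule additive_extends_linear)
    show "finite {t \<in> common_lattice. norm t \<le> R}" for R
      by (rule finite_subset[OF _ lattice_finite[of R]]) (auto simp: common_lattice_def)
  qed (simp_all add: common_lattice_0 common_lattice_add common_lattice_minus)
  then obtain A where A: "linear A" "\<And>t. t \<in> common_lattice \<Longrightarrow> A t = \<alpha> (\<lambda>x. x + t) 0" by blast
  define p where "p m = (lin m, lin (\<alpha> m))" for m
  define Q where "Q = p ` G"
  have finQ: "finite Q"
    by (rule finite_subset[of _ "lin ` G \<times> lin ` G"])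
      (auto simp: Q_def p_def \<alpha>_mem finite_point_group)
  define rep where "rep q = (SOME m. m \<in> G \<and> p m = q)" for q
  have rep: "rep q \<in> G" "p (rep q) = q" if "q \<in> Q" for q
    using someI_ex[of "\<lambda>m. m \<in> G \<and> p m = q"] that by (auto simp: Q_def rep_def)
  define F where "F m x = \<alpha> m (A (inv_into UNIV m x))" for m x
  have F_eq: "F m x = F m' x" if m: "m \<in> G" "m' \<in> G" and eq: "p m = p m'" for m m' x
  proof -
    define k where "k = inv_into UNIV m \<circ> m'"
    have k: "k \<in> G" unfolding k_def using m by (intro comp_mem inv_mem)
    have m': "m' = m \<circ> k" using m by (simp add: k_def fun_eq_iff)
    have "lin k y = y" for y
      using eq lin_comp_apply[OF inv_mem[OF m(1)], of m' y] lin_inv(2)[OF m(1), of y]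
      by (simp add: k_def p_def)
    then have lk: "lin k = id" by (simp add: fun_eq_iff)
    define t where "t = k 0"
    have kt: "k = (\<lambda>x. x + t)" "t \<in> lattice" using lin_eq_id[OF k lk] by (simp_all add: t_def)
    \<comment> \<open>Equality of the second components makes \<open>\<alpha> k\<close> a
      translation as well, which is why \<open>p\<close> records both linear parts.\<close>
    have "lin (\<alpha> m) (lin (\<alpha> k) y) = lin (\<alpha> m) y" for y
      using eq \<alpha>_comp[OF m(1) k] lin_comp_apply[OF \<alpha>_mem[OF m(1)], of "\<alpha> k" y] by (simp add: p_def m')
    then have "lin (\<alpha> k) y = y" for y
      using orthogonal_transformation_inj[OF orth[OF \<alpha>_mem[OF m(1)]]] by (metis injD)
    then have "t \<in> common_lattice" using kt by (simp add: common_lattice_def fun_eq_iff)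
    then have \<alpha>k: "\<alpha> k = (\<lambda>x. x + A t)" using common_lattice_translation[of t] A(2) kt(1) by simp
    have "inv_into UNIV k = (\<lambda>x. x - t)"
      unfolding kt(1) by (rule inv_equality) auto
    then have "F m' x = \<alpha> m (\<alpha> k (A (inv_into UNIV m x - t)))"
      using m(1) k by (simp add: F_def m' \<alpha>_comp inv_comp)
    also have "\<dots> = F m x" by (simp add: F_def \<alpha>k linear_diff[OF A(1)])
    finally show ?thesis by simp
  qed
  define h where "h x = (\<Sum>q\<in>Q. F (rep q) x) /\<^sub>R real (card Q)" for x
  have "Q \<noteq> {}" using id_mem by (auto simp: Q_def)
  then have cardQ: "real (card Q) > 0" using finQ by (simp add: card_gt_0_iff)
  have "h \<circ> g = \<alpha> g \<circ> h" if g: "g \<in> G" for g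
  proof
    fix x
    \<comment> \<open>Left multiplication by \<open>g\<close> permutes the finite set
      \<open>Q\<close>, so it only reorders the average.\<close>
    let ?\<sigma> = "\<lambda>q. p (g \<circ> rep q)"
    have \<sigma>: "?\<sigma> q = (lin g \<circ> fst q, lin (\<alpha> g) \<circ> snd q)" if "q \<in> Q" for q
    proof -
      have "lin (rep q) = fst q" "lin (\<alpha> (rep q)) = snd q"
        using rep(2)[OF that] by (simp_all add: p_def prod_eq_iff)
      then show ?thesis
        using rep(1)[OF that] g by (simp add: p_def \<alpha>_comp lin_comp mem_carrier \<alpha>_mem)
    qed
    have inj: "inj_on ?\<sigma> Q"
    proof (rule inj_onI)
      fix q q' assume q: "q \<in> Q" "q' \<in> Q" and eq: "?\<sigma> q = ?\<sigma> q'"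
      have "inj (lin g)" "inj (lin (\<alpha> g))"
        using orth g \<alpha>_mem by (auto intro: orthogonal_transformation_inj)
      then have "fst q = fst q'" "snd q = snd q'"
        using eq comp_left_cancel unfolding \<sigma>[OF q(1)] \<sigma>[OF q(2)] prod.inject by blast+
      then show "q = q'" by (rule prod_eqI)
    qed
    moreover have into: "?\<sigma> ` Q \<subseteq> Q" using rep g by (auto simp: Q_def intro!: imageI comp_mem)
    ultimately have bijQ: "bij_betw ?\<sigma> Q Q"
      using finQ by (simp add: bij_betw_def endo_inj_surj)
    have step: "\<alpha> g (F (rep q) x) = F (rep (?\<sigma> q)) (g x)" if q: "q \<in> Q" for q
    proof -
      have m: "rep q \<in> G" "g \<circ> rep q \<in> G" using rep(1)[OF q] g by (auto intro: comp_mem)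
      have "\<alpha> g (F (rep q) x) = F (g \<circ> rep q) (g x)"
        using m(1) g by (simp add: F_def \<alpha>_comp inv_comp)
      also have "\<dots> = F (rep (?\<sigma> q)) (g x)"
      proof (rule F_eq[OF m(2)])
        have "?\<sigma> q \<in> Q" using into q by blast
        then show "rep (?\<sigma> q) \<in> G" "p (g \<circ> rep q) = p (rep (?\<sigma> q))" using rep by auto
      qed
      finally show ?thesis .
    qed
    have lg: "linear (lin (\<alpha> g))" using g \<alpha>_mem lin_linear by blast
    have "\<alpha> g (h x) = lin (\<alpha> g) (h x) + \<alpha> g 0" by (rule decomp)
    also have "\<dots> = (\<Sum>q\<in>Q. lin (\<alpha> g) (F (rep q) x)) /\<^sub>R real (card Q) + \<alpha> g 0"
      unfolding h_def by (simp add: linear_cmul[OF lg] linear_sum[OF lg])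
    \<comment> \<open>An affine map commutes with averages because the weights add up to
      one.\<close>
    also have "\<dots> = (\<Sum>q\<in>Q. lin (\<alpha> g) (F (rep q) x) + \<alpha> g 0) /\<^sub>R real (card Q)"
      using cardQ by (simp add: sum.distrib sum_constant_scaleR scaleR_add_right)
    also have "\<dots> = (\<Sum>q\<in>Q. \<alpha> g (F (rep q) x)) /\<^sub>R real (card Q)"
      by (simp add: lin_def)
    also have "\<dots> = (\<Sum>q\<in>Q. F (rep (?\<sigma> q)) (g x)) /\<^sub>R real (card Q)" by (simp add: step)
    also have "\<dots> = h (g x)"
      unfolding h_def using sum.reindex_bij_betw[OF bijQ, of "\<lambda>q. F (rep q) (g x)"] by simp
    finally show "(h \<circ> g) x = (\<alpha> g \<circ> h) x" by simp
  qed
  moreover have "linear (lin h)"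
  proof -
    have "lin h = (\<lambda>x. (1 / real (card Q)) *\<^sub>R
        (\<Sum>q\<in>Q. (lin (\<alpha> (rep q)) \<circ> (A \<circ> lin (inv_into UNIV (rep q)))) x))"
    proof
      fix x
      have "F (rep q) x - F (rep q) 0 = lin (\<alpha> (rep q)) (A (lin (inv_into UNIV (rep q)) x))"
        if "q \<in> Q" for q
      proof -
        let ?m = "rep q"
        have "linear (lin (\<alpha> ?m))" using rep[OF that] \<alpha>_mem lin_linear by blast
        then have "lin (\<alpha> ?m) (A (inv_into UNIV ?m x) - A (inv_into UNIV ?m 0)) =
            F ?m x - F ?m 0"
          by (simp add: linear_diff) (simp add: lin_def F_def)
        then show ?thesis by (simp add: lin_def[of "inv_into UNIV ?m"] linear_diff[OF A(1)])
      qed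
      then have "(\<Sum>q\<in>Q. F (rep q) x) - (\<Sum>q\<in>Q. F (rep q) 0) =
          (\<Sum>q\<in>Q. lin (\<alpha> (rep q)) (A (lin (inv_into UNIV (rep q)) x)))"
        by (simp add: sum_subtractf[symmetric])
      then show "lin h x = (1 / real (card Q)) *\<^sub>R
          (\<Sum>q\<in>Q. (lin (\<alpha> (rep q)) \<circ> (A \<circ> lin (inv_into UNIV (rep q)))) x)"
        by (simp add: lin_def[of h] h_def scaleR_diff_right[symmetric] inverse_eq_divide)
    qed
    moreover have "linear (lin (\<alpha> (rep q)) \<circ> (A \<circ> lin (inv_into UNIV (rep q))))" if "q \<in> Q" for q
      using rep[OF that] A(1) \<alpha>_mem inv_mem lin_linear by (intro linear_compose) auto
    then have "linear (\<lambda>x. \<Sum>q\<in>Q. (lin (\<alpha> (rep q)) \<circ> (A \<circ> lin (inv_into UNIV (rep q)))) x)"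
      by (intro linear_compose_sum) blast
    ultimately show ?thesis by (simp only: linear_compose_scale_right)
  qed
  ultimately show ?thesis by blast
qed

text \<open>For \<open>t\<close> in \<open>common_lattice\<close>, equivariance at the origin forces
  \<open>lin h t\<close> to be the vector of the translation that \<open>\<alpha>\<close> assigns to
  the translation by \<open>t\<close>; such \<open>t\<close> span the space.\<close>

lemma equivariant_lin_unique:
  assumes h: "linear (lin h)" "\<And>g. g \<in> G \<Longrightarrow> h \<circ> g = \<alpha> g \<circ> h"
    and k: "linear (lin k)" "\<And>g. g \<in> G \<Longrightarrow> k \<circ> g = \<alpha> g \<circ> k"
  shows "lin h = lin k"
proof -
  have *: "lin f t = \<alpha> (\<lambda>x. x + t) 0"
    if f: "\<And>g. g \<in> G \<Longrightarrow> f \<circ> g = \<alpha> g \<circ> f" and t: "t \<in> common_lattice" for f t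
  proof -
    have "(f \<circ> (\<lambda>x. x + t)) 0 = (\<alpha> (\<lambda>x. x + t) \<circ> f) 0"
      using f t by (simp add: common_lattice_def translation_lattice)
    also have "\<dots> = f 0 + \<alpha> (\<lambda>x. x + t) 0"
      unfolding comp_def by (subst common_lattice_translation[OF t]) simp
    finally show ?thesis by (simp add: lin_def)
  qed
  have "lin h x = lin k x" for x
  proof (rule linear_eq_on_span[OF h(1) k(1), of common_lattice])
    show "x \<in> span common_lattice" by (simp add: span_common_lattice)
    show "lin h t = lin k t" if "t \<in> common_lattice" for t
      using *[of h t] *[of k t] h(2) k(2) that by simp
  qed
  then show ?thesis by (simp add: fun_eq_iff)
qed

end

end

section \<open>Trivial center and uniqueness of the affine map\<close>

locale centerless_crystal = crystal +
  assumes center: "group_center (grp G) = {\<one>\<^bsub>grp G\<^esub>}"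
begin

lemma lattice_sum: "finite I \<Longrightarrow> (\<And>i. i \<in> I \<Longrightarrow> f i \<in> lattice) \<Longrightarrow> sum f I \<in> lattice"
  by (induction I rule: finite_induct) (auto simp: lattice_0 intro: lattice_add)

text \<open>Summing a lattice vector over the point group gives an invariant lattice vector, that
  is, a central translation, so the sum is zero. A fixed \<open>w\<close> has the same inner product
  with every summand, hence is orthogonal to the whole lattice, which spans.\<close>

lemma no_fixed_vector:
  assumes w: "\<And>g. g \<in> G \<Longrightarrow> lin g w = w"
  shows "w = 0"
proof (rule ccontr)
  assume "w \<noteq> 0"
  have "\<exists>t\<in>lattice. t \<bullet> w \<noteq> 0"
  proof (rule ccontr)
    assume "\<not> (\<exists>t\<in>lattice. t \<bullet> w \<noteq> 0)"
    then have "lattice \<subseteq> {x. w \<bullet> x = 0}" by (auto simp: inner_commute)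
    then have "span lattice \<subseteq> {x. w \<bullet> x = 0}" by (intro span_minimal subspace_hyperplane)
    then have "w \<bullet> w = 0" using span_lattice by blast
    then show False using \<open>w \<noteq> 0\<close> by simp
  qed
  then obtain t where t: "t \<in> lattice" "t \<bullet> w \<noteq> 0" by blast
  define s where "s = (\<Sum>P\<in>lin ` G. P t)"
  have sL: "s \<in> lattice"
    unfolding s_def using finite_point_group t(1) lattice_lin by (intro lattice_sum) auto
  have lin_s: "lin g s = s" if g: "g \<in> G" for g
  proof -
    have "inj_on (\<lambda>P. lin g \<circ> P) (lin ` G)"
      using comp_left_cancel[OF orthogonal_transformation_inj[OF orth[OF g]]] by (auto intro: inj_onI)
    moreover have "(\<lambda>P. lin g \<circ> P) ` lin ` G \<subseteq> lin ` G"
      using g by (auto simp: lin_comp[OF mem_carrier[OF g], symmetric] intro: comp_mem)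
    ultimately have "bij_betw (\<lambda>P. lin g \<circ> P) (lin ` G) (lin ` G)"
      using finite_point_group by (simp add: bij_betw_def endo_inj_surj)
    then have "(\<Sum>P\<in>lin ` G. (lin g \<circ> P) t) = (\<Sum>P\<in>lin ` G. P t)"
      using sum.reindex_bij_betw[of "\<lambda>P. lin g \<circ> P" "lin ` G" "lin ` G" "\<lambda>P. P t"] by simp
    then show ?thesis by (simp add: s_def linear_sum[OF lin_linear[OF g]])
  qed
  have "(\<lambda>x. x + s) \<in> group_center (grp G)"
    using translation_lattice[OF sL] comp_translation lin_s by (simp add: group_center_def)
  then have "(\<lambda>x. x + s) = id" using center by simp
  then have "s = 0" by (simp add: fun_eq_iff)
  moreover have "P t \<bullet> w = t \<bullet> w" if P: "P \<in> lin ` G" for P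
  proof -
    obtain g where g: "g \<in> G" "P = lin g" using P by blast
    have "lin g t \<bullet> lin g w = t \<bullet> w" using orth[OF g(1)] by (simp add: orthogonal_transformation_def)
    then show ?thesis using w[OF g(1)] g(2) by simp
  qed
  then have "s \<bullet> w = real (card (lin ` G)) * (t \<bullet> w)" by (simp add: s_def inner_sum_left)
  moreover have "card (lin ` G) \<noteq> 0" using finite_point_group id_mem by auto
  ultimately show False using t(2) by simp
qed

lemma auto_grp_D:
  assumes "\<alpha> \<in> auto (grp G)"
  shows "g \<in> G \<Longrightarrow> \<alpha> g \<in> G" "f \<in> G \<Longrightarrow> g \<in> G \<Longrightarrow> \<alpha> (f \<circ> g) = \<alpha> f \<circ> \<alpha> g" "\<alpha> ` G = G"
  using assms by (auto simp: auto_def hom_def Bij_def bij_betw_def)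

definition equivariant :: "(('a \<Rightarrow> 'a) \<Rightarrow> ('a \<Rightarrow> 'a)) \<Rightarrow> ('a \<Rightarrow> 'a) \<Rightarrow> bool" where
  "equivariant \<alpha> h \<longleftrightarrow> linear (lin h) \<and> (\<forall>g\<in>G. h \<circ> g = \<alpha> g \<circ> h)"

text \<open>Two equivariant maps have the same linear part and so differ by a constant vector. As
  \<open>\<alpha>\<close> is onto, this vector is fixed by every linear part of
  \<open>G\<close>.\<close>

lemma equivariant_unique:
  assumes \<alpha>: "\<alpha> \<in> auto (grp G)" and h: "equivariant \<alpha> h" and k: "equivariant \<alpha> k"
  shows "h = k"
proof -
  note \<alpha>' = auto_grp_D[OF \<alpha>]
  have lin: "lin h = lin k"
    by (rule equivariant_lin_unique[OF \<alpha>'(1,2)]) (use h k in \<open>auto simp: equivariant_def\<close>)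
  define w where "w = h 0 - k 0"
  have diff: "h x - k x = w" for x
    using lin[THEN fun_cong, of x] by (simp add: lin_def w_def algebra_simps)
  have "lin g w = w" if g: "g \<in> G" for g
  proof -
    obtain f where f: "f \<in> G" "g = \<alpha> f" using g \<alpha>'(3) by blast
    have "h (f 0) = g (h 0)" "k (f 0) = g (k 0)"
      using h k f by (auto simp: equivariant_def fun_eq_iff)
    then have "w = g (h 0) - g (k 0)" using diff[of "f 0"] by simp
    also have "\<dots> = lin g (h 0) - lin g (k 0)" by (simp add: lin_def)
    also have "\<dots> = lin g w" using lin_linear[OF g] by (simp add: w_def linear_diff)
    finally show ?thesis by simp
  qed
  then have "w = 0" by (rule no_fixed_vector)
  then show ?thesis using diff by (simp add: fun_eq_iff)
qed

definition aff :: "(('a \<Rightarrow> 'a) \<Rightarrow> ('a \<Rightarrow> 'a)) \<Rightarrow> ('a \<Rightarrow> 'a)" where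
  "aff \<alpha> = (THE h. equivariant \<alpha> h)"

lemma equivariant_aff:
  assumes "\<alpha> \<in> auto (grp G)"
  shows "equivariant \<alpha> (aff \<alpha>)"
proof -
  have "\<exists>h. equivariant \<alpha> h"
    unfolding equivariant_def by (rule ex_equivariant) (use auto_grp_D[OF assms] in auto)
  then have "\<exists>!h. equivariant \<alpha> h" using equivariant_unique[OF assms] by blast
  then show ?thesis unfolding aff_def by (rule theI')
qed

lemma aff_eqI: "\<alpha> \<in> auto (grp G) \<Longrightarrow> equivariant \<alpha> h \<Longrightarrow> aff \<alpha> = h"
  using equivariant_unique equivariant_aff by blast

lemma lin_linear_aff: "\<alpha> \<in> auto (grp G) \<Longrightarrow> linear (lin (aff \<alpha>))"
  using equivariant_aff by (simp add: equivariant_def)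

lemma aff_comp: "\<alpha> \<in> auto (grp G) \<Longrightarrow> g \<in> G \<Longrightarrow> aff \<alpha> \<circ> g = \<alpha> g \<circ> aff \<alpha>"
  using equivariant_aff by (simp add: equivariant_def)

lemma lin_comp_affine:
  assumes "linear (lin f)"
  shows "lin (f \<circ> g) = lin f \<circ> lin g"
proof
  fix x
  have "lin f (g x) - lin f (g 0) = lin f (g x - g 0)" using assms by (simp add: linear_diff)
  then show "lin (f \<circ> g) x = (lin f \<circ> lin g) x" by (simp add: lin_def)
qed

text \<open>A composite of equivariant maps is equivariant for the composite automorphism, so
  uniqueness makes \<open>aff\<close> multiplicative.\<close>

lemma aff_mult:
  assumes \<alpha>: "\<alpha> \<in> auto (grp G)" and \<beta>: "\<beta> \<in> auto (grp G)"
  shows "aff (\<alpha> \<otimes>\<^bsub>AutoGroup (grp G)\<^esub> \<beta>) = aff \<alpha> \<circ> aff \<beta>"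
proof (rule aff_eqI)
  show "\<alpha> \<otimes>\<^bsub>AutoGroup (grp G)\<^esub> \<beta> \<in> auto (grp G)"
    using monoid.m_closed[OF group.is_monoid[OF group.AutoGroup[OF group_grp]]] \<alpha> \<beta>
    by (simp add: carrier_AutoGroup)
  have "aff \<alpha> \<circ> aff \<beta> \<circ> g = compose G \<alpha> \<beta> g \<circ> (aff \<alpha> \<circ> aff \<beta>)" if g: "g \<in> G" for g
  proof -
    have "aff \<alpha> \<circ> aff \<beta> \<circ> g = aff \<alpha> \<circ> \<beta> g \<circ> aff \<beta>" using aff_comp[OF \<beta> g] by (simp add: comp_assoc)
    also have "\<dots> = compose G \<alpha> \<beta> g \<circ> (aff \<alpha> \<circ> aff \<beta>)"
      using aff_comp[OF \<alpha> auto_grp_D(1)[OF \<beta> g]] g by (simp add: compose_eq comp_assoc)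
    finally show ?thesis .
  qed
  moreover have "linear (lin (aff \<alpha> \<circ> aff \<beta>))"
    using \<alpha> \<beta> lin_linear_aff by (simp add: lin_comp_affine linear_compose)
  ultimately show "equivariant (\<alpha> \<otimes>\<^bsub>AutoGroup (grp G)\<^esub> \<beta>) (aff \<alpha> \<circ> aff \<beta>)"
    using \<alpha> \<beta> by (simp add: equivariant_def mult_AutoGroup)
qed

text \<open>The isometry \<open>m\<close> is itself equivariant for conjugation by \<open>m\<close>,
  so \<open>aff\<close> recovers the elements of \<open>G\<close> from the inner
  automorphisms.\<close>

lemma aff_conj_map:
  assumes m: "m \<in> G"
  shows "aff (conj_map (grp G) G m) = m"
proof (rule aff_eqI)
  show "conj_map (grp G) G m \<in> auto (grp G)"
    using group.conj_map_auto[OF group_grp, of m] m by simp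
  have "m \<circ> g = m \<circ> g \<circ> inv_into UNIV m \<circ> m" for g using m by (simp add: fun_eq_iff)
  then show "equivariant (conj_map (grp G) G m) m"
    using m lin_linear by (simp add: equivariant_def conj_map_def inv_grp)
qed

lemma aff_one: "aff \<one>\<^bsub>AutoGroup (grp G)\<^esub> = id"
proof (rule aff_eqI)
  show "\<one>\<^bsub>AutoGroup (grp G)\<^esub> \<in> auto (grp G)"
    using monoid.one_closed[OF group.is_monoid[OF group.AutoGroup[OF group_grp]]]
    by (simp add: carrier_AutoGroup)
  show "equivariant \<one>\<^bsub>AutoGroup (grp G)\<^esub> id"
    using lin_linear[OF id_mem] by (simp add: equivariant_def one_AutoGroup)
qed

lemma bij_aff:
  assumes \<alpha>: "\<alpha> \<in> auto (grp G)"
  shows "bij (aff \<alpha>)"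
proof -
  interpret A: group "AutoGroup (grp G)" by (rule group.AutoGroup[OF group_grp])
  let ?i = "inv\<^bsub>AutoGroup (grp G)\<^esub> \<alpha>"
  have i: "?i \<in> auto (grp G)" using \<alpha> A.inv_closed[of \<alpha>] by (simp add: carrier_AutoGroup)
  have "aff \<alpha> \<circ> aff ?i = id" "aff ?i \<circ> aff \<alpha> = id"
    using aff_mult[OF \<alpha> i] aff_mult[OF i \<alpha>] aff_one A.l_inv[of \<alpha>] A.r_inv[of \<alpha>] \<alpha>
    by (simp_all add: carrier_AutoGroup)
  then show ?thesis by (rule o_bij[rotated])
qed

lemma aff_inj:
  assumes \<alpha>: "\<alpha> \<in> auto (grp G)" and \<beta>: "\<beta> \<in> auto (grp G)" and eq: "aff \<alpha> = aff \<beta>"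
  shows "\<alpha> = \<beta>"
proof (rule extensionalityI)
  show "\<alpha> \<in> extensional G" "\<beta> \<in> extensional G"
    using auto_extensional[OF \<alpha>] auto_extensional[OF \<beta>] by simp_all
  fix g assume g: "g \<in> G"
  have "\<alpha> g \<circ> aff \<alpha> = \<beta> g \<circ> aff \<alpha>" using aff_comp[OF \<alpha> g] aff_comp[OF \<beta> g] eq by simp
  then show "\<alpha> g = \<beta> g"
    using bij_is_surj[OF bij_aff[OF \<alpha>]] by (metis comp_apply ext surjD)
qed

end

section \<open>Realization of extensions\<close>

text \<open>The range of \<open>x \<mapsto> (f x, g x)\<close> is a subspace isometric to the original space.\<close>

lemma pythagorean_linear:
  fixes f g :: "'a::euclidean_space \<Rightarrow> 'a"
  assumes f: "linear f" "inj f" and g: "linear g"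
  shows "\<exists>h::'a \<Rightarrow> 'a. linear h \<and> inj h \<and> (\<forall>x. (norm (h x))\<^sup>2 = (norm (f x))\<^sup>2 + (norm (g x))\<^sup>2)"
proof -
  let ?k = "\<lambda>x. (f x, g x)"
  have k: "linear ?k" using f(1) g by (simp add: linear_iff)
  have injk: "inj ?k" using f(2) by (auto simp: inj_def)
  have V: "subspace (range ?k)" using linear_subspace_image[OF k subspace_UNIV] .
  have dim: "dim (range ?k) = dim (UNIV :: 'a set)"
    using dim_image_eq[OF k, of UNIV] injk by (simp add: inj_on_subset)
  obtain p :: "'a \<times> 'a \<Rightarrow> 'a" where p: "linear p" "p ` range ?k = UNIV"
    "\<And>x. x \<in> range ?k \<Longrightarrow> norm (p x) = norm x"
    by (rule isometry_subspaces[OF V subspace_UNIV dim]) blast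
  let ?h = "p \<circ> ?k"
  have h: "linear ?h" using linear_compose[OF k p(1)] .
  have n: "(norm (?h x))\<^sup>2 = (norm (f x))\<^sup>2 + (norm (g x))\<^sup>2" for x
    using p(3)[of "?k x"] by (simp add: norm_Pair)
  have "x = 0" if "?h x = 0" for x
  proof -
    have "(norm (f x))\<^sup>2 + (norm (g x))\<^sup>2 = 0" using n[of x] that by simp
    then have "f x = 0" by (simp add: sum_power2_eq_zero_iff)
    then show ?thesis using f by (simp add: linear_injective_0)
  qed
  then have "inj ?h" unfolding linear_injective_0[OF h] by blast
  then show ?thesis using h n by blast
qed

text \<open>The quadratic form on the right has to be the square of the norm after a linear change
  of coordinates. Adding one square at a time produces such a square root of the form without
  diagonalization.\<close>

lemma sum_of_squares_linear:
  fixes P :: "('a::euclidean_space \<Rightarrow> 'a) set"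
  assumes "finite P" "P \<noteq> {}" "\<And>L. L \<in> P \<Longrightarrow> linear L" "\<And>L. L \<in> P \<Longrightarrow> inj L"
  shows "\<exists>h::'a \<Rightarrow> 'a. linear h \<and> inj h \<and> (\<forall>x. (norm (h x))\<^sup>2 = (\<Sum>L\<in>P. (norm (L x))\<^sup>2))"
  using assms
proof (induction P rule: finite_ne_induct)
  case (singleton L)
  then show ?case by auto
next
  case (insert L P)
  have "\<exists>h::'a \<Rightarrow> 'a. linear h \<and> inj h \<and> (\<forall>x. (norm (h x))\<^sup>2 = (\<Sum>L\<in>P. (norm (L x))\<^sup>2))"
    by (rule insert.IH) (use insert.prems in auto)
  then obtain h :: "'a \<Rightarrow> 'a"
    where h: "linear h" "inj h" "\<forall>x. (norm (h x))\<^sup>2 = (\<Sum>L\<in>P. (norm (L x))\<^sup>2)" by blast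
  have "linear L" using insert.prems by simp
  then obtain k :: "'a \<Rightarrow> 'a" where "linear k" "inj k" "\<forall>x. (norm (k x))\<^sup>2 = (norm (h x))\<^sup>2 + (norm (L x))\<^sup>2"
    using pythagorean_linear[OF h(1,2)] by blast
  then show ?case using h(3) insert.hyps by (intro exI[of _ k]) simp
qed

text \<open>The sum of \<open>(norm (L x))\<^sup>2\<close> over \<open>P\<close> is invariant, since
  right multiplication by an element permutes the finite set \<open>P\<close>; \<open>S\<close>
  carries this form to the standard one.\<close>

lemma finite_linear_group_orthogonal:
  fixes P :: "('a::euclidean_space \<Rightarrow> 'a) set"
  assumes P: "finite P" "id \<in> P" "\<And>K L. K \<in> P \<Longrightarrow> L \<in> P \<Longrightarrow> K \<circ> L \<in> P"
    and lin: "\<And>L. L \<in> P \<Longrightarrow> linear L" and bij: "\<And>L. L \<in> P \<Longrightarrow> bij L"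
  obtains S T :: "'a \<Rightarrow> 'a" where "linear S" "linear T" "\<And>x. S (T x) = x" "\<And>x. T (S x) = x"
    "\<And>L x. L \<in> P \<Longrightarrow> norm (S (L x)) = norm (S x)"
proof -
  obtain S :: "'a \<Rightarrow> 'a" where S: "linear S" "inj S" "\<forall>x. (norm (S x))\<^sup>2 = (\<Sum>L\<in>P. (norm (L x))\<^sup>2)"
    using sum_of_squares_linear[of P] P(1,2) lin bij by (metis bij_is_inj empty_iff)
  obtain T where T: "linear T" "\<And>x. S (T x) = x" "\<And>x. T (S x) = x"
    using linear_injective_isomorphism[OF S(1,2)] by blast
  have "norm (S (L x)) = norm (S x)" if L: "L \<in> P" for L x
  proof -
    have "inj_on (\<lambda>K. K \<circ> L) P"
    proof (rule inj_onI)
      fix K K' assume "K \<circ> L = K' \<circ> L"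
      then show "K = K'" using bij_is_surj[OF bij[OF L]] by (metis comp_apply ext surjD)
    qed
    moreover have "(\<lambda>K. K \<circ> L) ` P \<subseteq> P" using P(3) L by blast
    ultimately have "bij_betw (\<lambda>K. K \<circ> L) P P" using P(1) by (simp add: bij_betw_def endo_inj_surj)
    from sum.reindex_bij_betw[OF this, of "\<lambda>K. (norm (K x))\<^sup>2"]
    have "(norm (S (L x)))\<^sup>2 = (norm (S x))\<^sup>2" using S(3) by simp
    then show ?thesis by simp
  qed
  then show thesis using that S(1) T by blast
qed

lemma lin_bij: "bij f \<Longrightarrow> bij (lin f)" for f :: "'a::real_vector \<Rightarrow> 'b::real_vector"
proof -
  assume "bij f"
  moreover have "bij (\<lambda>x. x - f 0)"
    by (rule o_bij[of "\<lambda>x. x + f 0"]) (auto simp: fun_eq_iff)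
  moreover have "lin f = (\<lambda>x. x - f 0) \<circ> f" by (simp add: fun_eq_iff lin_def)
  ultimately show ?thesis by (metis bij_comp)
qed

lemma (in group) conj_eqI:
  "x \<in> carrier G \<Longrightarrow> y \<in> carrier G \<Longrightarrow> z \<in> carrier G \<Longrightarrow> x \<otimes> y = z \<otimes> x \<Longrightarrow> x \<otimes> y \<otimes> inv x = z"
  by (simp add: m_assoc)

context centerless_crystal begin

sublocale M: group "grp G" by (rule group_grp)
sublocale A: group "AutoGroup (grp G)" by (rule M.AutoGroup)
sublocale O: group "Out (grp G)" by (rule M.group_Out)
sublocale out: group_hom "AutoGroup (grp G)" "Out (grp G)" "out (grp G)"
  using M.out_hom by unfold_locales

lemma auto_mult: "a \<in> auto (grp G) \<Longrightarrow> b \<in> auto (grp G) \<Longrightarrow> a \<otimes>\<^bsub>AutoGroup (grp G)\<^esub> b \<in> auto (grp G)"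
  using A.m_closed by (simp add: carrier_AutoGroup)

lemma out_mult: "a \<in> auto (grp G) \<Longrightarrow> b \<in> auto (grp G) \<Longrightarrow>
    out (grp G) (a \<otimes>\<^bsub>AutoGroup (grp G)\<^esub> b) = out (grp G) a \<otimes>\<^bsub>Out (grp G)\<^esub> out (grp G) b"
  using out.hom_mult by (simp add: carrier_AutoGroup)

lemma same_out:
  assumes a: "a \<in> auto (grp G)" and b: "b \<in> auto (grp G)" and eq: "out (grp G) a = out (grp G) b"
  obtains m where "m \<in> G" "a = conj_map (grp G) G m \<otimes>\<^bsub>AutoGroup (grp G)\<^esub> b" "aff a = m \<circ> aff b"
proof -
  have "a \<in> out (grp G) b" using M.mem_out_self[OF a] eq by simp
  then obtain m where m: "m \<in> G" "a = conj_map (grp G) G m \<otimes>\<^bsub>AutoGroup (grp G)\<^esub> b"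
    using M.mem_out_iff[OF b] by auto
  moreover have "conj_map (grp G) G m \<in> auto (grp G)" using M.conj_map_auto[of m] m(1) by simp
  ultimately show thesis using that aff_mult[of _ b] b aff_conj_map[OF m(1)] by metis
qed

text \<open>The affine maps of automorphisms in one outer class differ by elements of
  \<open>G\<close>, which have finitely many linear parts.\<close>

lemma finite_lin_aff:
  assumes C: "finite C"
  shows "finite {lin (aff a) | a. a \<in> auto (grp G) \<and> out (grp G) a \<in> C}"
proof -
  define rep where "rep c = (SOME a. a \<in> auto (grp G) \<and> out (grp G) a = c)" for c
  have "{lin (aff a) | a. a \<in> auto (grp G) \<and> out (grp G) a \<in> C} \<subseteq>
      (\<Union>c\<in>C. (\<lambda>P. P \<circ> lin (aff (rep c))) ` lin ` G)"
  proof clarify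
    fix a assume a: "a \<in> auto (grp G)" "out (grp G) a \<in> C"
    let ?b = "rep (out (grp G) a)"
    have b: "?b \<in> auto (grp G) \<and> out (grp G) ?b = out (grp G) a"
      unfolding rep_def by (rule someI[of _ a]) (use a in simp)
    obtain m where m: "m \<in> G" "aff a = m \<circ> aff ?b" using same_out[OF a(1)] b by metis
    then have "lin (aff a) = lin m \<circ> lin (aff ?b)" by (simp add: lin_comp mem_carrier)
    then show "lin (aff a) \<in> (\<Union>c\<in>C. (\<lambda>P. P \<circ> lin (aff (rep c))) ` lin ` G)" using a(2) m(1) by blast
  qed
  then show ?thesis by (rule finite_subset) (use C finite_point_group in auto)
qed

end

section \<open>The fibre product acting by isometries\<close>

locale realization = centerless_crystal G + D: crystal \<Delta>
  for G :: "('a::euclidean_space \<Rightarrow> 'a) set" and \<Delta> :: "('b::euclidean_space \<Rightarrow> 'b) set" +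
  fixes \<rho> :: "('b \<Rightarrow> 'b) \<Rightarrow> (('a \<Rightarrow> 'a) \<Rightarrow> ('a \<Rightarrow> 'a)) set"
    and S T :: "'a \<Rightarrow> 'a" and f :: "'a \<times> 'b \<Rightarrow> 'c::euclidean_space" and g :: "'c \<Rightarrow> 'a \<times> 'b"
  assumes \<rho>: "\<rho> \<in> hom (grp \<Delta>) (Out (grp G))" and fin_\<rho>: "finite (\<rho> ` \<Delta>)"
    and S: "linear S" "linear T" "\<And>x. S (T x) = x" "\<And>x. T (S x) = x"
    and inv_norm: "\<And>a x. a \<in> auto (grp G) \<Longrightarrow> out (grp G) a \<in> \<rho> ` \<Delta> \<Longrightarrow> norm (S (lin (aff a) x)) = norm (S x)"
    and f: "linear f" "linear g" "\<And>x. norm (f x) = norm x" "\<And>x. g (f x) = x" "\<And>y. f (g y) = y"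
begin

text \<open>
  K is the fibre product of \<open>Aut G\<close> and \<open>\<Delta>\<close> over \<open>Out G\<close>, and \<open>\<Psi>\<close> is its action on the product of the
  two Euclidean spaces; S turns the affine maps into isometries, and f identifies the product
  with a single Euclidean space.
\<close>

definition K where
  "K = {(a, \<delta>). a \<in> auto (grp G) \<and> \<delta> \<in> \<Delta> \<and> out (grp G) a = \<rho> \<delta>}"

definition \<Psi> where
  "\<Psi> k z = f (S (aff (fst k) (T (fst (g z)))), snd k (snd (g z)))"

definition prodG where "prodG = AutoGroup (grp G) \<times>\<times> grp \<Delta>"

sublocale DG: group "grp \<Delta>"
  by (rule D.group_grp)

sublocale P: group prodG
  unfolding prodG_def by (rule DirProd_group[OF A.is_group DG.is_group])

sublocale \<rho>: group_hom "grp \<Delta>" "Out (grp G)" \<rho>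
  using \<rho> by unfold_locales

lemma prodG_simps: "carrier prodG = auto (grp G) \<times> \<Delta>"
  "(a, d) \<otimes>\<^bsub>prodG\<^esub> (b, e) = (a \<otimes>\<^bsub>AutoGroup (grp G)\<^esub> b, d \<circ> e)"
  by (simp_all add: prodG_def carrier_AutoGroup)

lemma subgroup_K: "subgroup K prodG"
proof (rule P.subgroupI)
  show "K \<subseteq> carrier prodG" by (auto simp: K_def prodG_simps)
  have "(\<one>\<^bsub>AutoGroup (grp G)\<^esub>, id) \<in> K"
    using A.one_closed out.hom_one \<rho>.hom_one D.id_mem by (simp add: K_def carrier_AutoGroup)
  then show "K \<noteq> {}" by blast
  show "inv\<^bsub>prodG\<^esub> k \<in> K" if "k \<in> K" for k
  proof -
    obtain a d where k: "k = (a, d)" "a \<in> auto (grp G)" "d \<in> \<Delta>" "out (grp G) a = \<rho> d"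
      using \<open>k \<in> K\<close> by (auto simp: K_def)
    then have "inv\<^bsub>prodG\<^esub> k = (inv\<^bsub>AutoGroup (grp G)\<^esub> a, inv\<^bsub>grp \<Delta>\<^esub> d)"
      unfolding prodG_def k(1) by (intro inv_DirProd) (simp_all add: carrier_AutoGroup)
    moreover have "inv\<^bsub>AutoGroup (grp G)\<^esub> a \<in> auto (grp G)" "inv\<^bsub>grp \<Delta>\<^esub> d \<in> \<Delta>"
      using A.inv_closed[of a] DG.inv_closed[of d] k by (simp_all add: carrier_AutoGroup)
    ultimately show ?thesis
      using k out.hom_inv[of a] \<rho>.hom_inv[of d] by (simp add: K_def carrier_AutoGroup)
  qed
  show "k \<otimes>\<^bsub>prodG\<^esub> l \<in> K" if "k \<in> K" "l \<in> K" for k l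
  proof -
    obtain a d b e where k: "k = (a, d)" "a \<in> auto (grp G)" "d \<in> \<Delta>" "out (grp G) a = \<rho> d"
      and l: "l = (b, e)" "b \<in> auto (grp G)" "e \<in> \<Delta>" "out (grp G) b = \<rho> e"
      using \<open>k \<in> K\<close> \<open>l \<in> K\<close> by (auto simp: K_def)
    then show ?thesis
      using \<rho>.hom_mult[of d e] by (simp add: K_def prodG_simps auto_mult out_mult D.comp_mem)
  qed
qed

lemma K_aff_isometry:
  assumes "(a, d) \<in> K"
  shows "dist (S (aff a x)) (S (aff a y)) = dist (S x) (S y)"
proof -
  have a: "a \<in> auto (grp G)" "out (grp G) a \<in> \<rho> ` \<Delta>" using assms by (auto simp: K_def)
  have "aff a x - aff a y = lin (aff a) (x - y)"
    using lin_linear_aff[OF a(1)] by (simp add: linear_diff) (simp add: lin_def)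
  then have "norm (S (aff a x) - S (aff a y)) = norm (S (x - y))"
    using inv_norm[OF a, of "x - y"] by (simp flip: linear_diff[OF S(1)])
  then show ?thesis by (simp add: dist_norm linear_diff[OF S(1)])
qed

lemma \<Psi>_mult:
  assumes "k \<in> K" "l \<in> K"
  shows "\<Psi> (k \<otimes>\<^bsub>prodG\<^esub> l) = \<Psi> k \<circ> \<Psi> l"
proof -
  obtain a d b e where "k = (a, d)" "a \<in> auto (grp G)" "l = (b, e)" "b \<in> auto (grp G)"
    using assms by (auto simp: K_def)
  then show ?thesis by (simp add: fun_eq_iff \<Psi>_def prodG_simps aff_mult f S)
qed

lemma \<Psi>_isometry:
  assumes k: "k \<in> K"
  shows "\<Psi> k \<in> carrier isometry_group"
proof -
  obtain a d where kk: "k = (a, d)" "a \<in> auto (grp G)" "d \<in> \<Delta>" using k by (auto simp: K_def)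
  have f_dist: "dist (f x) (f y) = dist x y" for x y
    using f(3)[of "x - y"] by (simp add: dist_norm linear_diff[OF f(1)])
  have g_dist: "dist (g x) (g y) = dist x y" for x y
    using f_dist[of "g x" "g y"] by (simp add: f)
  have "dist (\<Psi> k x) (\<Psi> k y) = dist (g x) (g y)" for x y
  proof -
    have "dist (S (aff a (T (fst (g x))))) (S (aff a (T (fst (g y))))) = dist (fst (g x)) (fst (g y))"
      using K_aff_isometry[of a d] k kk(1) by (simp add: S)
    moreover have "dist (d (snd (g x))) (d (snd (g y))) = dist (snd (g x)) (snd (g y))"
      using kk(3) by (rule D.dist_eq)
    ultimately show ?thesis
      unfolding \<Psi>_def f_dist kk(1) by (simp add: dist_prod_def)
  qed
  then have dist: "dist (\<Psi> k x) (\<Psi> k y) = dist x y" for x y by (simp add: g_dist)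
  have "surj (\<Psi> k)"
  proof (rule surjI)
    fix z
    show "\<Psi> k (f (S (inv_into UNIV (aff a) (T (fst (g z)))), inv_into UNIV d (snd (g z)))) = z"
      using bij_aff[OF kk(2)] kk(3)
      by (simp add: \<Psi>_def kk(1) f S surj_f_inv_f bij_is_surj)
  qed
  moreover have "inj (\<Psi> k)"
  proof (rule injI)
    fix x y assume "\<Psi> k x = \<Psi> k y"
    then have "dist x y = 0" using dist[of x y] by simp
    then show "x = y" by simp
  qed
  ultimately show ?thesis using dist by (simp add: mem_isometry_group bij_def)
qed

text \<open>Both components can be read off from the action on the product, the first because an
  automorphism is determined by its affine map.\<close>

lemma \<Psi>_inj: "inj_on \<Psi> K"
proof (rule inj_onI)
  fix k l assume k: "k \<in> K" and l: "l \<in> K" and eq: "\<Psi> k = \<Psi> l"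
  obtain a d where kk: "k = (a, d)" "a \<in> auto (grp G)" using k by (auto simp: K_def)
  obtain b e where ll: "l = (b, e)" "b \<in> auto (grp G)" using l by (auto simp: K_def)
  have "(S (aff a x), d y) = (S (aff b x), e y)" for x y
    using fun_cong[OF eq, of "f (S x, y)", THEN arg_cong[of _ _ g]] by (simp add: \<Psi>_def kk(1) ll(1) f S)
  then have 1: "S (aff a x) = S (aff b x)" and 2: "d y = e y" for x y by blast+
  have "aff a = aff b" using 1 S(4) by (metis ext)
  then have "a = b" using kk(2) ll(2) aff_inj by blast
  moreover have "d = e" using 2 by blast
  ultimately show "k = l" using kk ll by simp
qed

definition \<Gamma> where "\<Gamma> = \<Psi> ` K"

lemma \<Psi>_hom: "group_hom (prodG\<lparr>carrier := K\<rparr>) isometry_group \<Psi>"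
proof -
  have "group (prodG\<lparr>carrier := K\<rparr>)" using subgroup_K P.is_group by (rule subgroup.subgroup_is_group)
  moreover have "\<Psi> \<in> hom (prodG\<lparr>carrier := K\<rparr>) isometry_group"
    by (rule homI) (simp_all add: \<Psi>_isometry \<Psi>_mult)
  ultimately show ?thesis using group_isometry_group by (simp add: group_hom_def group_hom_axioms_def)
qed

lemma subgroup_\<Gamma>: "subgroup \<Gamma> isometry_group"
  using group_hom.img_is_subgroup[OF \<Psi>_hom] by (simp add: \<Gamma>_def)

lemma exists_K: "d \<in> \<Delta> \<Longrightarrow> \<exists>a. (a, d) \<in> K"
  using \<rho>.hom_closed[of d] unfolding M.carrier_Out by (auto simp: K_def)

text \<open>Within one of the finitely many outer classes, \<open>aff a\<close> is some
  \<open>m\<close> in \<open>G\<close> after the affine map of a fixed representative. A bound on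
  \<open>S (aff a 0)\<close> bounds \<open>m 0\<close>, which leaves finitely many
  \<open>m\<close>.\<close>

lemma finite_aff:
  "finite {a \<in> auto (grp G). out (grp G) a \<in> \<rho> ` \<Delta> \<and> norm (S (aff a 0)) \<le> R}"
proof -
  define rep where "rep c = (SOME a. a \<in> auto (grp G) \<and> out (grp G) a = c)" for c
  obtain B where B: "\<And>x. norm (T x) \<le> B * norm x" "B > 0" using linear_bounded_pos[OF S(2)] by blast
  define R' where "R' c = B * R + norm (aff (rep c) 0)" for c
  have "{a \<in> auto (grp G). out (grp G) a \<in> \<rho> ` \<Delta> \<and> norm (S (aff a 0)) \<le> R} \<subseteq>
     (\<Union>c\<in>\<rho> ` \<Delta>. (\<lambda>m. conj_map (grp G) G m \<otimes>\<^bsub>AutoGroup (grp G)\<^esub> rep c) ` {m \<in> G. norm (m 0) \<le> R' c})"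
  proof clarify
    fix a d assume a: "a \<in> auto (grp G)" and d: "out (grp G) a = \<rho> d" "d \<in> \<Delta>" and R: "norm (S (aff a 0)) \<le> R"
    let ?b = "rep (\<rho> d)"
    have b: "?b \<in> auto (grp G)" "out (grp G) ?b = out (grp G) a"
      using someI[of "\<lambda>b. b \<in> auto (grp G) \<and> out (grp G) b = \<rho> d" a] a d unfolding rep_def by simp_all
    obtain m where m: "m \<in> G" "a = conj_map (grp G) G m \<otimes>\<^bsub>AutoGroup (grp G)\<^esub> ?b" "aff a = m \<circ> aff ?b"
      using same_out[OF a b(1) b(2)[symmetric]] .
    have "norm (aff a 0) \<le> B * norm (S (aff a 0))" using B(1)[of "S (aff a 0)"] by (simp only: S(4))
    also have "\<dots> \<le> B * R" using R B(2) by (intro mult_left_mono) auto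
    finally have "norm (aff a 0) \<le> B * R" .
    moreover have "norm (m 0) \<le> norm (m (aff ?b 0)) + norm (aff ?b 0)"
      using dist_eq[OF m(1), of 0 "aff ?b 0"] norm_triangle_sub[of "m 0" "m (aff ?b 0)"] by (simp add: dist_norm)
    ultimately have "norm (m 0) \<le> R' (\<rho> d)" using m(3) by (simp add: R'_def)
    then show "a \<in> (\<Union>c\<in>\<rho> ` \<Delta>. (\<lambda>m. conj_map (grp G) G m \<otimes>\<^bsub>AutoGroup (grp G)\<^esub> rep c) `
        {m \<in> G. norm (m 0) \<le> R' c})"
      using m(1,2) d(2) by blast
  qed
  then show ?thesis by (rule finite_subset) (intro finite_UN_I fin_\<rho> finite_imageI fin)
qed

text \<open>A bound on the translation part bounds both components, which gives finiteness. For
  cocompactness, an element of \<open>\<Delta>\<close> brings the second coordinate near the origin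
  and is lifted to \<open>K\<close>; composing the lift with the inner automorphism of a suitable
  \<open>m\<close> in \<open>G\<close> adjusts the first coordinate without changing the outer
  class, so the result stays in \<open>K\<close> with the same component in
  \<open>\<Delta>\<close>.\<close>

lemma crystal_\<Gamma>: "crystal \<Gamma>"
proof (intro crystal.intro isometry_subgroup.intro crystal_axioms.intro)
  show "subgroup \<Gamma> isometry_group" by (rule subgroup_\<Gamma>)
  fix R
  have "{\<gamma> \<in> \<Gamma>. norm (\<gamma> 0) \<le> R} \<subseteq>
      \<Psi> ` ({a \<in> auto (grp G). out (grp G) a \<in> \<rho> ` \<Delta> \<and> norm (S (aff a 0)) \<le> R} \<times> {d \<in> \<Delta>. norm (d 0) \<le> R})"
  proof clarify
    fix \<gamma> assume "\<gamma> \<in> \<Gamma>" and R: "norm (\<gamma> 0) \<le> R"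
    then obtain a d where k: "(a, d) \<in> K" "\<gamma> = \<Psi> (a, d)" by (auto simp: \<Gamma>_def)
    have "norm (\<gamma> 0) = norm (S (aff a 0), d 0)"
      by (simp add: k(2) \<Psi>_def f(3) linear_0[OF f(2)] linear_0[OF S(2)])
    then have "norm (S (aff a 0)) \<le> R" "norm (d 0) \<le> R"
      using R norm_fst_le[of "S (aff a 0)" "d 0"] norm_snd_le[of "d 0" "S (aff a 0)"] by auto
    then show "\<gamma> \<in> \<Psi> ` ({a \<in> auto (grp G). out (grp G) a \<in> \<rho> ` \<Delta> \<and> norm (S (aff a 0)) \<le> R} \<times>
        {d \<in> \<Delta>. norm (d 0) \<le> R})"
      using k by (intro image_eqI[of _ _ "(a, d)"]) (auto simp: K_def)
  qed
  then show "finite {\<gamma> \<in> \<Gamma>. norm (\<gamma> 0) \<le> R}"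
    by (rule finite_subset) (use finite_aff D.fin in auto)
next
  obtain RG where RG: "\<And>x. \<exists>g\<in>G. norm (g x) \<le> RG" using cocompact by blast
  obtain RD where RD: "\<And>x. \<exists>g\<in>\<Delta>. norm (g x) \<le> RD" using D.cocompact by blast
  obtain B where B: "\<And>x. norm (S x) \<le> B * norm x" "B > 0" using linear_bounded_pos[OF S(1)] by blast
  have "\<exists>\<gamma>\<in>\<Gamma>. norm (\<gamma> z) \<le> B * RG + RD" for z
  proof -
    obtain d where d: "d \<in> \<Delta>" "norm (d (snd (g z))) \<le> RD" using RD by blast
    obtain b where b: "(b, d) \<in> K" using exists_K[OF d(1)] by blast
    then have ba: "b \<in> auto (grp G)" by (simp add: K_def)
    let ?x = "aff b (T (fst (g z)))"
    obtain m where m: "m \<in> G" "norm (m ?x) \<le> RG" using RG by blast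
    let ?c = "conj_map (grp G) G m"
    let ?a = "?c \<otimes>\<^bsub>AutoGroup (grp G)\<^esub> b"
    have c: "?c \<in> auto (grp G)" using M.conj_map_auto[of m] m(1) by simp
    have "out (grp G) ?a = out (grp G) b"
      using M.out_conj_map[of m] m(1) out_mult[OF c ba] ba out.hom_closed[of b] by (simp add: carrier_AutoGroup)
    then have k: "(?a, d) \<in> K" using b auto_mult[OF c ba] by (simp add: K_def)
    have "norm (\<Psi> (?a, d) z) = norm (S (m ?x), d (snd (g z)))"
      using aff_mult[OF c ba] aff_conj_map[OF m(1)] by (simp add: \<Psi>_def f(3))
    also have "\<dots> \<le> norm (S (m ?x)) + norm (d (snd (g z)))" by (rule norm_Pair_le)
    also have "\<dots> \<le> B * RG + RD"
    proof (rule add_mono[OF _ d(2)])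
      have "norm (S (m ?x)) \<le> B * norm (m ?x)" by (rule B(1))
      also have "\<dots> \<le> B * RG" using m(2) B(2) by (intro mult_left_mono) auto
      finally show "norm (S (m ?x)) \<le> B * RG" .
    qed
    finally show ?thesis using k by (auto simp: \<Gamma>_def)
  qed
  then show "\<exists>R. \<forall>z. \<exists>\<gamma>\<in>\<Gamma>. norm (\<gamma> z) \<le> R" by blast
qed

end

section \<open>The extension carried by the fibre product\<close>

context realization begin

definition \<pi> where "\<pi> \<gamma> = snd (inv_into K \<Psi> \<gamma>)"

lemma \<pi>_\<Psi> [simp]: "k \<in> K \<Longrightarrow> \<pi> (\<Psi> k) = snd k"
  by (simp add: \<pi>_def inv_into_f_f[OF \<Psi>_inj])

lemma group_\<Gamma>: "group (grp \<Gamma>)"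
  using subgroup.subgroup_is_group[OF subgroup_\<Gamma> group_isometry_group] .

lemma \<pi>_hom: "\<pi> \<in> hom (grp \<Gamma>) (grp \<Delta>)"
proof (rule homI)
  fix x y assume "x \<in> carrier (grp \<Gamma>)" "y \<in> carrier (grp \<Gamma>)"
  then obtain k l where k: "k \<in> K" "x = \<Psi> k" and l: "l \<in> K" "y = \<Psi> l" by (auto simp: \<Gamma>_def)
  have "k \<otimes>\<^bsub>prodG\<^esub> l \<in> K" using subgroup.m_closed[OF subgroup_K k(1) l(1)] .
  then have "\<pi> (x \<circ> y) = snd (k \<otimes>\<^bsub>prodG\<^esub> l)" using \<Psi>_mult[OF k(1) l(1)] k(2) l(2) \<pi>_\<Psi> by metis
  then show "\<pi> (x \<otimes>\<^bsub>grp \<Gamma>\<^esub> y) = \<pi> x \<otimes>\<^bsub>grp \<Delta>\<^esub> \<pi> y"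
    using k l by (cases k; cases l) (simp add: prodG_simps)
qed (auto simp: \<Gamma>_def K_def)

sublocale \<pi>: group_hom "grp \<Gamma>" "grp \<Delta>" \<pi>
  using group_\<Gamma> DG.is_group \<pi>_hom by (simp add: group_hom_def group_hom_axioms_def)

lemma \<pi>_image: "\<pi> ` \<Gamma> = \<Delta>"
proof
  show "\<Delta> \<subseteq> \<pi> ` \<Gamma>"
  proof
    fix d assume "d \<in> \<Delta>"
    then obtain a where "(a, d) \<in> K" using exists_K by blast
    then show "d \<in> \<pi> ` \<Gamma>" by (intro image_eqI[of _ _ "\<Psi> (a, d)"]) (auto simp: \<Gamma>_def)
  qed
qed (use \<pi>.hom_closed in auto)

definition N where "N = kernel (grp \<Gamma>) (grp \<Delta>) \<pi>"

text \<open>The copy of \<open>G\<close> in \<open>\<Gamma>\<close>: an element of \<open>K\<close>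
  over the identity of \<open>\<Delta>\<close> has trivial outer class, so its first component is an
  inner automorphism. By \<open>aff_conj_map\<close> it acts as \<open>m\<close> on the first
  factor, in the coordinates given by \<open>S\<close>.\<close>

definition j where "j m = \<Psi> (conj_map (grp G) G m, id)"

lemma conj_K: "m \<in> G \<Longrightarrow> (conj_map (grp G) G m, id) \<in> K"
  using M.conj_map_auto[of m] M.out_conj_map[of m] \<rho>.hom_one D.id_mem by (simp add: K_def)

lemma N_eq: "N = j ` G"
proof
  show "N \<subseteq> j ` G"
  proof
    fix \<gamma> assume \<gamma>: "\<gamma> \<in> N"
    then obtain a d where k: "(a, d) \<in> K" "\<gamma> = \<Psi> (a, d)" by (auto simp: N_def kernel_def \<Gamma>_def)
    then have "d = id" using \<gamma> by (simp add: N_def kernel_def)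
    then have a: "a \<in> auto (grp G)" "out (grp G) a = Inn (grp G)"
      using k(1) \<rho>.hom_one by (auto simp: K_def M.one_Out)
    have "a \<in> Inn (grp G)" using M.mem_out_self[OF a(1)] a(2) by simp
    then show "\<gamma> \<in> j ` G" using k(2) \<open>d = id\<close> by (auto simp: Inn_def j_def)
  qed
  show "j ` G \<subseteq> N"
    using conj_K by (auto simp: N_def kernel_def \<Gamma>_def j_def)
qed

lemma N_subset: "N \<subseteq> \<Gamma>" by (auto simp: N_def kernel_def)

lemma j_apply: "m \<in> G \<Longrightarrow> j m z = f (S (m (T (fst (g z)))), snd (g z))"
  by (simp add: j_def \<Psi>_def aff_conj_map)

lemma j_iso: "j \<in> iso (grp G) (grp N)"
proof (rule isoI)
  show "j \<in> hom (grp G) (grp N)"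
  proof (rule homI)
    show "j m \<in> carrier (grp N)" if "m \<in> carrier (grp G)" for m using that by (simp add: N_eq)
    show "j (m \<otimes>\<^bsub>grp G\<^esub> n) = j m \<otimes>\<^bsub>grp N\<^esub> j n" if "m \<in> carrier (grp G)" "n \<in> carrier (grp G)" for m n
      using that comp_mem[of m n] by (simp add: fun_eq_iff j_apply f S)
  qed
  have "inj_on j G"
  proof (rule inj_onI)
    fix m n assume mn: "m \<in> G" "n \<in> G" "j m = j n"
    have "(conj_map (grp G) G m, id) = (conj_map (grp G) G n, id :: 'b \<Rightarrow> 'b)"
      using inj_onD[OF \<Psi>_inj _ conj_K[OF mn(1)] conj_K[OF mn(2)]] mn(3) by (simp add: j_def)
    then have "aff (conj_map (grp G) G m) = aff (conj_map (grp G) G n)" by simp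
    then show "m = n" unfolding aff_conj_map[OF mn(1)] aff_conj_map[OF mn(2)] .
  qed
  then show "bij_betw j (carrier (grp G)) (carrier (grp N))" by (simp add: bij_betw_def N_eq)
qed

definition \<alpha> where "\<alpha> = inv_into G j"

lemma \<alpha>_iso: "\<alpha> \<in> iso (grp N) (grp G)"
  using M.iso_set_sym[OF j_iso] by (simp add: \<alpha>_def)

lemma \<alpha>_j: "m \<in> G \<Longrightarrow> \<alpha> (j m) = m"
  using j_iso by (simp add: \<alpha>_def iso_def bij_betw_def)

sublocale ext: normal_extension N "grp \<Gamma>" "grp G" \<alpha>
proof (intro normal_extension.intro normal_extension_axioms.intro)
  show "N \<lhd> grp \<Gamma>" unfolding N_def by (rule \<pi>.normal_kernel)
  show "\<alpha> \<in> iso (grp \<Gamma>\<lparr>carrier := N\<rparr>) (grp G)" using \<alpha>_iso by simp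
qed (rule M.is_group)

text \<open>By the defining relation of \<open>aff a\<close>, \<open>aff a\<close> after
  \<open>m\<close> is \<open>a m\<close> after \<open>aff a\<close>; so conjugation by
  \<open>\<Psi> (a, d)\<close> takes \<open>j m\<close> to \<open>j (a m)\<close>.\<close>

lemma act_\<Psi>:
  assumes k: "(a, d) \<in> K"
  shows "ext.act (\<Psi> (a, d)) = a"
proof (rule extensionalityI[of _ G])
  have a: "a \<in> auto (grp G)" using k by (simp add: K_def)
  show "a \<in> extensional G" using auto_extensional[OF a] by simp
  show "ext.act (\<Psi> (a, d)) \<in> extensional G" by (simp add: ext.act_def)
  fix m assume m: "m \<in> G"
  let ?\<gamma> = "\<Psi> (a, d)"
  have \<gamma>: "?\<gamma> \<in> \<Gamma>" using k by (simp add: \<Gamma>_def)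
  have am: "a m \<in> G" using auto_grp_D(1)[OF a m] .
  have jG: "j n \<in> \<Gamma>" if "n \<in> G" for n using that N_subset N_eq by blast
  have "?\<gamma> \<circ> j m = j (a m) \<circ> ?\<gamma>"
  proof
    fix z
    have "aff a (m x) = a m (aff a x)" for x using aff_comp[OF a m] by (simp add: fun_eq_iff)
    then show "(?\<gamma> \<circ> j m) z = (j (a m) \<circ> ?\<gamma>) z" using m am by (simp add: \<Psi>_def j_apply f S)
  qed
  then have comm: "?\<gamma> \<otimes>\<^bsub>grp \<Gamma>\<^esub> j m = j (a m) \<otimes>\<^bsub>grp \<Gamma>\<^esub> ?\<gamma>" by simp
  have c: "?\<gamma> \<in> carrier (grp \<Gamma>)" "j m \<in> carrier (grp \<Gamma>)" "j (a m) \<in> carrier (grp \<Gamma>)"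
    using \<gamma> jG[OF m] jG[OF am] by simp_all
  have conj: "?\<gamma> \<otimes>\<^bsub>grp \<Gamma>\<^esub> j m \<otimes>\<^bsub>grp \<Gamma>\<^esub> inv\<^bsub>grp \<Gamma>\<^esub> ?\<gamma> = j (a m)"
    by (rule group.conj_eqI[OF group_\<Gamma> c comm])
  have jN: "j m \<in> N" using m unfolding N_eq by blast
  have "ext.act ?\<gamma> (\<alpha> (j m)) = \<alpha> (?\<gamma> \<otimes>\<^bsub>grp \<Gamma>\<^esub> j m \<otimes>\<^bsub>grp \<Gamma>\<^esub> inv\<^bsub>grp \<Gamma>\<^esub> ?\<gamma>)"
    by (rule ext.act_apply[OF c(1) jN])
  then have "ext.act ?\<gamma> (\<alpha> (j m)) = \<alpha> (j (a m))" unfolding conj .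
  then show "ext.act ?\<gamma> m = a m" unfolding \<alpha>_j[OF m] \<alpha>_j[OF am] .
qed

lemma cls_\<Gamma>:
  assumes "\<gamma> \<in> \<Gamma>"
  shows "ext.cls \<gamma> = \<rho> (\<pi> \<gamma>)"
proof -
  obtain a d where k: "(a, d) \<in> K" "\<gamma> = \<Psi> (a, d)" using assms by (auto simp: \<Gamma>_def)
  then show ?thesis by (simp add: ext.cls_def act_\<Psi>) (simp add: K_def)
qed

end

text \<open>The linear parts of the affine maps over the finite image of \<open>\<rho>\<close> form
  a finite set closed under composition, so one linear change of coordinates makes all of them
  orthogonal. The dimension hypothesis lets a single Euclidean space carry the product
  action.\<close>

theorem (in centerless_crystal) extension_realization:
  fixes \<Delta> :: "('b::euclidean_space \<Rightarrow> 'b) set"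
  assumes \<Delta>: "crystal \<Delta>" and \<rho>: "\<rho> \<in> hom (grp \<Delta>) (Out (grp G))" "finite (\<rho> ` \<Delta>)"
    and dim: "DIM('c::euclidean_space) = DIM('a) + DIM('b)"
  obtains \<Gamma> :: "('c::euclidean_space \<Rightarrow> 'c) set" and N \<alpha> \<pi> where "crystal \<Gamma>" "normal_extension N (grp \<Gamma>) (grp G) \<alpha>"
    "\<pi> \<in> hom (grp \<Gamma>) (grp \<Delta>)" "\<pi> ` \<Gamma> = \<Delta>" "kernel (grp \<Gamma>) (grp \<Delta>) \<pi> = N"
    "\<And>\<gamma>. \<gamma> \<in> \<Gamma> \<Longrightarrow> normal_extension.cls N (grp \<Gamma>) (grp G) \<alpha> \<gamma> = \<rho> (\<pi> \<gamma>)"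
proof -
  interpret D: crystal \<Delta> by fact
  interpret DG: group "grp \<Delta>" by (rule D.group_grp)
  interpret \<rho>: group_hom "grp \<Delta>" "Out (grp G)" \<rho> using \<rho>(1) by unfold_locales
  let ?E = "{a. a \<in> auto (grp G) \<and> out (grp G) a \<in> \<rho> ` \<Delta>}"
  let ?P = "{lin (aff a) | a. a \<in> auto (grp G) \<and> out (grp G) a \<in> \<rho> ` \<Delta>}"
  have one: "\<one>\<^bsub>AutoGroup (grp G)\<^esub> \<in> ?E"
    using A.one_closed \<rho>.hom_one D.id_mem by (auto simp: carrier_AutoGroup intro!: image_eqI[of _ _ id])
  have mult: "a \<otimes>\<^bsub>AutoGroup (grp G)\<^esub> b \<in> ?E" if "a \<in> ?E" "b \<in> ?E" for a b
  proof -
    obtain d e where "a \<in> auto (grp G)" "out (grp G) a = \<rho> d" "d \<in> \<Delta>"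
      "b \<in> auto (grp G)" "out (grp G) b = \<rho> e" "e \<in> \<Delta>" using \<open>a \<in> ?E\<close> \<open>b \<in> ?E\<close> by auto
    then show ?thesis
      using \<rho>.hom_mult[of d e] D.comp_mem[of d e]
      by (auto simp: auto_mult out_mult intro!: image_eqI[of _ _ "d \<circ> e"])
  qed
  have P_id: "id \<in> ?P" using one aff_one by force
  have P_comp: "K \<circ> L \<in> ?P" if "K \<in> ?P" "L \<in> ?P" for K L
  proof -
    obtain a b where ab: "a \<in> ?E" "K = lin (aff a)" "b \<in> ?E" "L = lin (aff b)"
      using \<open>K \<in> ?P\<close> \<open>L \<in> ?P\<close> by blast
    have "K \<circ> L = lin (aff (a \<otimes>\<^bsub>AutoGroup (grp G)\<^esub> b))"
      using ab by (simp add: aff_mult lin_comp_affine lin_linear_aff)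
    then show ?thesis using mult[OF ab(1,3)] by blast
  qed
  have P_lin: "linear L" and P_bij: "bij L" if "L \<in> ?P" for L
    using that lin_linear_aff bij_aff by (auto intro: lin_bij)
  obtain S T :: "'a \<Rightarrow> 'a" where ST: "linear S" "linear T" "\<And>x. S (T x) = x" "\<And>x. T (S x) = x"
    "\<And>L x. L \<in> ?P \<Longrightarrow> norm (S (L x)) = norm (S x)"
    by (rule finite_linear_group_orthogonal[OF finite_lin_aff[OF \<rho>(2)] P_id P_comp P_lin P_bij],
      assumption, assumption, assumption, assumption, rule that, assumption+)
  have dim': "DIM('a \<times> 'b) = DIM('c)" unfolding dim by (rule DIM_prod)
  obtain f :: "'a \<times> 'b \<Rightarrow> 'c" and g where fg: "linear f" "linear g" "\<And>x. norm (f x) = norm x"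
    "\<And>x. g (f x) = x" "\<And>y. f (g y) = y"
    by (rule isomorphisms_UNIV_UNIV[OF dim'], rule that, assumption+)
  interpret realization G \<Delta> \<rho> S T f g
  proof (intro realization.intro realization_axioms.intro)
    show "norm (S (lin (aff a) x)) = norm (S x)" if "a \<in> auto (grp G)" "out (grp G) a \<in> \<rho> ` \<Delta>" for a x
      by (rule ST(5)) (use that in blast)
  qed (fact centerless_crystal_axioms \<Delta> \<rho> ST(1-4) fg)+
  show thesis
    by (rule that, rule crystal_\<Gamma>, rule ext.normal_extension_axioms, rule \<pi>_hom, rule \<pi>_image,
      rule N_def[symmetric], erule cls_\<Gamma>)
qed

section \<open>Coxeter generators and their outer classes\<close>

text \<open>\<open>x\<close> squares to one exactly if its order divides 2, and 0, which encodes
  infinite order, does not divide 2.\<close>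

lemma (in group) ord_1_2_iff: "x \<in> carrier G \<Longrightarrow> ord x \<in> {1, 2} \<longleftrightarrow> x \<otimes> x = \<one>"
proof -
  assume x: "x \<in> carrier G"
  have "d dvd 2 \<longleftrightarrow> d \<in> {1, 2}" for d :: nat
    using dvd_imp_le[of d 2] by (cases "d = 0") (auto simp: le_Suc_eq numeral_2_eq_2)
  then show ?thesis using pow_eq_id[OF x, of 2] x by (simp add: numeral_2_eq_2)
qed

lemma (in group) ord_2_iff: "x \<in> carrier G \<Longrightarrow> ord x = 2 \<longleftrightarrow> x \<otimes> x = \<one> \<and> x \<noteq> \<one>"
  using ord_1_2_iff[of x] ord_eq_1[of x] by auto

lemma (in group) coxeter_generators_iff:
  "coxeter_generators G {x, y} \<longleftrightarrow> x \<in> carrier G \<and> y \<in> carrier G \<and> x \<otimes> x = \<one> \<and> x \<noteq> \<one> \<and>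
    y \<otimes> y = \<one> \<and> y \<noteq> \<one> \<and> generate G {x, y} = carrier G"
proof -
  have "(\<exists>u\<in>carrier G. \<exists>v\<in>carrier G. {x, y} = {u, v} \<and> ord u = 2 \<and> ord v = 2) \<longleftrightarrow>
      x \<in> carrier G \<and> y \<in> carrier G \<and> ord x = 2 \<and> ord y = 2"
    by (auto simp: doubleton_eq_iff)
  then show ?thesis unfolding coxeter_generators_def by (auto simp: ord_2_iff)
qed

lemma (in group) coxeter_generators_dihedral:
  assumes "infinite (carrier G)" "coxeter_generators G {x, y}"
  shows "infinite_dihedral_group G x y"
  using assms by unfold_locales (simp_all add: coxeter_generators_iff)

lemma coxeter_generators_iso:
  assumes G: "group G" and H: "group H" and h: "h \<in> iso G H" and S: "coxeter_generators G {x, y}"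
  shows "coxeter_generators H {h x, h y}"
proof -
  interpret G: group G by fact
  interpret H: group H by fact
  interpret h: group_hom G H h using h by unfold_locales (simp add: iso_def)
  have bij: "bij_betw h (carrier G) (carrier H)" using h by (simp add: iso_def)
  have S': "x \<in> carrier G" "y \<in> carrier G" "x \<otimes>\<^bsub>G\<^esub> x = \<one>\<^bsub>G\<^esub>" "x \<noteq> \<one>\<^bsub>G\<^esub>" "y \<otimes>\<^bsub>G\<^esub> y = \<one>\<^bsub>G\<^esub>" "y \<noteq> \<one>\<^bsub>G\<^esub>"
    "generate G {x, y} = carrier G"
    using S by (simp_all add: G.coxeter_generators_iff)
  have ne: "h z \<noteq> \<one>\<^bsub>H\<^esub>" if z: "z \<in> carrier G" "z \<noteq> \<one>\<^bsub>G\<^esub>" for z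
    using bij z h.hom_one inj_onD[of h "carrier G" z "\<one>\<^bsub>G\<^esub>"] by (auto simp: bij_betw_def)
  have sq: "h z \<otimes>\<^bsub>H\<^esub> h z = \<one>\<^bsub>H\<^esub>" if z: "z \<in> carrier G" "z \<otimes>\<^bsub>G\<^esub> z = \<one>\<^bsub>G\<^esub>" for z
    using h.hom_mult[of z z] z by simp
  have "generate H {h x, h y} = h ` generate G {x, y}"
    using h.generate_img[of "{x, y}"] S'(1,2) by simp
  then have "generate H {h x, h y} = carrier H" using S'(7) bij by (simp add: bij_betw_def)
  then show ?thesis using S' ne sq by (simp add: H.coxeter_generators_iff)
qed

lemma infinite_dihedral_iso:
  assumes "infinite_dihedral G" and H: "group H" and iso: "G \<cong> H"
  shows "infinite_dihedral H"
proof -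
  have G: "group G" "infinite (carrier G)" using assms(1) by (auto simp: infinite_dihedral_def)
  obtain x y where "coxeter_generators G {x, y}"
    using assms(1) unfolding infinite_dihedral_def coxeter_generators_def by blast
  moreover obtain h where "h \<in> iso G H" using iso by (auto simp: is_iso_def)
  ultimately have "coxeter_generators H {h x, h y}" using coxeter_generators_iso[OF G(1) H] by blast
  then show ?thesis using H G(2) iso_finite[OF iso] by (auto simp: infinite_dihedral_def)
qed

lemma hom_dih:
  assumes h: "group_hom G H h" and ab: "a \<in> carrier G" "b \<in> carrier G"
  shows "h (dih G a b k e) = dih H (h a) (h b) k e"
proof -
  interpret group_hom G H h by fact
  show ?thesis using ab by (simp add: dih_def hom_int_pow)
qed

context infinite_dihedral_group
begin

lemma iso_exists:
  assumes H: "infinite_dihedral_group H u v"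
  obtains \<theta> where "\<theta> \<in> iso G H" "\<theta> a = u" "\<theta> b = v"
proof -
  interpret H: infinite_dihedral_group H u v by fact
  obtain \<theta> where \<theta>: "\<theta> \<in> hom G H" "\<theta> a = u" "\<theta> b = v" "\<theta> ` carrier G = {dih H u v k e | k e. True}"
    using hom_exists[OF H.is_group H.ab] .
  have \<theta>_hom: "group_hom G H \<theta>"
    using is_group H.is_group \<theta>(1) by (simp add: group_hom_def group_hom_axioms_def)
  have "inj_on \<theta> (carrier G)"
  proof (rule inj_onI)
    fix x y assume xy: "x \<in> carrier G" "y \<in> carrier G" "\<theta> x = \<theta> y"
    obtain k e where x: "x = dih G a b k e" using xy(1) carrier_dih by blast
    obtain l f where y: "y = dih G a b l f" using xy(2) carrier_dih by blast
    show "x = y"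
      using xy(3) unfolding x y hom_dih[OF \<theta>_hom ab(1,3)] \<theta>(2,3) by (simp add: H.dih_inj)
  qed
  moreover have "\<theta> ` carrier G = carrier H" using \<theta>(4) H.carrier_dih by simp
  ultimately show thesis using that \<theta> by (simp add: iso_def bij_betw_def)
qed

end

context group
begin

lemma conj_class_conj:
  assumes g: "g \<in> carrier G" and S: "S \<subseteq> carrier G"
  shows "conj_class G ((\<lambda>x. g \<otimes> x \<otimes> inv g) ` S) = conj_class G S"
proof -
  have comp: "(\<lambda>x. h \<otimes> x \<otimes> inv h) ` (\<lambda>x. g \<otimes> x \<otimes> inv g) ` S = (\<lambda>x. (h \<otimes> g) \<otimes> x \<otimes> inv (h \<otimes> g)) ` S"
    if h: "h \<in> carrier G" for h
  proof -
    have "h \<otimes> (g \<otimes> x \<otimes> inv g) \<otimes> inv h = (h \<otimes> g) \<otimes> x \<otimes> inv (h \<otimes> g)" if "x \<in> S" for x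
    proof -
      have "x \<in> carrier G" using S that by blast
      then show ?thesis using g h by (simp add: inv_mult_group m_assoc)
    qed
    then show ?thesis unfolding image_image by (rule image_cong[OF refl])
  qed
  show ?thesis
  proof
    show "conj_class G ((\<lambda>x. g \<otimes> x \<otimes> inv g) ` S) \<subseteq> conj_class G S"
    proof
      fix A assume "A \<in> conj_class G ((\<lambda>x. g \<otimes> x \<otimes> inv g) ` S)"
      then obtain h where h: "h \<in> carrier G" "A = (\<lambda>x. h \<otimes> x \<otimes> inv h) ` (\<lambda>x. g \<otimes> x \<otimes> inv g) ` S"
        unfolding conj_class_def by blast
      then have "A = (\<lambda>x. (h \<otimes> g) \<otimes> x \<otimes> inv (h \<otimes> g)) ` S" using comp by simp
      then show "A \<in> conj_class G S" unfolding conj_class_def using h(1) g by blast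
    qed
    show "conj_class G S \<subseteq> conj_class G ((\<lambda>x. g \<otimes> x \<otimes> inv g) ` S)"
    proof
      fix A assume "A \<in> conj_class G S"
      then obtain h where h: "h \<in> carrier G" "A = (\<lambda>x. h \<otimes> x \<otimes> inv h) ` S"
        unfolding conj_class_def by blast
      have "h \<otimes> inv g \<otimes> g = h" using h(1) g by (simp add: m_assoc)
      then have "A = (\<lambda>x. (h \<otimes> inv g) \<otimes> x \<otimes> inv (h \<otimes> inv g)) ` (\<lambda>x. g \<otimes> x \<otimes> inv g) ` S"
        using comp[of "h \<otimes> inv g"] h g by simp
      moreover have "h \<otimes> inv g \<in> carrier G" using h(1) g by simp
      ultimately show "A \<in> conj_class G ((\<lambda>x. g \<otimes> x \<otimes> inv g) ` S)" unfolding conj_class_def by blast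
    qed
  qed
qed

lemma conj_class_eqD:
  assumes S: "S \<subseteq> carrier G" and eq: "conj_class G S = conj_class G S'"
  obtains g where "g \<in> carrier G" "S = (\<lambda>x. g \<otimes> x \<otimes> inv g) ` S'"
proof -
  have "(\<lambda>x. \<one> \<otimes> x \<otimes> inv \<one>) ` S = id ` S" by (rule image_cong) (use S in auto)
  then have "S = (\<lambda>x. \<one> \<otimes> x \<otimes> inv \<one>) ` S" by simp
  then have "S \<in> conj_class G S" unfolding conj_class_def using one_closed by blast
  then have "S \<in> conj_class G S'" unfolding eq .
  then obtain g where "g \<in> carrier G" "S = (\<lambda>x. g \<otimes> x \<otimes> inv g) ` S'"
    unfolding conj_class_def by blast
  then show thesis by (rule that)
qed

end

lemma (in group_hom) kernel_quotient_iso: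
  assumes surj: "h ` carrier G = carrier H"
  obtains \<theta> where "\<theta> \<in> iso (G Mod kernel G H h) H"
    "\<And>g. g \<in> carrier G \<Longrightarrow> \<theta> (kernel G H h #>\<^bsub>G\<^esub> g) = h g"
proof -
  have "the_elem (h ` (kernel G H h #>\<^bsub>G\<^esub> g)) = h g" if g: "g \<in> carrier G" for g
  proof -
    have "h x = h g" if "x \<in> kernel G H h #>\<^bsub>G\<^esub> g" for x
      using that g by (auto simp: r_coset_def kernel_def)
    moreover have "g \<in> kernel G H h #>\<^bsub>G\<^esub> g" using G.rcos_self[OF g subgroup_kernel] .
    ultimately have "h ` (kernel G H h #>\<^bsub>G\<^esub> g) = {h g}" by blast
    then show ?thesis by simp
  qed
  with FactGroup_iso_set[OF surj] show thesis by (rule that)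
qed

text \<open>First isomorphism theorem for \<open>h\<close>, that is, \<open>\<phi>\<close> followed
  by the projection modulo \<open>N2\<close>; its kernel is \<open>N1\<close>.\<close>

lemma quotient_iso:
  assumes N1: "N1 \<lhd> G1" and N2: "N2 \<lhd> G2" and \<phi>: "\<phi> \<in> iso G1 G2" "\<phi> ` N1 = N2"
  obtains \<theta> where "\<theta> \<in> iso (G1 Mod N1) (G2 Mod N2)"
    "\<And>g. g \<in> carrier G1 \<Longrightarrow> \<theta> (N1 #>\<^bsub>G1\<^esub> g) = N2 #>\<^bsub>G2\<^esub> \<phi> g"
proof -
  interpret N1: normal N1 G1 by fact
  interpret N2: normal N2 G2 by fact
  interpret Q2: group "G2 Mod N2" by (rule N2.factorgroup_is_group)
  interpret \<phi>: group_hom G1 G2 \<phi> using \<phi> by unfold_locales (simp add: iso_def)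
  have bij: "bij_betw \<phi> (carrier G1) (carrier G2)" using \<phi>(1) by (simp add: iso_def)
  define h where "h g = N2 #>\<^bsub>G2\<^esub> \<phi> g" for g
  have hhom: "h \<in> hom G1 (G2 Mod N2)"
    using N2.r_coset_hom_Mod by (auto simp: hom_def h_def)
  interpret h: group_hom G1 "G2 Mod N2" h using hhom by unfold_locales
  have mem: "N2 #>\<^bsub>G2\<^esub> y = N2 \<longleftrightarrow> y \<in> N2" if "y \<in> carrier G2" for y
    using that N2.coset_join1[OF _ that N2.subgroup_axioms] N2.coset_join2[OF that N2.subgroup_axioms]
    by blast
  have ker: "kernel G1 (G2 Mod N2) h = N1"
  proof
    show "kernel G1 (G2 Mod N2) h \<subseteq> N1"
    proof
      fix x assume "x \<in> kernel G1 (G2 Mod N2) h"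
      then have x: "x \<in> carrier G1" "\<phi> x \<in> N2" using mem by (auto simp: kernel_def h_def)
      have "\<phi> x \<in> \<phi> ` N1" using x(2) unfolding \<phi>(2) .
      then obtain y where "\<phi> x = \<phi> y" "y \<in> N1" by (rule imageE)
      then show "x \<in> N1" using bij x(1) N1.mem_carrier by (auto simp: bij_betw_def dest: inj_onD)
    qed
    show "N1 \<subseteq> kernel G1 (G2 Mod N2) h"
    proof
      fix x assume x: "x \<in> N1"
      then have "\<phi> x \<in> N2" unfolding \<phi>(2)[symmetric] by (rule imageI)
      then have "h x = N2" using mem[of "\<phi> x"] N2.mem_carrier by (simp add: h_def)
      then show "x \<in> kernel G1 (G2 Mod N2) h" using N1.mem_carrier[OF x] by (simp add: kernel_def)
    qed
  qed
  have surj: "h ` carrier G1 = carrier (G2 Mod N2)"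
    using bij by (auto simp: h_def carrier_FactGroup bij_betw_def image_image[symmetric])
  obtain \<theta> where "\<theta> \<in> iso (G1 Mod N1) (G2 Mod N2)"
    "\<And>g. g \<in> carrier G1 \<Longrightarrow> \<theta> (N1 #>\<^bsub>G1\<^esub> g) = h g"
    by (rule h.kernel_quotient_iso[OF surj, unfolded ker], rule that, assumption+)
  then show thesis using that[of \<theta>] unfolding h_def by blast
qed

section \<open>The outer classes of Coxeter generators as a complete invariant\<close>

text \<open>Transport along \<open>\<phi>\<close> conjugates both outer classes by the class of
  \<open>a\<close>. The transported generators of \<open>G2 Mod N2\<close> are conjugate to the
  given ones by some \<open>q\<close>, and \<open>\<rho> q\<close> conjugates their outer classes
  accordingly.\<close>

lemma outer_pair_class_unique:
  assumes e1: "normal_extension N1 G1 M \<alpha>1" and e2: "normal_extension N2 G2 M \<alpha>2"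
    and \<phi>: "\<phi> \<in> iso G1 G2" "\<phi> ` N1 = N2" and inf: "infinite (carrier (G2 Mod N2))"
    and \<gamma>: "\<gamma>1 \<in> carrier G1" "\<gamma>2 \<in> carrier G1"
      "coxeter_generators (G1 Mod N1) {N1 #>\<^bsub>G1\<^esub> \<gamma>1, N1 #>\<^bsub>G1\<^esub> \<gamma>2}"
    and \<delta>: "\<delta>1 \<in> carrier G2" "\<delta>2 \<in> carrier G2"
      "coxeter_generators (G2 Mod N2) {N2 #>\<^bsub>G2\<^esub> \<delta>1, N2 #>\<^bsub>G2\<^esub> \<delta>2}"
  shows "conj_class (Out M) {normal_extension.cls N1 G1 M \<alpha>1 \<gamma>1, normal_extension.cls N1 G1 M \<alpha>1 \<gamma>2} =
    conj_class (Out M) {normal_extension.cls N2 G2 M \<alpha>2 \<delta>1, normal_extension.cls N2 G2 M \<alpha>2 \<delta>2}"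
proof -
  interpret e1: normal_extension N1 G1 M \<alpha>1 by fact
  interpret e2: normal_extension N2 G2 M \<alpha>2 by fact
  interpret O: group "Out M" by (rule e1.M.group_Out)
  interpret Q1: group "G1 Mod N1" by (rule e1.factorgroup_is_group)
  interpret Q2: group "G2 Mod N2" by (rule e2.factorgroup_is_group)
  interpret \<phi>: group_hom G1 G2 \<phi> using \<phi> by unfold_locales (simp add: iso_def)
  obtain \<theta> where \<theta>: "\<theta> \<in> iso (G1 Mod N1) (G2 Mod N2)"
    "\<And>g. g \<in> carrier G1 \<Longrightarrow> \<theta> (N1 #>\<^bsub>G1\<^esub> g) = N2 #>\<^bsub>G2\<^esub> \<phi> g"
    by (rule quotient_iso[OF e1.normal_axioms e2.normal_axioms \<phi>], rule that, assumption+)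
  have "coxeter_generators (G2 Mod N2) {N2 #>\<^bsub>G2\<^esub> \<phi> \<gamma>1, N2 #>\<^bsub>G2\<^esub> \<phi> \<gamma>2}"
    using coxeter_generators_iso[OF Q1.is_group Q2.is_group \<theta>(1) \<gamma>(3)] \<theta>(2) \<gamma>(1,2) by simp
  then interpret D: infinite_dihedral_group "G2 Mod N2" "N2 #>\<^bsub>G2\<^esub> \<phi> \<gamma>1" "N2 #>\<^bsub>G2\<^esub> \<phi> \<gamma>2"
    by (rule Q2.coxeter_generators_dihedral[OF inf])
  obtain q where q: "q \<in> carrier (G2 Mod N2)"
    "{q \<otimes>\<^bsub>G2 Mod N2\<^esub> (N2 #>\<^bsub>G2\<^esub> \<phi> \<gamma>1) \<otimes>\<^bsub>G2 Mod N2\<^esub> inv\<^bsub>G2 Mod N2\<^esub> q,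
      q \<otimes>\<^bsub>G2 Mod N2\<^esub> (N2 #>\<^bsub>G2\<^esub> \<phi> \<gamma>2) \<otimes>\<^bsub>G2 Mod N2\<^esub> inv\<^bsub>G2 Mod N2\<^esub> q} =
      {N2 #>\<^bsub>G2\<^esub> \<delta>1, N2 #>\<^bsub>G2\<^esub> \<delta>2}"
    using \<delta>(3) unfolding Q2.coxeter_generators_iff
    by (elim conjE) (rule D.generators_conjugate[of "N2 #>\<^bsub>G2\<^esub> \<delta>1" "N2 #>\<^bsub>G2\<^esub> \<delta>2"], assumption+)
  obtain \<rho> where \<rho>: "\<rho> \<in> hom (G2 Mod N2) (Out M)" "\<And>g. g \<in> carrier G2 \<Longrightarrow> \<rho> (N2 #>\<^bsub>G2\<^esub> g) = e2.cls g"
    using e2.quotient_hom by blast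
  interpret \<rho>: group_hom "G2 Mod N2" "Out M" \<rho> using \<rho>(1) by unfold_locales
  define a where "a = (\<lambda>m\<in>carrier M. \<alpha>2 (\<phi> (inv_into N1 \<alpha>1 m)))"
  have a: "a \<in> auto M" unfolding a_def by (rule normal_extension_conj(1)[OF e1 e2 \<phi>])
  have cls: "e2.cls (\<phi> g) = out M a \<otimes>\<^bsub>Out M\<^esub> e1.cls g \<otimes>\<^bsub>Out M\<^esub> inv\<^bsub>Out M\<^esub> out M a"
    if "g \<in> carrier G1" for g
    unfolding a_def by (rule normal_extension_conj(2)[OF e1 e2 \<phi> that])
  let ?A = "out M a" and ?r = "\<rho> q"
  have A: "?A \<in> carrier (Out M)" using a by (simp add: e1.M.carrier_Out)
  have r: "?r \<in> carrier (Out M)" using q(1) by (rule \<rho>.hom_closed)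
  let ?c = "\<lambda>g x. g \<otimes>\<^bsub>Out M\<^esub> x \<otimes>\<^bsub>Out M\<^esub> inv\<^bsub>Out M\<^esub> g"
  have "\<rho> (q \<otimes>\<^bsub>G2 Mod N2\<^esub> X \<otimes>\<^bsub>G2 Mod N2\<^esub> inv\<^bsub>G2 Mod N2\<^esub> q) = ?c ?r (\<rho> X)"
    if "X \<in> carrier (G2 Mod N2)" for X
    using q(1) that by (simp del: mult_FactGroup)
  then have "{e2.cls \<delta>1, e2.cls \<delta>2} = {?c ?r (e2.cls (\<phi> \<gamma>1)), ?c ?r (e2.cls (\<phi> \<gamma>2))}"
    using arg_cong[OF q(2), of "(`) \<rho>"] D.ab(1,3) \<gamma>(1,2) \<delta>(1,2)
    by (simp add: \<rho>(2) del: mult_FactGroup)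
  also have "\<dots> = ?c ?r ` ?c ?A ` {e1.cls \<gamma>1, e1.cls \<gamma>2}"
    using \<gamma>(1,2) by (simp add: cls)
  finally have "conj_class (Out M) {e2.cls \<delta>1, e2.cls \<delta>2} =
      conj_class (Out M) (?c ?r ` ?c ?A ` {e1.cls \<gamma>1, e1.cls \<gamma>2})" by (rule arg_cong)
  also have "\<dots> = conj_class (Out M) (?c ?A ` {e1.cls \<gamma>1, e1.cls \<gamma>2})"
    by (rule O.conj_class_conj[OF r]) (use A \<gamma>(1,2) in auto)
  also have "\<dots> = conj_class (Out M) {e1.cls \<gamma>1, e1.cls \<gamma>2}"
    by (rule O.conj_class_conj[OF A]) (use \<gamma>(1,2) in auto)
  finally show ?thesis by simp
qed

text \<open>The case of the identity isomorphism in \<open>normal_extension_conj\<close>: a change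
  of identification conjugates all outer classes at once.\<close>

lemma normal_extension_twist:
  assumes e: "normal_extension N G M \<alpha>" and b: "b \<in> auto M"
  shows "normal_extension N G M (\<lambda>n. b (\<alpha> n))"
    and "g \<in> carrier G \<Longrightarrow> normal_extension.cls N G M (\<lambda>n. b (\<alpha> n)) g =
      out M b \<otimes>\<^bsub>Out M\<^esub> normal_extension.cls N G M \<alpha> g \<otimes>\<^bsub>Out M\<^esub> inv\<^bsub>Out M\<^esub> (out M b)"
proof -
  interpret normal_extension N G M \<alpha> by fact
  have "b \<in> iso M M" using b auto_bij[OF b] by (simp add: iso_def auto_def)
  then have "b \<circ> \<alpha> \<in> iso (G\<lparr>carrier := N\<rparr>) M" using iso_set_trans[OF iso] by blast
  then show e': "normal_extension N G M (\<lambda>n. b (\<alpha> n))"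
    using normal_axioms M.is_group
    by (simp add: normal_extension_def normal_extension_axioms_def comp_def)
  assume g: "g \<in> carrier G"
  have "(\<lambda>m\<in>carrier M. b (\<alpha> (id (inv_into N \<alpha> m)))) = b"
    by (rule extensionalityI[of _ "carrier M"]) (use auto_extensional[OF b] in auto)
  then show "normal_extension.cls N G M (\<lambda>n. b (\<alpha> n)) g =
      out M b \<otimes>\<^bsub>Out M\<^esub> cls g \<otimes>\<^bsub>Out M\<^esub> inv\<^bsub>Out M\<^esub> (out M b)"
    using normal_extension_conj(2)[OF e e' id_iso _ g] by simp
qed

text \<open>Twisting \<open>\<alpha>1\<close> by an automorphism of \<open>M\<close> turns conjugate
  pairs into equal ones. The isomorphism of quotients that matches the generators then respects the
  outer actions, since a homomorphism is determined by its values on generators, and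
  \<open>centerless_extension_iso\<close> applies.\<close>

lemma outer_pair_class_injective:
  assumes e1: "normal_extension N1 G1 M \<alpha>1" and e2: "normal_extension N2 G2 M \<alpha>2"
    and center: "group_center M = {\<one>\<^bsub>M\<^esub>}"
    and inf: "infinite (carrier (G1 Mod N1))" "infinite (carrier (G2 Mod N2))"
    and \<gamma>: "\<gamma>1 \<in> carrier G1" "\<gamma>2 \<in> carrier G1"
      "coxeter_generators (G1 Mod N1) {N1 #>\<^bsub>G1\<^esub> \<gamma>1, N1 #>\<^bsub>G1\<^esub> \<gamma>2}"
    and \<delta>: "\<delta>1 \<in> carrier G2" "\<delta>2 \<in> carrier G2"
      "coxeter_generators (G2 Mod N2) {N2 #>\<^bsub>G2\<^esub> \<delta>1, N2 #>\<^bsub>G2\<^esub> \<delta>2}"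
    and eq: "conj_class (Out M) {normal_extension.cls N1 G1 M \<alpha>1 \<gamma>1, normal_extension.cls N1 G1 M \<alpha>1 \<gamma>2} =
      conj_class (Out M) {normal_extension.cls N2 G2 M \<alpha>2 \<delta>1, normal_extension.cls N2 G2 M \<alpha>2 \<delta>2}"
  shows "\<exists>\<phi>\<in>iso G1 G2. \<phi> ` N1 = N2"
proof -
  interpret e1: normal_extension N1 G1 M \<alpha>1 by fact
  interpret e2: normal_extension N2 G2 M \<alpha>2 by fact
  interpret O: group "Out M" by (rule e1.M.group_Out)
  interpret Q1: group "G1 Mod N1" by (rule e1.factorgroup_is_group)
  interpret Q2: group "G2 Mod N2" by (rule e2.factorgroup_is_group)
  let ?c = "\<lambda>g x. g \<otimes>\<^bsub>Out M\<^esub> x \<otimes>\<^bsub>Out M\<^esub> inv\<^bsub>Out M\<^esub> g"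
  obtain A where A: "A \<in> carrier (Out M)" "{e2.cls \<delta>1, e2.cls \<delta>2} = ?c A ` {e1.cls \<gamma>1, e1.cls \<gamma>2}"
    using O.conj_class_eqD[OF _ eq[symmetric]] \<delta>(1,2) by auto
  obtain b where b: "b \<in> auto M" "A = out M b" using A(1) by (auto simp: e1.M.carrier_Out)
  let ?\<alpha> = "\<lambda>n. b (\<alpha>1 n)"
  have e3: "normal_extension N1 G1 M ?\<alpha>" by (rule normal_extension_twist(1)[OF e1 b(1)])
  interpret e3: normal_extension N1 G1 M ?\<alpha> by fact
  have e3_cls: "e3.cls g = ?c A (e1.cls g)" if "g \<in> carrier G1" for g
    unfolding b(2) by (rule normal_extension_twist(2)[OF e1 b(1) that])
  have "{e2.cls \<delta>1, e2.cls \<delta>2} = {e3.cls \<gamma>1, e3.cls \<gamma>2}" using A(2) \<gamma>(1,2) by (simp add: e3_cls)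
  \<comment> \<open>Equal unordered pairs match only up to a swap; \<open>\<epsilon>1\<close> and
    \<open>\<epsilon>2\<close> are \<open>\<delta>1\<close> and \<open>\<delta>2\<close> in the
    right order.\<close>
  then have "\<exists>\<epsilon>1 \<epsilon>2. {\<epsilon>1, \<epsilon>2} = {\<delta>1, \<delta>2} \<and> e2.cls \<epsilon>1 = e3.cls \<gamma>1 \<and> e2.cls \<epsilon>2 = e3.cls \<gamma>2"
    by (auto simp: doubleton_eq_iff)
  then obtain \<epsilon>1 \<epsilon>2 where \<epsilon>: "{\<epsilon>1, \<epsilon>2} = {\<delta>1, \<delta>2}" "e2.cls \<epsilon>1 = e3.cls \<gamma>1" "e2.cls \<epsilon>2 = e3.cls \<gamma>2"
    by blast
  have \<epsilon>': "\<epsilon>1 \<in> carrier G2" "\<epsilon>2 \<in> carrier G2" using \<epsilon>(1) \<delta>(1,2) by auto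
  have "{N2 #>\<^bsub>G2\<^esub> \<epsilon>1, N2 #>\<^bsub>G2\<^esub> \<epsilon>2} = {N2 #>\<^bsub>G2\<^esub> \<delta>1, N2 #>\<^bsub>G2\<^esub> \<delta>2}"
    using \<epsilon>(1) by (auto simp: doubleton_eq_iff)
  then have cox: "coxeter_generators (G2 Mod N2) {N2 #>\<^bsub>G2\<^esub> \<epsilon>1, N2 #>\<^bsub>G2\<^esub> \<epsilon>2}" using \<delta>(3) by simp
  interpret D1: infinite_dihedral_group "G1 Mod N1" "N1 #>\<^bsub>G1\<^esub> \<gamma>1" "N1 #>\<^bsub>G1\<^esub> \<gamma>2"
    by (rule Q1.coxeter_generators_dihedral[OF inf(1) \<gamma>(3)])
  obtain \<theta> where \<theta>: "\<theta> \<in> iso (G1 Mod N1) (G2 Mod N2)" "\<theta> (N1 #>\<^bsub>G1\<^esub> \<gamma>1) = N2 #>\<^bsub>G2\<^esub> \<epsilon>1"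
    "\<theta> (N1 #>\<^bsub>G1\<^esub> \<gamma>2) = N2 #>\<^bsub>G2\<^esub> \<epsilon>2"
    using D1.iso_exists[OF Q2.coxeter_generators_dihedral[OF inf(2) cox]] .
  obtain \<rho>2 where \<rho>2: "\<rho>2 \<in> hom (G2 Mod N2) (Out M)" "\<And>g. g \<in> carrier G2 \<Longrightarrow> \<rho>2 (N2 #>\<^bsub>G2\<^esub> g) = e2.cls g"
    using e2.quotient_hom by blast
  obtain \<rho>3 where \<rho>3: "\<rho>3 \<in> hom (G1 Mod N1) (Out M)" "\<And>g. g \<in> carrier G1 \<Longrightarrow> \<rho>3 (N1 #>\<^bsub>G1\<^esub> g) = e3.cls g"
    using e3.quotient_hom by blast
  have "(\<lambda>X. \<rho>2 (\<theta> X)) \<in> hom (G1 Mod N1) (Out M)"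
    using \<theta>(1) \<rho>2(1) by (auto simp: hom_def iso_def Pi_iff simp del: mult_FactGroup)
  then have agree: "\<rho>2 (\<theta> X) = \<rho>3 X" if "X \<in> carrier (G1 Mod N1)" for X
    using that \<rho>3(1) D1.hom_eqI[OF O.is_group, of "\<lambda>X. \<rho>2 (\<theta> X)" \<rho>3 X] \<theta>(2,3) \<rho>2(2) \<rho>3(2) \<epsilon>(2,3) \<epsilon>' \<gamma>(1,2)
    by simp
  show ?thesis
  proof (rule centerless_extension_iso[OF e3 e2 center \<theta>(1)])
    fix x y assume x: "x \<in> carrier G1" and y: "y \<in> carrier G2" and xy: "\<theta> (N1 #>\<^bsub>G1\<^esub> x) = N2 #>\<^bsub>G2\<^esub> y"
    have "N1 #>\<^bsub>G1\<^esub> x \<in> carrier (G1 Mod N1)" using x by (auto simp: carrier_FactGroup)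
    then show "e2.cls y = e3.cls x" using agree[of "N1 #>\<^bsub>G1\<^esub> x"] xy \<rho>2(2)[OF y] \<rho>3(2)[OF x] by simp
  qed
qed

text \<open>
  If \<open>\<gamma>\<close> to the power k is the translation by t and F is the point group of N, then \<open>\<gamma>\<close> to the power
  \<open>k \<cdot> card F\<close> acts on N like the translation by \<open>w = (\<Sum>P\<in>F. t - P t)\<close>, which belongs to N.
\<close>

lemma (in crystal) cls_finite_order:
  assumes e: "normal_extension N (grp G) M \<alpha>" and \<gamma>: "\<gamma> \<in> G"
  shows "group.ord (Out M) (normal_extension.cls N (grp G) M \<alpha> \<gamma>) \<noteq> 0"
proof -
  interpret e: normal_extension N "grp G" M \<alpha> by fact
  interpret O: group "Out M" by (rule e.M.group_Out)
  interpret cls: group_hom "grp G" "Out M" e.cls using e.cls_hom by unfold_locales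
  have NG: "n \<in> G" if "n \<in> N" for n using e.mem_carrier[OF that] by simp
  have N_comp: "f \<circ> g \<in> N" if "f \<in> N" "g \<in> N" for f g
    using subgroup.m_closed[OF e.subgroup_axioms that] by simp
  have N_id: "id \<in> N" using subgroup.one_closed[OF e.subgroup_axioms] by simp
  have pow: "\<gamma> [^]\<^bsub>grp G\<^esub> (i::nat) = \<gamma> ^^ i" for i
    by (induction i) (simp_all add: funpow_Suc_right del: funpow.simps(2))
  obtain k where k: "k > 0" "lin (\<gamma> ^^ k) = id" using power_translation[OF \<gamma>] .
  define t where "t = (\<gamma> ^^ k) 0"
  have t: "\<gamma> ^^ k = (\<lambda>x. x + t)" "t \<in> lattice"
    using lin_eq_id[OF funpow_mem[OF \<gamma>] k(2)] by (simp_all add: t_def)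
  \<comment> \<open>Conjugation by the translation by \<open>s\<close> depends on \<open>s\<close>
    only through the differences \<open>s - lin \<nu> s\<close>, so vectors with the same
    differences act alike on \<open>N\<close>.\<close>
  have conj_tr: "(\<lambda>x. x + s) \<circ> \<nu> \<circ> inv_into UNIV (\<lambda>x. x + s) = (\<lambda>x. x + (s - lin \<nu> s)) \<circ> \<nu>"
    if "\<nu> \<in> G" for s \<nu>
  proof -
    have i: "inv_into UNIV (\<lambda>x. x + s) = (\<lambda>x. x + - s)" by (rule inv_equality) auto
    have l: "lin \<nu> (- s) = - lin \<nu> s" using lin_linear[OF that] by (rule linear_neg)
    show ?thesis
    proof
      fix x
      have "\<nu> (x + - s) = \<nu> x + lin \<nu> (- s)"
        using fun_cong[OF comp_translation[OF that, of "- s"], of x] by simp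
      then show "((\<lambda>x. x + s) \<circ> \<nu> \<circ> inv_into UNIV (\<lambda>x. x + s)) x = ((\<lambda>x. x + (s - lin \<nu> s)) \<circ> \<nu>) x"
        unfolding i l by simp
    qed
  qed
  have N_tr: "(\<lambda>x. x + (s + s')) \<in> N" if s: "(\<lambda>x. x + s) \<in> N" "(\<lambda>x. x + s') \<in> N" for s s' :: 'a
  proof -
    have "(\<lambda>x. x + s') \<circ> (\<lambda>x. x + s) \<in> N" using s(2,1) by (rule N_comp)
    then show ?thesis by (simp add: comp_def add.assoc)
  qed
  \<comment> \<open>This translation is the commutator of the translation by \<open>t\<close> with
    \<open>\<nu>\<close>, which lies in \<open>N\<close> by normality.\<close>
  have diff: "(\<lambda>x. x + (t - lin \<nu> t)) \<in> N" if \<nu>: "\<nu> \<in> N" for \<nu>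
  proof -
    have tG: "(\<lambda>x. x + t) \<in> G" using t(2) by (rule translation_lattice)
    have "(\<lambda>x. x + t) \<circ> \<nu> \<circ> inv_into UNIV (\<lambda>x. x + t) \<in> N"
      using e.conj_closed[of "\<lambda>x. x + t" \<nu>] \<nu> tG by (simp add: inv_grp)
    then have A: "(\<lambda>x. x + (t - lin \<nu> t)) \<circ> \<nu> \<in> N" unfolding conj_tr[OF NG[OF \<nu>]] .
    have "inv_into UNIV \<nu> \<in> N"
      using subgroup.m_inv_closed[OF e.subgroup_axioms \<nu>] by (simp add: inv_grp[OF NG[OF \<nu>]])
    then have "(\<lambda>x. x + (t - lin \<nu> t)) \<circ> \<nu> \<circ> inv_into UNIV \<nu> \<in> N" by (rule N_comp[OF A])
    moreover have "(\<lambda>x. x + (t - lin \<nu> t)) \<circ> \<nu> \<circ> inv_into UNIV \<nu> = (\<lambda>x. x + (t - lin \<nu> t))"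
      using NG[OF \<nu>] by (simp add: fun_eq_iff)
    ultimately show ?thesis by simp
  qed
  let ?F = "lin ` N"
  have finF: "finite ?F" using finite_subset[OF _ finite_point_group] NG by blast
  define w where "w = (\<Sum>P\<in>?F. t - P t)"
  have "(\<lambda>x. x + (\<Sum>P\<in>I. t - P t)) \<in> N" if "finite I" "I \<subseteq> ?F" for I
    using that
  proof (induction I rule: finite_induct)
    case empty
    then show ?case using N_id by (simp add: id_def)
  next
    case (insert P I)
    then obtain \<nu> where "\<nu> \<in> N" "P = lin \<nu>" by blast
    then show ?case using insert diff N_tr by simp
  qed
  then have wN: "(\<lambda>x. x + w) \<in> N" using finF by (simp add: w_def)
  let ?c = "real (card ?F)"
  \<comment> \<open>The sum of all \<open>P t\<close> is invariant under the point group of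
    \<open>N\<close>, and \<open>w\<close> is \<open>?c *\<^sub>R t\<close> minus this sum.\<close>
  have w_eq: "w - lin \<nu> w = ?c *\<^sub>R t - lin \<nu> (?c *\<^sub>R t)" if \<nu>: "\<nu> \<in> N" for \<nu>
  proof -
    have l: "linear (lin \<nu>)" using lin_linear NG[OF \<nu>] by blast
    have "inj_on (\<lambda>P. lin \<nu> \<circ> P) ?F"
      using comp_left_cancel[OF orthogonal_transformation_inj[OF orth[OF NG[OF \<nu>]]]] by (auto intro: inj_onI)
    moreover have "(\<lambda>P. lin \<nu> \<circ> P) ` ?F \<subseteq> ?F"
    proof clarify
      fix \<mu> assume "\<mu> \<in> N"
      then have "\<nu> \<circ> \<mu> \<in> N" using N_comp[OF \<nu>] by simp
      then show "lin \<nu> \<circ> lin \<mu> \<in> ?F" using lin_comp[OF mem_carrier[OF NG[OF \<nu>]], of \<mu>] by (metis imageI)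
    qed
    ultimately have "bij_betw (\<lambda>P. lin \<nu> \<circ> P) ?F ?F" using finF by (simp add: bij_betw_def endo_inj_surj)
    from sum.reindex_bij_betw[OF this, of "\<lambda>P. P t"]
    have "(\<Sum>P\<in>?F. lin \<nu> (P t)) = (\<Sum>P\<in>?F. P t)" by simp
    moreover have "w = ?c *\<^sub>R t - (\<Sum>P\<in>?F. P t)" by (simp add: w_def sum_subtractf sum_constant_scaleR)
    ultimately show ?thesis by (simp add: linear_diff[OF l] linear_sum[OF l])
  qed
  define K where "K = k * card ?F"
  have "\<gamma> ^^ K = (\<lambda>x. x + t) ^^ card ?F" unfolding K_def t(1)[symmetric] by (simp add: funpow_mult mult.commute)
  then have \<gamma>K: "\<gamma> ^^ K = (\<lambda>x. x + ?c *\<^sub>R t)" by (simp add: funpow_translation)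
  have act_eq: "e.act (\<gamma> ^^ K) = e.act (\<lambda>x. x + w)"
  proof (rule extensionalityI[of _ "carrier M"])
    fix m assume "m \<in> carrier M"
    then obtain n where n: "n \<in> N" "m = \<alpha> n" by (rule e.iso_cases)
    have "\<gamma> ^^ K \<circ> n \<circ> inv_into UNIV (\<gamma> ^^ K) = (\<lambda>x. x + w) \<circ> n \<circ> inv_into UNIV (\<lambda>x. x + w)"
      unfolding \<gamma>K conj_tr[OF NG[OF n(1)]] w_eq[OF n(1)] ..
    then show "e.act (\<gamma> ^^ K) m = e.act (\<lambda>x. x + w) m"
      using n NG wN funpow_mem[OF \<gamma>, of K] by (simp add: e.act_apply inv_grp)
  qed (simp_all add: e.act_def)
  have "e.cls (\<gamma> ^^ K) = \<one>\<^bsub>Out M\<^esub>"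
    using e.cls_N[OF wN] act_eq by (simp add: e.cls_def)
  then have "e.cls \<gamma> [^]\<^bsub>Out M\<^esub> K = \<one>\<^bsub>Out M\<^esub>"
    using cls.hom_nat_pow[of \<gamma> K] \<gamma> by (simp add: pow)
  moreover have "?F \<noteq> {}" using N_id by blast
  then have "K > 0" using k(1) finF by (simp add: K_def card_gt_0_iff)
  ultimately show ?thesis using O.ord_eq_0[of "e.cls \<gamma>"] \<gamma> by auto
qed

section \<open>The classification\<close>

lemma outer_class_eq_cls:
  assumes "normal_extension N (grp \<Gamma>) (grp M) \<alpha>"
  shows "outer_class \<Gamma> N M \<alpha> \<gamma> = normal_extension.cls N (grp \<Gamma>) (grp M) \<alpha> \<gamma>"
  using assms
  by (simp add: outer_class_def normal_extension.cls_def normal_extension.act_def out_def)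

lemma Iso_pairsD:
  assumes "(\<Gamma>, N) \<in> Iso_pairs \<Delta> M"
  shows "crystal \<Gamma>" "N \<lhd> grp \<Gamma>" "grp N \<cong> grp M" "(grp \<Gamma> Mod N) \<cong> grp \<Delta>"
  using assms by (simp_all add: Iso_pairs_def space_group_iff_crystal)

lemma group_grp_space_group:
  assumes "space_group \<Gamma>"
  shows "group (grp \<Gamma>)"
  using assms subgroup.subgroup_is_group[OF _ group_isometry_group] by (auto simp: space_group_def)

lemma Iso_pairs_extension:
  assumes "space_group M" "(\<Gamma>, N) \<in> Iso_pairs \<Delta> M" "\<alpha> \<in> iso (grp N) (grp M)"
  shows "normal_extension N (grp \<Gamma>) (grp M) \<alpha>"
proof (intro normal_extension.intro normal_extension_axioms.intro)
  show "N \<lhd> grp \<Gamma>" using Iso_pairsD(2)[OF assms(2)] .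
  show "group (grp M)" using assms(1) by (rule group_grp_space_group)
  show "\<alpha> \<in> iso (grp \<Gamma>\<lparr>carrier := N\<rparr>) (grp M)" using assms(3) by simp
qed

text \<open>The correspondence as a relation, with the identification and the representatives
  quantified existentially; it becomes a function only after it has been shown to be independent of
  these choices.\<close>

definition pair_class ::
    "(real^'m \<Rightarrow> real^'m) set \<Rightarrow> (real^'n \<Rightarrow> real^'n) set \<times> (real^'n \<Rightarrow> real^'n) set
      \<Rightarrow> ((real^'m \<Rightarrow> real^'m) \<Rightarrow> real^'m \<Rightarrow> real^'m) set set set \<Rightarrow> bool" where
  "pair_class M p c \<longleftrightarrow> (\<exists>\<alpha> \<gamma>1 \<gamma>2. \<alpha> \<in> iso (grp (snd p)) (grp M) \<and> \<gamma>1 \<in> fst p \<and> \<gamma>2 \<in> fst p \<and>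
     coxeter_generators (grp (fst p) Mod snd p)
       {snd p #>\<^bsub>grp (fst p)\<^esub> \<gamma>1, snd p #>\<^bsub>grp (fst p)\<^esub> \<gamma>2} \<and>
     c = conj_class (Out (grp M)) {outer_class (fst p) (snd p) M \<alpha> \<gamma>1, outer_class (fst p) (snd p) M \<alpha> \<gamma>2})"

lemma pair_classE:
  assumes "space_group M" "(\<Gamma>, N) \<in> Iso_pairs \<Delta> M" "pair_class M (\<Gamma>, N) c"
  obtains \<alpha> \<gamma>1 \<gamma>2 where "normal_extension N (grp \<Gamma>) (grp M) \<alpha>" "\<gamma>1 \<in> carrier (grp \<Gamma>)" "\<gamma>2 \<in> carrier (grp \<Gamma>)"
    "coxeter_generators (grp \<Gamma> Mod N) {N #>\<^bsub>grp \<Gamma>\<^esub> \<gamma>1, N #>\<^bsub>grp \<Gamma>\<^esub> \<gamma>2}"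
    "c = conj_class (Out (grp M)) {normal_extension.cls N (grp \<Gamma>) (grp M) \<alpha> \<gamma>1,
      normal_extension.cls N (grp \<Gamma>) (grp M) \<alpha> \<gamma>2}"
proof -
  obtain \<alpha> \<gamma>1 \<gamma>2 where c: "\<alpha> \<in> iso (grp N) (grp M)" "\<gamma>1 \<in> \<Gamma>" "\<gamma>2 \<in> \<Gamma>"
    "coxeter_generators (grp \<Gamma> Mod N) {N #>\<^bsub>grp \<Gamma>\<^esub> \<gamma>1, N #>\<^bsub>grp \<Gamma>\<^esub> \<gamma>2}"
    "c = conj_class (Out (grp M)) {outer_class \<Gamma> N M \<alpha> \<gamma>1, outer_class \<Gamma> N M \<alpha> \<gamma>2}"
    using assms(3) unfolding pair_class_def fst_conv snd_conv by blast
  note e = Iso_pairs_extension[OF assms(1,2) c(1)]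
  show thesis
    by (rule that[OF e _ _ c(4) c(5)[unfolded outer_class_eq_cls[OF e]]]) (use c(2,3) in simp_all)
qed

lemma pair_class_exists:
  assumes \<Delta>: "infinite_dihedral (grp \<Delta>)" and p: "p \<in> Iso_pairs \<Delta> M"
  shows "\<exists>c. pair_class M p c"
proof -
  obtain \<Gamma> N where pp: "p = (\<Gamma>, N)" by (cases p)
  note P = Iso_pairsD[OF p[unfolded pp]]
  interpret N: normal N "grp \<Gamma>" by (rule P(2))
  interpret Q: group "grp \<Gamma> Mod N" by (rule N.factorgroup_is_group)
  obtain \<alpha> where \<alpha>: "\<alpha> \<in> iso (grp N) (grp M)" using P(3) by (auto simp: is_iso_def)
  have "infinite_dihedral (grp \<Gamma> Mod N)"
    using infinite_dihedral_iso[OF \<Delta> Q.is_group Q.iso_sym[OF P(4)]] .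
  then obtain x y where xy: "coxeter_generators (grp \<Gamma> Mod N) {x, y}"
    unfolding infinite_dihedral_def coxeter_generators_def by blast
  then have "x \<in> carrier (grp \<Gamma> Mod N)" "y \<in> carrier (grp \<Gamma> Mod N)"
    by (simp_all add: Q.coxeter_generators_iff)
  then obtain \<gamma>1 \<gamma>2 where "\<gamma>1 \<in> \<Gamma>" "x = N #>\<^bsub>grp \<Gamma>\<^esub> \<gamma>1" "\<gamma>2 \<in> \<Gamma>" "y = N #>\<^bsub>grp \<Gamma>\<^esub> \<gamma>2"
    by (auto simp: carrier_FactGroup)
  then show ?thesis using \<alpha> xy unfolding pair_class_def pp fst_conv snd_conv by blast
qed

lemma Iso_pairs_quotient_infinite:
  assumes \<Delta>: "infinite_dihedral (grp \<Delta>)" and p: "(\<Gamma>, N) \<in> Iso_pairs \<Delta> M"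
  shows "infinite (carrier (grp \<Gamma> Mod N))"
  using iso_finite[OF Iso_pairsD(4)[OF p]] \<Delta> by (simp add: infinite_dihedral_def)

lemma pair_class_unique:
  assumes M: "space_group M" and \<Delta>: "infinite_dihedral (grp \<Delta>)"
    and pq: "(p, q) \<in> pair_iso_rel \<Delta> M" and c: "pair_class M p c" and d: "pair_class M q d"
  shows "c = d"
proof -
  obtain \<Gamma>1 N1 \<Gamma>2 N2 \<phi> where pp: "p = (\<Gamma>1, N1)" "q = (\<Gamma>2, N2)" and P: "(\<Gamma>1, N1) \<in> Iso_pairs \<Delta> M"
    and Q: "(\<Gamma>2, N2) \<in> Iso_pairs \<Delta> M" and \<phi>: "\<phi> \<in> iso (grp \<Gamma>1) (grp \<Gamma>2)" "\<phi> ` N1 = N2"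
    using pq by (auto simp: pair_iso_rel_def)
  obtain \<alpha>1 \<gamma>1 \<gamma>2 where e1: "normal_extension N1 (grp \<Gamma>1) (grp M) \<alpha>1"
    and \<gamma>: "\<gamma>1 \<in> carrier (grp \<Gamma>1)" "\<gamma>2 \<in> carrier (grp \<Gamma>1)"
      "coxeter_generators (grp \<Gamma>1 Mod N1) {N1 #>\<^bsub>grp \<Gamma>1\<^esub> \<gamma>1, N1 #>\<^bsub>grp \<Gamma>1\<^esub> \<gamma>2}"
    and c': "c = conj_class (Out (grp M)) {normal_extension.cls N1 (grp \<Gamma>1) (grp M) \<alpha>1 \<gamma>1,
      normal_extension.cls N1 (grp \<Gamma>1) (grp M) \<alpha>1 \<gamma>2}"
    by (rule pair_classE[OF M P c[unfolded pp]])
  obtain \<alpha>2 \<delta>1 \<delta>2 where e2: "normal_extension N2 (grp \<Gamma>2) (grp M) \<alpha>2"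
    and \<delta>: "\<delta>1 \<in> carrier (grp \<Gamma>2)" "\<delta>2 \<in> carrier (grp \<Gamma>2)"
      "coxeter_generators (grp \<Gamma>2 Mod N2) {N2 #>\<^bsub>grp \<Gamma>2\<^esub> \<delta>1, N2 #>\<^bsub>grp \<Gamma>2\<^esub> \<delta>2}"
    and d': "d = conj_class (Out (grp M)) {normal_extension.cls N2 (grp \<Gamma>2) (grp M) \<alpha>2 \<delta>1,
      normal_extension.cls N2 (grp \<Gamma>2) (grp M) \<alpha>2 \<delta>2}"
    by (rule pair_classE[OF M Q d[unfolded pp]])
  show ?thesis
    unfolding c' d'
    by (rule outer_pair_class_unique[OF e1 e2 \<phi> Iso_pairs_quotient_infinite[OF \<Delta> Q] \<gamma> \<delta>])
qed

lemma pair_class_injective: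
  assumes M: "space_group M" "group_center (grp M) = {\<one>\<^bsub>grp M\<^esub>}" and \<Delta>: "infinite_dihedral (grp \<Delta>)"
    and p: "p \<in> Iso_pairs \<Delta> M" and q: "q \<in> Iso_pairs \<Delta> M"
    and c: "pair_class M p c" and d: "pair_class M q c"
  shows "(p, q) \<in> pair_iso_rel \<Delta> M"
proof -
  obtain \<Gamma>1 N1 \<Gamma>2 N2 where pp: "p = (\<Gamma>1, N1)" "q = (\<Gamma>2, N2)" by (cases p; cases q)
  note P = p[unfolded pp] and Q = q[unfolded pp]
  obtain \<alpha>1 \<gamma>1 \<gamma>2 where e1: "normal_extension N1 (grp \<Gamma>1) (grp M) \<alpha>1"
    and \<gamma>: "\<gamma>1 \<in> carrier (grp \<Gamma>1)" "\<gamma>2 \<in> carrier (grp \<Gamma>1)"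
      "coxeter_generators (grp \<Gamma>1 Mod N1) {N1 #>\<^bsub>grp \<Gamma>1\<^esub> \<gamma>1, N1 #>\<^bsub>grp \<Gamma>1\<^esub> \<gamma>2}"
    and c': "c = conj_class (Out (grp M)) {normal_extension.cls N1 (grp \<Gamma>1) (grp M) \<alpha>1 \<gamma>1,
      normal_extension.cls N1 (grp \<Gamma>1) (grp M) \<alpha>1 \<gamma>2}"
    by (rule pair_classE[OF M(1) P c[unfolded pp]])
  obtain \<alpha>2 \<delta>1 \<delta>2 where e2: "normal_extension N2 (grp \<Gamma>2) (grp M) \<alpha>2"
    and \<delta>: "\<delta>1 \<in> carrier (grp \<Gamma>2)" "\<delta>2 \<in> carrier (grp \<Gamma>2)"
      "coxeter_generators (grp \<Gamma>2 Mod N2) {N2 #>\<^bsub>grp \<Gamma>2\<^esub> \<delta>1, N2 #>\<^bsub>grp \<Gamma>2\<^esub> \<delta>2}"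
    and d': "c = conj_class (Out (grp M)) {normal_extension.cls N2 (grp \<Gamma>2) (grp M) \<alpha>2 \<delta>1,
      normal_extension.cls N2 (grp \<Gamma>2) (grp M) \<alpha>2 \<delta>2}"
    by (rule pair_classE[OF M(1) Q d[unfolded pp]])
  have "\<exists>\<phi>\<in>iso (grp \<Gamma>1) (grp \<Gamma>2). \<phi> ` N1 = N2"
    by (rule outer_pair_class_injective[OF e1 e2 M(2) Iso_pairs_quotient_infinite[OF \<Delta> P]
          Iso_pairs_quotient_infinite[OF \<Delta> Q] \<gamma> \<delta> c'[symmetric, unfolded d']])
  then show ?thesis using P Q by (simp add: pair_iso_rel_def pp)
qed

text \<open>Coxeter generators have trivial squares, and the outer action preserves this; order 1
  occurs because the outer action may kill a generator. The product of the two classes is the class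
  of \<open>\<gamma>1 \<circ> \<gamma>2\<close>, to which \<open>cls_finite_order\<close>
  applies.\<close>

lemma pair_class_involution_pairs:
  assumes M: "space_group M" and p: "p \<in> Iso_pairs \<Delta> M" and c: "pair_class M p c"
  shows "c \<in> conj_class (Out (grp M)) ` involution_pairs (Out (grp M))"
proof -
  obtain \<Gamma> N where pp: "p = (\<Gamma>, N)" by (cases p)
  note P = p[unfolded pp]
  obtain \<alpha> \<gamma>1 \<gamma>2 where e: "normal_extension N (grp \<Gamma>) (grp M) \<alpha>"
    and \<gamma>: "\<gamma>1 \<in> carrier (grp \<Gamma>)" "\<gamma>2 \<in> carrier (grp \<Gamma>)"
      "coxeter_generators (grp \<Gamma> Mod N) {N #>\<^bsub>grp \<Gamma>\<^esub> \<gamma>1, N #>\<^bsub>grp \<Gamma>\<^esub> \<gamma>2}"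
    and c': "c = conj_class (Out (grp M)) {normal_extension.cls N (grp \<Gamma>) (grp M) \<alpha> \<gamma>1,
      normal_extension.cls N (grp \<Gamma>) (grp M) \<alpha> \<gamma>2}"
    by (rule pair_classE[OF M P c[unfolded pp]])
  interpret e: normal_extension N "grp \<Gamma>" "grp M" \<alpha> by (rule e)
  interpret \<Gamma>: crystal \<Gamma> by (rule Iso_pairsD(1)[OF P])
  interpret O: group "Out (grp M)" by (rule e.M.group_Out)
  interpret Q: group "grp \<Gamma> Mod N" by (rule e.factorgroup_is_group)
  obtain \<rho> where \<rho>: "\<rho> \<in> hom (grp \<Gamma> Mod N) (Out (grp M))"
    "\<And>g. g \<in> carrier (grp \<Gamma>) \<Longrightarrow> \<rho> (N #>\<^bsub>grp \<Gamma>\<^esub> g) = e.cls g"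
    using e.quotient_hom by blast
  interpret \<rho>: group_hom "grp \<Gamma> Mod N" "Out (grp M)" \<rho> using \<rho>(1) by unfold_locales
  have sq: "group.ord (Out (grp M)) (e.cls \<gamma>) \<in> {1, 2}"
    if g: "\<gamma> \<in> carrier (grp \<Gamma>)" "(N #>\<^bsub>grp \<Gamma>\<^esub> \<gamma>) \<otimes>\<^bsub>grp \<Gamma> Mod N\<^esub> (N #>\<^bsub>grp \<Gamma>\<^esub> \<gamma>) = \<one>\<^bsub>grp \<Gamma> Mod N\<^esub>" for \<gamma>
  proof -
    have "N #>\<^bsub>grp \<Gamma>\<^esub> \<gamma> \<in> carrier (grp \<Gamma> Mod N)" using g(1) unfolding carrier_FactGroup by (rule imageI)
    from \<rho>.hom_mult[OF this this, symmetric] have "e.cls \<gamma> \<otimes>\<^bsub>Out (grp M)\<^esub> e.cls \<gamma> = \<one>\<^bsub>Out (grp M)\<^esub>"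
      unfolding g(2) \<rho>.hom_one \<rho>(2)[OF g(1)] .
    then show ?thesis using O.ord_1_2_iff[OF e.cls_closed[OF g(1)]] by simp
  qed
  have fin: "group.ord (Out (grp M)) (e.cls \<gamma>1 \<otimes>\<^bsub>Out (grp M)\<^esub> e.cls \<gamma>2) \<noteq> 0"
    using \<Gamma>.cls_finite_order[OF e \<Gamma>.comp_mem[of \<gamma>1 \<gamma>2]] hom_mult[OF e.cls_hom, of \<gamma>1 \<gamma>2] \<gamma>(1,2) by simp
  have "{e.cls \<gamma>1, e.cls \<gamma>2} \<in> involution_pairs (Out (grp M))"
    unfolding involution_pairs_def
  proof (intro CollectI exI conjI)
    note cox = \<gamma>(3)[unfolded Q.coxeter_generators_iff]
    show "O.ord (e.cls \<gamma>1) \<in> {1, 2}" by (rule sq[OF \<gamma>(1)]) (use cox in blast)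
    show "O.ord (e.cls \<gamma>2) \<in> {1, 2}" by (rule sq[OF \<gamma>(2)]) (use cox in blast)
  qed (use fin \<gamma>(1,2) in simp_all)
  then show ?thesis unfolding c' by (rule imageI)
qed

text \<open>The homomorphism from \<open>\<Delta>\<close> that sends Coxeter generators to
  \<open>u\<close> and \<open>v\<close> has finite image because their product has finite order. It
  is the outer action of an extension by \<open>extension_realization\<close>, and preimages of the
  generators under \<open>\<pi>\<close> serve as representatives.\<close>

lemma pair_class_surjective:
  fixes M :: "(real^'m \<Rightarrow> real^'m) set" and \<Delta> :: "(real^1 \<Rightarrow> real^1) set"
  assumes dim: "CARD('n::finite) = CARD('m::finite) + 1"
    and M: "space_group M" "group_center (grp M) = {\<one>\<^bsub>grp M\<^esub>}"
    and \<Delta>: "space_group \<Delta>" "infinite_dihedral (grp \<Delta>)"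
    and c: "c \<in> conj_class (Out (grp M)) ` involution_pairs (Out (grp M))"
  shows "\<exists>p \<in> Iso_pairs \<Delta> M :: ((real^'n \<Rightarrow> real^'n) set \<times> (real^'n \<Rightarrow> real^'n) set) set. pair_class M p c"
proof -
  interpret M: centerless_crystal M
    using M by (simp add: centerless_crystal_def centerless_crystal_axioms_def space_group_iff_crystal)
  have cr: "crystal \<Delta>" using \<Delta>(1) by (simp add: space_group_iff_crystal)
  interpret DG: group "grp \<Delta>" using \<Delta>(1) by (rule group_grp_space_group)
  let ?O = "Out (grp M)"
  obtain u v where uv: "c = conj_class ?O {u, v}" "u \<in> carrier ?O" "v \<in> carrier ?O"
    "M.O.ord u \<in> {1, 2}" "M.O.ord v \<in> {1, 2}" "M.O.ord (u \<otimes>\<^bsub>?O\<^esub> v) \<noteq> 0"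
    using c unfolding involution_pairs_def by blast
  have sq: "u \<otimes>\<^bsub>?O\<^esub> u = \<one>\<^bsub>?O\<^esub>" "v \<otimes>\<^bsub>?O\<^esub> v = \<one>\<^bsub>?O\<^esub>"
    using uv(2-5) M.O.ord_1_2_iff by simp_all
  obtain a b where ab: "coxeter_generators (grp \<Delta>) {a, b}"
    using \<Delta>(2) unfolding infinite_dihedral_def coxeter_generators_def by blast
  have "infinite (carrier (grp \<Delta>))" using \<Delta>(2) by (simp add: infinite_dihedral_def)
  from DG.coxeter_generators_dihedral[OF this ab]
  interpret D: infinite_dihedral_group "grp \<Delta>" a b .
  obtain \<rho> where \<rho>: "\<rho> \<in> hom (grp \<Delta>) ?O" "\<rho> a = u" "\<rho> b = v"
    "\<rho> ` carrier (grp \<Delta>) = {dih ?O u v k e | k e. True}"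
    by (rule D.hom_exists[OF M.O.is_group uv(2) sq(1) uv(3) sq(2)])
  have fin: "finite (\<rho> ` \<Delta>)" using \<rho>(4) M.O.finite_dih[OF uv(2,3,6)] by simp
  have dim': "DIM(real^'n) = DIM(real^'m) + DIM(real^1)" using dim by simp
  obtain \<Gamma> :: "(real^'n \<Rightarrow> real^'n) set" and N \<alpha> \<pi> where \<Gamma>: "crystal \<Gamma>"
    "normal_extension N (grp \<Gamma>) (grp M) \<alpha>" "\<pi> \<in> hom (grp \<Gamma>) (grp \<Delta>)" "\<pi> ` \<Gamma> = \<Delta>"
    "kernel (grp \<Gamma>) (grp \<Delta>) \<pi> = N"
    "\<And>\<gamma>. \<gamma> \<in> \<Gamma> \<Longrightarrow> normal_extension.cls N (grp \<Gamma>) (grp M) \<alpha> \<gamma> = \<rho> (\<pi> \<gamma>)"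
    by (rule M.extension_realization[OF cr \<rho>(1) fin dim'], rule that, assumption+)
  interpret e: normal_extension N "grp \<Gamma>" "grp M" \<alpha> by (rule \<Gamma>(2))
  interpret Q: group "grp \<Gamma> Mod N" by (rule e.factorgroup_is_group)
  interpret \<pi>: group_hom "grp \<Gamma>" "grp \<Delta>" \<pi>
    using e.is_group DG.is_group \<Gamma>(3) by (simp add: group_hom_def group_hom_axioms_def)
  have surj: "\<pi> ` carrier (grp \<Gamma>) = carrier (grp \<Delta>)" using \<Gamma>(4) by simp
  obtain \<theta> where \<theta>: "\<theta> \<in> iso (grp \<Gamma> Mod N) (grp \<Delta>)"
    "\<And>g. g \<in> carrier (grp \<Gamma>) \<Longrightarrow> \<theta> (N #>\<^bsub>grp \<Gamma>\<^esub> g) = \<pi> g"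
    by (rule \<pi>.kernel_quotient_iso[OF surj, unfolded \<Gamma>(5)], rule that, assumption+)
  have \<alpha>: "\<alpha> \<in> iso (grp N) (grp M)" using e.iso by simp
  have pair: "(\<Gamma>, N) \<in> Iso_pairs \<Delta> M"
    using \<Gamma>(1) e.normal_axioms is_isoI[OF \<alpha>] is_isoI[OF \<theta>(1)]
    by (simp add: Iso_pairs_def space_group_iff_crystal)
  have "a \<in> \<pi> ` \<Gamma>" "b \<in> \<pi> ` \<Gamma>" using D.ab(1,3) \<Gamma>(4) by simp_all
  then obtain \<gamma>1 \<gamma>2 where \<gamma>: "\<gamma>1 \<in> \<Gamma>" "\<pi> \<gamma>1 = a" "\<gamma>2 \<in> \<Gamma>" "\<pi> \<gamma>2 = b" by blast
  have inv: "inv_into (carrier (grp \<Gamma> Mod N)) \<theta> (\<pi> g) = N #>\<^bsub>grp \<Gamma>\<^esub> g" if "g \<in> \<Gamma>" for g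
  proof -
    have "N #>\<^bsub>grp \<Gamma>\<^esub> g \<in> carrier (grp \<Gamma> Mod N)" using that by (auto simp: carrier_FactGroup)
    then show ?thesis
      using \<theta>(1) \<theta>(2)[of g] that inv_into_f_f[of \<theta> "carrier (grp \<Gamma> Mod N)" "N #>\<^bsub>grp \<Gamma>\<^esub> g"]
      by (simp add: iso_def bij_betw_def)
  qed
  have "coxeter_generators (grp \<Gamma> Mod N) {N #>\<^bsub>grp \<Gamma>\<^esub> \<gamma>1, N #>\<^bsub>grp \<Gamma>\<^esub> \<gamma>2}"
    using coxeter_generators_iso[OF DG.is_group Q.is_group Q.iso_set_sym[OF \<theta>(1)] ab]
      inv[OF \<gamma>(1)] inv[OF \<gamma>(3)] \<gamma>(2,4) by simp
  moreover have "outer_class \<Gamma> N M \<alpha> \<gamma>1 = u" "outer_class \<Gamma> N M \<alpha> \<gamma>2 = v"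
    using \<gamma> \<Gamma>(6) \<rho>(2,3) by (simp_all add: outer_class_eq_cls[OF \<Gamma>(2)])
  ultimately have "pair_class M (\<Gamma>, N) c"
    unfolding pair_class_def fst_conv snd_conv uv(1) using \<alpha> \<gamma>(1,3)
    by (intro exI[of _ \<alpha>] exI[of _ \<gamma>1] exI[of _ \<gamma>2]) simp
  then show ?thesis using pair by blast
qed

theorem theorem8:
  fixes M :: "(real^'m \<Rightarrow> real^'m) set" and \<Delta> :: "(real^1 \<Rightarrow> real^1) set" and n :: nat
  assumes "n \<ge> 2" and "CARD('n::finite) = n" and "CARD('m::finite) = n - 1"
    and "space_group M" and "group_center (grp M) = {\<one>\<^bsub>grp M\<^esub>}"
    and "space_group \<Delta>" and "infinite_dihedral (grp \<Delta>)"
  shows "\<exists>F. bij_betw F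
          (Iso \<Delta> M :: ((real^'n \<Rightarrow> real^'n) set \<times> (real^'n \<Rightarrow> real^'n) set) set set)
          (conj_class (Out (grp M)) ` involution_pairs (Out (grp M))) \<and>
        (\<forall>\<Gamma> N \<alpha> \<gamma>1 \<gamma>2.
           (\<Gamma>, N) \<in> Iso_pairs \<Delta> M \<longrightarrow> \<alpha> \<in> iso (grp N) (grp M) \<longrightarrow> \<gamma>1 \<in> \<Gamma> \<longrightarrow> \<gamma>2 \<in> \<Gamma> \<longrightarrow>
           coxeter_generators (grp \<Gamma> Mod N) {N #>\<^bsub>grp \<Gamma>\<^esub> \<gamma>1, N #>\<^bsub>grp \<Gamma>\<^esub> \<gamma>2} \<longrightarrow>
           F (pair_iso_rel \<Delta> M `` {(\<Gamma>, N)}) =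
             conj_class (Out (grp M)) {outer_class \<Gamma> N M \<alpha> \<gamma>1, outer_class \<Gamma> N M \<alpha> \<gamma>2})"
proof -
  let ?P = "Iso_pairs \<Delta> M :: ((real^'n \<Rightarrow> real^'n) set \<times> (real^'n \<Rightarrow> real^'n) set) set"
  let ?R = "pair_iso_rel \<Delta> M :: ((real^'n \<Rightarrow> real^'n) set \<times> (real^'n \<Rightarrow> real^'n) set) rel"
  note M = assms(4,5) and \<Delta> = assms(6,7)
  have dim: "CARD('n) = CARD('m) + 1" using assms(1-3) by simp
  have equiv: "equiv ?P ?R" by (rule equiv_pair_iso_rel)
  \<comment> \<open>The class is taken from an arbitrary member of \<open>X\<close>; by
    \<open>pair_class_unique\<close> all members of an equivalence class give the same one.\<close>
  define F where "F X = (SOME c. \<exists>p\<in>X. pair_class M p c)"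
    for X :: "((real^'n \<Rightarrow> real^'n) set \<times> (real^'n \<Rightarrow> real^'n) set) set"
  have F: "F (?R `` {p}) = c" if p: "p \<in> ?P" and c: "pair_class M p c" for p c
  proof -
    have "p \<in> ?R `` {p}" using equiv p by (rule equiv_class_self)
    then have "\<exists>c. \<exists>q\<in>?R `` {p}. pair_class M q c" using c by blast
    then have "\<exists>q\<in>?R `` {p}. pair_class M q (F (?R `` {p}))" unfolding F_def by (rule someI_ex)
    then obtain q where q: "(p, q) \<in> ?R" "pair_class M q (F (?R `` {p}))" by blast
    show ?thesis using pair_class_unique[OF M(1) \<Delta>(2) q(1) c q(2)] by simp
  qed
  have "bij_betw F (Iso \<Delta> M :: ((real^'n \<Rightarrow> real^'n) set \<times> (real^'n \<Rightarrow> real^'n) set) set set)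
      (conj_class (Out (grp M)) ` involution_pairs (Out (grp M)))"
  proof (rule bij_betw_imageI)
    show "inj_on F (Iso \<Delta> M :: ((real^'n \<Rightarrow> real^'n) set \<times> (real^'n \<Rightarrow> real^'n) set) set set)"
      unfolding Iso_def
    proof (rule inj_onI)
      fix X Y assume "X \<in> ?P // ?R" "Y \<in> ?P // ?R" and eq: "F X = F Y"
      then obtain p q where p: "p \<in> ?P" "X = ?R `` {p}" and q: "q \<in> ?P" "Y = ?R `` {q}"
        by (auto simp: quotient_def)
      obtain c where c: "pair_class M p c" using pair_class_exists[OF \<Delta>(2) p(1)] by blast
      obtain d where d: "pair_class M q d" using pair_class_exists[OF \<Delta>(2) q(1)] by blast
      have "c = d" using F[OF p(1) c] F[OF q(1) d] eq p(2) q(2) by simp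
      then have "(p, q) \<in> ?R" using pair_class_injective[OF M \<Delta>(2) p(1) q(1) c] d by simp
      then show "X = Y" unfolding p(2) q(2) by (rule equiv_class_eq[OF equiv])
    qed
    show "F ` (Iso \<Delta> M :: ((real^'n \<Rightarrow> real^'n) set \<times> (real^'n \<Rightarrow> real^'n) set) set set) =
        conj_class (Out (grp M)) ` involution_pairs (Out (grp M))" (is "?L = ?C")
    proof
      show "?L \<subseteq> ?C"
      proof
        fix c assume "c \<in> ?L"
        then obtain p where p: "p \<in> ?P" "c = F (?R `` {p})" by (auto simp: Iso_def quotient_def)
        obtain d where d: "pair_class M p d" using pair_class_exists[OF \<Delta>(2) p(1)] by blast
        show "c \<in> ?C"
          unfolding p(2) F[OF p(1) d] by (rule pair_class_involution_pairs[OF M(1) p(1) d])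
      qed
      show "?C \<subseteq> ?L"
      proof
        fix c assume "c \<in> ?C"
        then obtain p where p: "p \<in> ?P" "pair_class M p c"
          using pair_class_surjective[OF dim M \<Delta>] by blast
        have "?R `` {p} \<in> Iso \<Delta> M" unfolding Iso_def using p(1) by (rule quotientI)
        then show "c \<in> ?L" using F[OF p] by blast
      qed
    qed
  qed
  moreover have "F (?R `` {(\<Gamma>, N)}) =
      conj_class (Out (grp M)) {outer_class \<Gamma> N M \<alpha> \<gamma>1, outer_class \<Gamma> N M \<alpha> \<gamma>2}"
    if "(\<Gamma>, N) \<in> ?P" "\<alpha> \<in> iso (grp N) (grp M)" "\<gamma>1 \<in> \<Gamma>" "\<gamma>2 \<in> \<Gamma>"
      "coxeter_generators (grp \<Gamma> Mod N) {N #>\<^bsub>grp \<Gamma>\<^esub> \<gamma>1, N #>\<^bsub>grp \<Gamma>\<^esub> \<gamma>2}" for \<Gamma> N \<alpha> \<gamma>1 \<gamma>2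
    using that(1)
  proof (rule F)
    show "pair_class M (\<Gamma>, N) (conj_class (Out (grp M)) {outer_class \<Gamma> N M \<alpha> \<gamma>1, outer_class \<Gamma> N M \<alpha> \<gamma>2})"
      unfolding pair_class_def fst_conv snd_conv using that(2-5) by blast
  qed
  ultimately show ?thesis by blast
qed

end
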